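(* Let $G = G(m, p, n)$, with $p\mid m$, be not of the form $G(1, 1, n)$, $G(2, 1, n)$, $G(2, 2, n)$, $G(m, p, 1) = G(m/p, 1, 1)$, $G(m, m, 2)$, or $G(m, 1, n)$. Then $r=n$ and $\mathrm{Ann}\,\Gamma_G \neq \mathcal{I}_G'$. Hence $$\mathcal{SH}_G^r \neq K[\partial_{x_1},\dots,\partial_{x_n}]\,(\mathcal{SH}_G^r)^{\det}.$$ Moreover, in these cases, the top $x$-degree of a non-zero component of $\mathcal{SH}_G^r$ is strictly higher than the top $x$-degree of a non-zero component of $(\mathcal{SH}_G^r)^{\det}$; so it is not true that for all integers $i$ one has $\mathcal{SH}_G^{i,r}\ne0 \Leftrightarrow 0\le i\le \deg\Delta_G-e_1^*-\cdots-e_r^*$.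
   Context: Setting. $K \subset \mathbb{C}$ is a subfield closed under complex conjugation containing the $m$th roots of unity, $V = K^n$. $G(m,p,n)\subset\mathrm{GL}(V)$ is the group of $n\times n$ matrices with exactly one non-zero entry in each row and column, each such entry an $m$th root of unity, such that the product of the non-zero entries raised to the power $m/p$ is $1$. $r=\dim(V/V^G)$, where $V^G$ is the space of $G$-fixed vectors. Differential forms. $x_1,\dots,x_n$ are the coordinate functions on $V$. $K[x_1,\dots,x_n,\theta_1,\dots,\theta_n]$ is the $K$-algebra with $x_ix_j=x_jx_i$, $x_i\theta_j=\theta_jx_i$, $\theta_i\theta_j=-\theta_j\theta_i$ (so $\theta_i^2=0$), bigraded by $x$-degree and $\theta$-degree. $G$ acts by $K$-algebra automorphisms with $\sigma\cdot x_j=\sum_i\overline{\sigma_{ij}}x_i$, $\sigma\cdot\theta_j=\sum_i\overline{\sigma_{ij}}\theta_i$. $\partial_{x_i}$ is the usual ($\theta$-linear) partial derivative; $\partial_{\theta_i}$ is the $x$-linear interior product: for $i_1<\dots<i_k$, $\partial_{\theta_i}\theta_{i_1}\cdots\theta_{i_k}=(-1)^{\ell-1}\theta_{i_1}\cdots\widehat{\theta_{i_\ell}}\cdots\theta_{i_k}$ if $i=i_\ell$, and $0$ otherwise. For $\omega=\sum c_{\alpha,I}x^\alpha\theta_{i_1}\cdots\theta_{i_k}$ put $\partial_\omega=\sum\overline{c_{\alpha,I}}\,\partial_{x_1}^{\alpha_1}\cdots\partial_{x_n}^{\alpha_n}\partial_{\theta_{i_k}}\cdots\partial_{\theta_{i_1}}$.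 Super harmonics. $\mathcal{J}_G$ is the ideal of $K[x_1,\dots,x_n,\theta_1,\dots,\theta_n]$ generated by the bi-homogeneous $G$-invariant elements of positive total degree, and $\mathcal{SH}_G=\{\eta:\partial_\omega\eta=0\text{ for all }\omega\in\mathcal{J}_G\}$; $\mathcal{SH}_G^{i,k}$ is its component of $x$-degree $i$ and $\theta$-degree $k$, $\mathcal{SH}_G^k=\bigoplus_i\mathcal{SH}_G^{i,k}$, and $(\mathcal{SH}_G^k)^{\det}=\{\eta\in\mathcal{SH}_G^k:\sigma\cdot\eta=\det(\sigma)\eta\ \forall\sigma\in G\}$. $K[\partial_{x_1},\dots,\partial_{x_n}]W$ is the span of all $\partial_g\eta$, $g\in K[x_1,\dots,x_n]$, $\eta\in W$. $\mathcal{H}_G=\mathcal{SH}_G^0\subset K[x_1,\dots,x_n]$ carries the regular representation of $G$; $\Delta_G$ spans its (one-dimensional) top-degree component, and $\Gamma_G$ is a non-zero element, unique up to scalar, of $\{f\in\mathcal{H}_G:\sigma\cdot f=\det(\sigma)^2f\ \forall\sigma\in G\}$. Let $f_1,\dots,f_n$ be algebraically independent homogeneous generators of $K[x_1,\dots,x_n]^G$. Then $\mathcal{I}_G'=\langle\partial_{x_j}f_i:1\le i,j\le n\rangle\subset K[x_1,\dots,x_n]$, and $\mathrm{Ann}\,F=\{g\in K[x_1,\dots,x_n]:\partial_gF=0\}$. Co-exponents. Viewing $\theta_j$ as left multiplication, there are bi-homogeneous $G$-equivariant operators $\mathrm{d}_1,\dots,\mathrm{d}_n\in K[\partial_{x_1},\dots,\partial_{x_n},\theta_1,\dots,\theta_n]$,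 each raising $\theta$-degree by $1$, such that $\{\partial_{f_1}^{\alpha_1}\cdots\partial_{f_n}^{\alpha_n}\mathrm{d}_{i_1}\cdots\mathrm{d}_{i_k}:\alpha_i\ge0,\ 1\le i_1<\dots<i_k\le n,\ 0\le k\le n\}$ is a $K$-basis of the $G$-equivariant operators in that algebra (Orlik--Solomon). The co-exponents $e_i^*$ are the amounts by which the $\mathrm{d}_i$ lower $x$-degree; $e_1^*\le\cdots\le e_r^*$ are the positive ones. *)

theory Defs
  imports
    "HOL-Library.Poly_Mapping"
    "HOL-Library.FuncSet"
    "HOL-Algebra.Subrings"
    "Jordan_Normal_Form.Determinant"
    "Jordan_Normal_Form.VS_Connect"
begin

text \<open>
  Coordinates are numbered \<open>0, \<dots>, n - 1\<close>. The field \<open>K\<close> is a subset of the complex numbers, and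
  the objects over \<open>K\<close> are the complex objects all of whose entries (coefficients) lie in \<open>K\<close>.
\<close>

definition imprim_group :: "nat \<Rightarrow> nat \<Rightarrow> nat \<Rightarrow> complex mat set" where
  "imprim_group m p n = {A \<in> carrier_mat n n.
     (\<forall>i<n. \<exists>!j. j < n \<and> A $$ (i, j) \<noteq> 0) \<and>
     (\<forall>j<n. \<exists>!i. i < n \<and> A $$ (i, j) \<noteq> 0) \<and>
     (\<forall>i<n. \<forall>j<n. A $$ (i, j) \<noteq> 0 \<longrightarrow> A $$ (i, j) ^ m = 1) \<and>
     (\<Prod>(i, j) \<in> {(i, j). i < n \<and> j < n \<and> A $$ (i, j) \<noteq> 0}. A $$ (i, j)) ^ (m div p) = 1}"

definition scalar_ring :: "complex set \<Rightarrow> complex ring" where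
  "scalar_ring K = class_ring\<lparr>carrier := K\<rparr>"

definition vec_space_over :: "complex set \<Rightarrow> nat \<Rightarrow> (complex, complex vec) module" where
  "vec_space_over K n =
     (module_vec TYPE(complex) n)\<lparr>carrier := {v \<in> carrier_vec n. \<forall>i<n. v $ i \<in> K}\<rparr>"

definition fixed_space :: "complex set \<Rightarrow> nat \<Rightarrow> complex mat set \<Rightarrow> complex vec set" where
  "fixed_space K n G = {v \<in> carrier (vec_space_over K n). \<forall>\<sigma>\<in>G. \<sigma> *\<^sub>v v = v}"

definition quotient_module :: "('a, 'b, 'c) module_scheme \<Rightarrow> 'b set \<Rightarrow> ('a, 'b set) module" where
  "quotient_module V W =
     \<lparr>carrier = a_rcosets\<^bsub>V\<^esub> W, mult = undefined, one = undefined, zero = W,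
      add = (\<lambda>X Y. X <+>\<^bsub>V\<^esub> Y),
      smult = (\<lambda>c X. \<Union>v\<in>X. W +>\<^bsub>V\<^esub> (c \<odot>\<^bsub>V\<^esub> v))\<rparr>"

definition refl_rank :: "complex set \<Rightarrow> nat \<Rightarrow> complex mat set \<Rightarrow> nat" where
  "refl_rank K n G =
     vectorspace.dim (scalar_ring K) (quotient_module (vec_space_over K n) (fixed_space K n G))"

text \<open>
  The basis element indexed by \<open>(\<alpha>, I)\<close>, with \<open>I = {i\<^sub>1 < \<dots> < i\<^sub>k}\<close>, is
  \<open>x\<^sup>\<alpha> \<theta>\<^sub>i\<^sub>1 \<cdots> \<theta>\<^sub>i\<^sub>k\<close>.
\<close>

type_synonym form = "((nat \<Rightarrow>\<^sub>0 nat) \<times> nat set) \<Rightarrow>\<^sub>0 complex"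

definition forms :: "complex set \<Rightarrow> nat \<Rightarrow> form set" where
  "forms K n = {\<eta>. \<forall>(\<alpha>, I) \<in> Poly_Mapping.keys \<eta>. Poly_Mapping.keys \<alpha> \<subseteq> {..<n} \<and> I \<subseteq> {..<n} \<and> Poly_Mapping.lookup \<eta> (\<alpha>, I) \<in> K}"

definition polys :: "complex set \<Rightarrow> nat \<Rightarrow> form set" where
  "polys K n = {\<eta> \<in> forms K n. \<forall>(\<alpha>, I) \<in> Poly_Mapping.keys \<eta>. I = {}}"

definition basis_form :: "(nat \<Rightarrow>\<^sub>0 nat) \<Rightarrow> nat set \<Rightarrow> form" where
  "basis_form \<alpha> I = Poly_Mapping.single (\<alpha>, I) 1"

definition scale :: "complex \<Rightarrow> form \<Rightarrow> form" where
  "scale c \<eta> = Poly_Mapping.map (\<lambda>a. c * a) \<eta>"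

definition lin_ext :: "((nat \<Rightarrow>\<^sub>0 nat) \<Rightarrow> nat set \<Rightarrow> form) \<Rightarrow> form \<Rightarrow> form" where
  "lin_ext \<phi> \<eta> = (\<Sum>(\<alpha>, I) \<in> Poly_Mapping.keys \<eta>. scale (Poly_Mapping.lookup \<eta> (\<alpha>, I)) (\<phi> \<alpha> I))"

definition one_form :: form where
  "one_form = basis_form 0 {}"

definition var_x :: "nat \<Rightarrow> form" where
  "var_x i = basis_form (Poly_Mapping.single i 1) {}"

definition var_theta :: "nat \<Rightarrow> form" where
  "var_theta i = basis_form 0 {i}"

text \<open>The sign counts the transpositions needed to sort \<open>\<theta>\<^sub>I \<theta>\<^sub>J\<close>.\<close>

definition basis_times ::
  "(nat \<Rightarrow>\<^sub>0 nat) \<Rightarrow> nat set \<Rightarrow> (nat \<Rightarrow>\<^sub>0 nat) \<Rightarrow> nat set \<Rightarrow> form" where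
  "basis_times \<alpha> I \<beta> J =
     (if I \<inter> J = {}
      then scale ((-1) ^ card {(i, j). i \<in> I \<and> j \<in> J \<and> j < i}) (basis_form (\<alpha> + \<beta>) (I \<union> J))
      else 0)"

definition form_times :: "form \<Rightarrow> form \<Rightarrow> form" where
  "form_times \<eta> \<zeta> = lin_ext (\<lambda>\<alpha> I. lin_ext (\<lambda>\<beta> J. basis_times \<alpha> I \<beta> J) \<zeta>) \<eta>"

definition form_prod :: "form list \<Rightarrow> form" where
  "form_prod \<eta>s = foldr form_times \<eta>s one_form"

definition xdeg :: "(nat \<Rightarrow>\<^sub>0 nat) \<Rightarrow> nat" where
  "xdeg \<alpha> = (\<Sum>i\<in>Poly_Mapping.keys \<alpha>. Poly_Mapping.lookup \<alpha> i)"

definition bihomogeneous :: "int \<Rightarrow> nat \<Rightarrow> form \<Rightarrow> bool" where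
  "bihomogeneous i k \<eta> \<longleftrightarrow> (\<forall>(\<alpha>, I) \<in> Poly_Mapping.keys \<eta>. int (xdeg \<alpha>) = i \<and> card I = k)"

definition x_degree :: "form \<Rightarrow> nat" where
  "x_degree \<eta> = Max ((\<lambda>(\<alpha>, I). xdeg \<alpha>) ` Poly_Mapping.keys \<eta>)"

inductive_set lin_span :: "complex set \<Rightarrow> form set \<Rightarrow> form set" for K S where
  zero: "0 \<in> lin_span K S"
| add: "\<eta> \<in> lin_span K S \<Longrightarrow> c \<in> K \<Longrightarrow> \<zeta> \<in> S \<Longrightarrow> \<eta> + scale c \<zeta> \<in> lin_span K S"

text \<open>The two-sided ideal of the subalgebra \<open>A\<close> generated by \<open>S \<subseteq> A\<close>.\<close>

inductive_set ideal_gen :: "form set \<Rightarrow> form set \<Rightarrow> form set" for A S where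
  zero: "0 \<in> ideal_gen A S"
| gen: "\<eta> \<in> S \<Longrightarrow> \<eta> \<in> ideal_gen A S"
| add: "\<eta> \<in> ideal_gen A S \<Longrightarrow> \<zeta> \<in> ideal_gen A S \<Longrightarrow> \<eta> + \<zeta> \<in> ideal_gen A S"
| left: "\<omega> \<in> A \<Longrightarrow> \<eta> \<in> ideal_gen A S \<Longrightarrow> form_times \<omega> \<eta> \<in> ideal_gen A S"
| right: "\<omega> \<in> A \<Longrightarrow> \<eta> \<in> ideal_gen A S \<Longrightarrow> form_times \<eta> \<omega> \<in> ideal_gen A S"

definition act_x :: "complex mat \<Rightarrow> nat \<Rightarrow> form" where
  "act_x \<sigma> j = (\<Sum>i<dim_row \<sigma>. scale (cnj (\<sigma> $$ (i, j))) (var_x i))"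

definition act_theta :: "complex mat \<Rightarrow> nat \<Rightarrow> form" where
  "act_theta \<sigma> j = (\<Sum>i<dim_row \<sigma>. scale (cnj (\<sigma> $$ (i, j))) (var_theta i))"

definition act :: "complex mat \<Rightarrow> form \<Rightarrow> form" where
  "act \<sigma> = lin_ext (\<lambda>\<alpha> I. form_times
     (form_prod (concat (map (\<lambda>j. replicate (Poly_Mapping.lookup \<alpha> j) (act_x \<sigma> j)) (sorted_list_of_set (Poly_Mapping.keys \<alpha>)))))
     (form_prod (map (act_theta \<sigma>) (sorted_list_of_set I))))"

definition d_x :: "nat \<Rightarrow> form \<Rightarrow> form" where
  "d_x i = lin_ext (\<lambda>\<alpha> I.
     scale (of_nat (Poly_Mapping.lookup \<alpha> i)) (basis_form (\<alpha> - Poly_Mapping.single i 1) I))"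

definition d_theta :: "nat \<Rightarrow> form \<Rightarrow> form" where
  "d_theta i = lin_ext (\<lambda>\<alpha> I.
     if i \<in> I then scale ((-1) ^ card {j \<in> I. j < i}) (basis_form \<alpha> (I - {i})) else 0)"

definition d_x_power :: "(nat \<Rightarrow>\<^sub>0 nat) \<Rightarrow> form \<Rightarrow> form" where
  "d_x_power \<alpha> = foldr (\<lambda>i. d_x i ^^ Poly_Mapping.lookup \<alpha> i) (sorted_list_of_set (Poly_Mapping.keys \<alpha>))"

text \<open>\<open>fold\<close> applies \<open>\<partial>\<^bsub>\<theta>\<^esub>\<close> with the smallest index first, as in
  \<open>\<partial>\<^sub>\<theta>\<^sub>i\<^sub>k \<cdots> \<partial>\<^sub>\<theta>\<^sub>i\<^sub>1\<close>.\<close>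

definition d_form :: "form \<Rightarrow> form \<Rightarrow> form" where
  "d_form \<omega> \<eta> = (\<Sum>(\<alpha>, I) \<in> Poly_Mapping.keys \<omega>.
     scale (cnj (Poly_Mapping.lookup \<omega> (\<alpha>, I))) (d_x_power \<alpha> (fold d_theta (sorted_list_of_set I) \<eta>)))"

definition invariant_ideal :: "complex set \<Rightarrow> nat \<Rightarrow> complex mat set \<Rightarrow> form set" where
  "invariant_ideal K n G = ideal_gen (forms K n)
     {\<omega> \<in> forms K n. (\<exists>i k. bihomogeneous i k \<omega> \<and> i + int k > 0) \<and> (\<forall>\<sigma>\<in>G. act \<sigma> \<omega> = \<omega>)}"

definition super_harmonics :: "complex set \<Rightarrow> nat \<Rightarrow> complex mat set \<Rightarrow> form set" where
  "super_harmonics K n G = {\<eta> \<in> forms K n. \<forall>\<omega> \<in> invariant_ideal K n G. d_form \<omega> \<eta> = 0}"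

definition SH_comp :: "complex set \<Rightarrow> nat \<Rightarrow> complex mat set \<Rightarrow> int \<Rightarrow> nat \<Rightarrow> form set" where
  "SH_comp K n G i k = {\<eta> \<in> super_harmonics K n G. bihomogeneous i k \<eta>}"

definition SH :: "complex set \<Rightarrow> nat \<Rightarrow> complex mat set \<Rightarrow> nat \<Rightarrow> form set" where
  "SH K n G k = {\<Sum>i\<in>F. \<eta> i | F \<eta>. finite F \<and> (\<forall>i\<in>F. \<eta> i \<in> SH_comp K n G i k)}"

definition SH_det :: "complex set \<Rightarrow> nat \<Rightarrow> complex mat set \<Rightarrow> nat \<Rightarrow> form set" where
  "SH_det K n G k = {\<eta> \<in> SH K n G k. \<forall>\<sigma>\<in>G. act \<sigma> \<eta> = scale (det \<sigma>) \<eta>}"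

definition diff_closure :: "complex set \<Rightarrow> nat \<Rightarrow> form set \<Rightarrow> form set" where
  "diff_closure K n W = lin_span K {d_form g \<eta> | g \<eta>. g \<in> polys K n \<and> \<eta> \<in> W}"

definition is_top_degree :: "(int \<Rightarrow> form set) \<Rightarrow> int \<Rightarrow> bool" where
  "is_top_degree C t \<longleftrightarrow> C t \<noteq> {0} \<and> (\<forall>i. C i \<noteq> {0} \<longrightarrow> i \<le> t)"

definition is_Delta :: "complex set \<Rightarrow> nat \<Rightarrow> complex mat set \<Rightarrow> form \<Rightarrow> bool" where
  "is_Delta K n G \<Delta> \<longleftrightarrow>
     (\<exists>t. is_top_degree (\<lambda>i. SH_comp K n G i 0) t \<and> SH_comp K n G t 0 = {scale c \<Delta> | c. c \<in> K})"

definition is_Gamma :: "complex set \<Rightarrow> nat \<Rightarrow> complex mat set \<Rightarrow> form \<Rightarrow> bool" where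
  "is_Gamma K n G \<Gamma> \<longleftrightarrow>
     \<Gamma> \<noteq> 0 \<and> \<Gamma> \<in> SH K n G 0 \<and> (\<forall>\<sigma>\<in>G. act \<sigma> \<Gamma> = scale ((det \<sigma>)\<^sup>2) \<Gamma>)"

text \<open>The value of the polynomial \<open>P\<close> at \<open>x\<^sub>i = f i\<close>.\<close>

definition subst_poly :: "(nat \<Rightarrow> form) \<Rightarrow> form \<Rightarrow> form" where
  "subst_poly f = lin_ext (\<lambda>\<alpha> I.
     form_prod (concat (map (\<lambda>i. replicate (Poly_Mapping.lookup \<alpha> i) (f i)) (sorted_list_of_set (Poly_Mapping.keys \<alpha>)))))"

definition basic_invariants :: "complex set \<Rightarrow> nat \<Rightarrow> complex mat set \<Rightarrow> (nat \<Rightarrow> form) \<Rightarrow> bool" where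
  "basic_invariants K n G f \<longleftrightarrow>
     (\<forall>i<n. f i \<in> polys K n \<and> (\<exists>e. bihomogeneous e 0 (f i))) \<and>
     inj_on (subst_poly f) (polys K n) \<and>
     subst_poly f ` polys K n = {g \<in> polys K n. \<forall>\<sigma>\<in>G. act \<sigma> g = g}"

definition jacobian_ideal :: "complex set \<Rightarrow> nat \<Rightarrow> (nat \<Rightarrow> form) \<Rightarrow> form set" where
  "jacobian_ideal K n f = ideal_gen (polys K n) {d_x j (f i) | i j. i < n \<and> j < n}"

definition Ann :: "complex set \<Rightarrow> nat \<Rightarrow> form \<Rightarrow> form set" where
  "Ann K n F = {g \<in> polys K n. d_form g F = 0}"

text \<open>
  \<open>K[\<partial>\<^sub>x\<^sub>1, \<dots>, \<partial>\<^sub>x\<^sub>n, \<theta>\<^sub>1, \<dots>, \<theta>\<^sub>n]\<close> acts on \<^term>\<open>forms K n\<close>. Since its generators commute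
  up to sign, its elements are exactly the operators \<open>\<Sum> c\<^bsub>\<alpha>,I\<^esub> \<theta>\<^sub>I \<partial>\<^sub>x\<^sup>\<alpha>\<close>, which are
  encoded by forms. There is no conjugation of coefficients here.
\<close>

definition diff_op :: "complex set \<Rightarrow> nat \<Rightarrow> form \<Rightarrow> (form \<Rightarrow> form)" where
  "diff_op K n \<omega> = (\<lambda>\<eta> \<in> forms K n.
     lin_ext (\<lambda>\<alpha> I. form_times (basis_form 0 I) (d_x_power \<alpha> \<eta>)) \<omega>)"

definition equivariant_ops :: "complex set \<Rightarrow> nat \<Rightarrow> complex mat set \<Rightarrow> (form \<Rightarrow> form) set" where
  "equivariant_ops K n G = {D \<in> diff_op K n ` forms K n.
     \<forall>\<sigma>\<in>G. \<forall>\<eta> \<in> forms K n. D (act \<sigma> \<eta>) = act \<sigma> (D \<eta>)}"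

definition op_product :: "(nat \<Rightarrow> form) \<Rightarrow> (nat \<Rightarrow> form \<Rightarrow> form) \<Rightarrow> (nat \<Rightarrow>\<^sub>0 nat) \<Rightarrow> nat set
    \<Rightarrow> form \<Rightarrow> form" where
  "op_product f d \<alpha> I =
     foldr (\<lambda>i. d_form (f i) ^^ Poly_Mapping.lookup \<alpha> i) (sorted_list_of_set (Poly_Mapping.keys \<alpha>)) \<circ>
     foldr d (sorted_list_of_set I)"

text \<open>
  In the last clause \<open>c\<close> ranges over the finitely supported families of coefficients in \<open>K\<close> indexed by
  the pairs \<open>(\<alpha>, I)\<close>; a family of operators is a \<open>K\<close>-basis iff forming linear combinations is a
  bijection from these families of coefficients.
\<close>

definition orlik_solomon_ops :: "complex set \<Rightarrow> nat \<Rightarrow> complex mat set \<Rightarrow> (nat \<Rightarrow> form)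
    \<Rightarrow> (nat \<Rightarrow> form \<Rightarrow> form) \<Rightarrow> (nat \<Rightarrow> nat) \<Rightarrow> bool" where
  "orlik_solomon_ops K n G f d e \<longleftrightarrow>
     (\<forall>i<n. d i \<in> equivariant_ops K n G \<and>
        (\<exists>\<omega> \<in> forms K n. bihomogeneous (int (e i)) 1 \<omega> \<and> d i = diff_op K n \<omega>)) \<and>
     bij_betw (\<lambda>c. \<lambda>\<eta> \<in> forms K n. lin_ext (\<lambda>\<alpha> I. op_product f d \<alpha> I \<eta>) c)
       (forms K n) (equivariant_ops K n G)"

definition coexponents :: "complex set \<Rightarrow> nat \<Rightarrow> complex mat set \<Rightarrow> nat list \<Rightarrow> bool" where
  "coexponents K n G es \<longleftrightarrow>
     (\<exists>f d e. basic_invariants K n G f \<and> orlik_solomon_ops K n G f d e \<and>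
        es = sort (filter (\<lambda>a. 0 < a) (map e [0..<n])))"

end

theory Submission
  imports Defs
begin

text \<open>
  Put \<open>q = m / p\<close>. Everything reduces to bookkeeping of monomials, because the group contains many
  diagonal matrices and the relevant ideals turn out to be monomial.

  The invariants \<open>\<Sum> x\<^sub>i\<^sup>m\<close> and \<open>(x\<^sub>1 \<cdots> x\<^sub>n)\<^sup>q\<close> have, up to scalars, the
  differentials \<open>\<Sum> x\<^sub>j\<^bsup>m-1\<^esup> \<theta>\<^sub>j\<close> and \<open>\<Sum> ((x\<^sub>1 \<cdots> x\<^sub>n)\<^sup>q / x\<^sub>j) \<theta>\<^sub>j\<close>. These invariant forms force
  \<open>F\<close> to be annihilated by all \<open>x\<^sub>j\<^bsup>m-1\<^esup>\<close> and \<open>(x\<^sub>1 \<cdots> x\<^sub>n)\<^sup>q / x\<^sub>j\<close> when \<open>F \<theta>\<^sub>1 \<cdots> \<theta>\<^sub>n\<close> is super harmonic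
  (\<open>top_key_not_bad\<close>). Conversely, every monomial \<open>x\<^sup>\<beta> \<theta>\<^sub>I\<close> of positive degree in an invariant form
  has \<open>x\<^sup>\<beta>\<close> in the ideal generated by these polynomials (\<open>invariant_key_bad\<close>): diagonal matrices make the exponents of
  \<open>x\<^sup>\<beta> \<Prod>\<^bsub>i\<in>I\<^esub> x\<^sub>i\<close> congruent modulo \<open>m\<close> with a residue divisible by \<open>q\<close>, and in the one case that this
  leaves open an exchange of two \<open>\<theta>\<close>'s changes the sign. So the forms \<open>x\<^sup>\<alpha> \<theta>\<^sub>1 \<cdots> \<theta>\<^sub>n\<close> with \<open>x\<^sup>\<alpha>\<close>
  outside the ideal are a basis of the top component.

  Semi-invariance for the determinant leaves the single
  monomial \<open>(x\<^sub>1 \<cdots> x\<^sub>n)\<^bsup>q-2\<^esup>\<close>, where the exponent is \<open>0\<close> for \<open>q = 1\<close> (\<open>SH_det_key\<close>), whereas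
  outside the ideal all exponents but one (but two, if \<open>q = 1\<close>) can be \<open>m - 2\<close>. This gives the strict
  inequality of the top degrees (\<open>det_deg_less_top_deg\<close>), and then \<open>SH\<close> is not generated by derivatives
  of its determinant component, as these do not raise the degree.

  Were \<open>Ann \<Gamma>\<close> equal to the ideal of partial derivatives of basic invariants, it
  would contain \<open>x\<^sub>j\<^bsup>m-1\<^esup>\<close>. That makes \<open>\<Gamma>\<close> a multiple of \<open>(x\<^sub>1 \<cdots> x\<^sub>n)\<^bsup>q-2\<^esup>\<close>, so a small power of
  a single variable annihilates it, but this power is outside the ideal (\<open>Ann_neq_jacobian_ideal\<close>).

  If the degree formula held, its upper end would be the top degree of the top component. It
  suffices to show that \<open>deg \<Delta> - \<Sum> e\<^sub>i\<^sup>*\<close> is at most the top degree \<open>n (q - 2)\<close> of the determinant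
  component, \<open>0\<close> for \<open>q = 1\<close>. The bound \<open>deg \<Delta> \<le> m n (n - 1) / 2 + n (q - 1)\<close> (\<open>Delta_degree_le\<close>) comes
  from rewriting monomials modulo the complete homogeneous symmetric polynomials in the \<open>x\<^sub>i\<^sup>m\<close> and
  \<open>(x\<^sub>1 \<cdots> x\<^sub>n)\<^sup>q\<close>. For the co-exponents, the product \<open>d\<^sub>1 \<cdots> d\<^sub>n\<close> is a non-zero equivariant operator
  \<open>\<theta>\<^sub>1 \<cdots> \<theta>\<^sub>n P(\<partial>)\<close> with \<open>deg P = \<Sum> e\<^sub>i\<^sup>*\<close>. By equivariance the exponents in a monomial of \<open>P\<close> are
  distinct, congruent modulo \<open>m\<close>, and congruent to \<open>1\<close> modulo \<open>q\<close>, so \<open>deg P\<close> is at least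
  \<open>m n (n - 1) / 2\<close>, plus \<open>n\<close> unless \<open>q = 1\<close> (\<open>coexponents_sum_ge\<close>).
\<close>

section \<open>Linear calculus of forms\<close>

abbreviation lk :: "('a \<Rightarrow>\<^sub>0 'b::zero) \<Rightarrow> 'a \<Rightarrow> 'b" where "lk \<equiv> Poly_Mapping.lookup"
abbreviation ks :: "('a \<Rightarrow>\<^sub>0 'b::zero) \<Rightarrow> 'a set" where "ks \<equiv> Poly_Mapping.keys"

abbreviation xpow :: "nat \<Rightarrow> nat \<Rightarrow> (nat \<Rightarrow>\<^sub>0 nat)" where "xpow \<equiv> Poly_Mapping.single"

lemma lookup_scale [simp]: "lk (scale c \<eta>) k = c * lk \<eta> k"
  unfolding scale_def by (simp add: Poly_Mapping.map.rep_eq when_def)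

lemma lookup_basis_form: "lk (basis_form \<alpha> I) k = (if k = (\<alpha>, I) then 1 else 0)"
  unfolding basis_form_def by (auto simp: lookup_single when_def)

lemma keys_basis_form [simp]: "ks (basis_form \<alpha> I) = {(\<alpha>, I)}"
  unfolding basis_form_def by simp

lemma scale_simps [simp]: "scale 1 \<eta> = \<eta>" "scale 0 \<eta> = 0" "scale c 0 = 0"
  "scale c (scale d \<eta>) = scale (c * d) \<eta>"
  by (rule poly_mapping_eqI; simp)+

lemma scale_add: "scale c (\<eta> + \<zeta>) = scale c \<eta> + scale c \<zeta>"
  by (rule poly_mapping_eqI) (simp add: lookup_add algebra_simps)

lemma scale_add_left: "scale (c + d) \<eta> = scale c \<eta> + scale d \<eta>"
  by (rule poly_mapping_eqI) (simp add: lookup_add algebra_simps)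

lemma keys_scale_subset: "ks (scale c \<eta>) \<subseteq> ks \<eta>"
  by (auto simp: in_keys_iff)

lemma keys_scale [simp]: "c \<noteq> 0 \<Longrightarrow> ks (scale c \<eta>) = ks \<eta>"
  by (auto simp: in_keys_iff)

lemma lookup_lin_ext_superset:
  assumes "finite A" "ks \<eta> \<subseteq> A"
  shows "lk (lin_ext \<phi> \<eta>) k = (\<Sum>a\<in>A. lk \<eta> a * lk (\<phi> (fst a) (snd a)) k)"
proof -
  have "lk (lin_ext \<phi> \<eta>) k = (\<Sum>a\<in>ks \<eta>. lk \<eta> a * lk (\<phi> (fst a) (snd a)) k)"
    unfolding lin_ext_def by (simp add: lookup_sum case_prod_unfold)
  also have "\<dots> = (\<Sum>a\<in>A. lk \<eta> a * lk (\<phi> (fst a) (snd a)) k)"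
    by (rule sum.mono_neutral_left) (use assms in \<open>auto simp: in_keys_iff\<close>)
  finally show ?thesis .
qed

lemma lookup_lin_ext:
  "lk (lin_ext \<phi> \<eta>) k = (\<Sum>a\<in>ks \<eta>. lk \<eta> a * lk (\<phi> (fst a) (snd a)) k)"
  by (rule lookup_lin_ext_superset) auto

definition linear_op :: "(form \<Rightarrow> form) \<Rightarrow> bool" where
  "linear_op T \<longleftrightarrow> (\<forall>\<eta> \<zeta>. T (\<eta> + \<zeta>) = T \<eta> + T \<zeta>) \<and> (\<forall>c \<eta>. T (scale c \<eta>) = scale c (T \<eta>))"

lemma linear_op_add: "linear_op T \<Longrightarrow> T (\<eta> + \<zeta>) = T \<eta> + T \<zeta>"
  and linear_op_scale: "linear_op T \<Longrightarrow> T (scale c \<eta>) = scale c (T \<eta>)"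
  by (auto simp: linear_op_def)

lemma linear_op_zero: "linear_op T \<Longrightarrow> T 0 = 0"
  using linear_op_scale[of T 0 0] by simp

lemma linear_op_sum: "linear_op T \<Longrightarrow> T (\<Sum>a\<in>A. \<eta> a) = (\<Sum>a\<in>A. T (\<eta> a))"
  by (induction A rule: infinite_finite_induct) (auto simp: linear_op_zero linear_op_add)

lemma linear_lin_ext: "linear_op (lin_ext \<phi>)"
proof -
  have "lin_ext \<phi> (\<eta> + \<zeta>) = lin_ext \<phi> \<eta> + lin_ext \<phi> \<zeta>" for \<eta> \<zeta>
  proof (rule poly_mapping_eqI)
    fix k
    let ?A = "ks \<eta> \<union> ks \<zeta>"
    have "ks (\<eta> + \<zeta>) \<subseteq> ?A" by (rule Poly_Mapping.keys_add)
    then show "lk (lin_ext \<phi> (\<eta> + \<zeta>)) k = lk (lin_ext \<phi> \<eta> + lin_ext \<phi> \<zeta>) k"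
      by (simp add: lookup_add lookup_lin_ext_superset[of ?A] sum.distrib ring_distribs)
  qed
  moreover have "lin_ext \<phi> (scale c \<eta>) = scale c (lin_ext \<phi> \<eta>)" for c \<eta>
    by (rule poly_mapping_eqI)
      (simp add: lookup_lin_ext_superset[of "ks \<eta>"] keys_scale_subset sum_distrib_left mult.assoc)
  ultimately show ?thesis by (simp add: linear_op_def)
qed

lemmas lin_ext_add = linear_op_add[OF linear_lin_ext]
  and lin_ext_scale = linear_op_scale[OF linear_lin_ext]
  and lin_ext_zero [simp] = linear_op_zero[OF linear_lin_ext]
  and lin_ext_sum = linear_op_sum[OF linear_lin_ext]

lemma lin_ext_basis [simp]: "lin_ext \<phi> (basis_form \<alpha> I) = \<phi> \<alpha> I"
  by (rule poly_mapping_eqI) (simp add: lookup_lin_ext lookup_basis_form)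

lemma form_expand: "\<eta> = (\<Sum>a\<in>ks \<eta>. scale (lk \<eta> a) (basis_form (fst a) (snd a)))"
proof (rule poly_mapping_eqI)
  fix k
  have "(\<Sum>a\<in>ks \<eta>. lk \<eta> a * lk (basis_form (fst a) (snd a)) k)
      = (\<Sum>a\<in>ks \<eta>. if a = k then lk \<eta> a else 0)"
    by (rule sum.cong) (auto simp: lookup_basis_form)
  also have "\<dots> = lk \<eta> k" by (simp add: in_keys_iff)
  finally show "lk \<eta> k = lk (\<Sum>a\<in>ks \<eta>. scale (lk \<eta> a) (basis_form (fst a) (snd a))) k"
    by (simp add: lookup_sum)
qed

lemma linear_op_eqI:
  assumes "linear_op S" "linear_op T"
    and "\<And>\<alpha> I. (\<alpha>, I) \<in> ks \<eta> \<Longrightarrow> S (basis_form \<alpha> I) = T (basis_form \<alpha> I)"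
  shows "S \<eta> = T \<eta>"
proof -
  let ?e = "\<Sum>a\<in>ks \<eta>. scale (lk \<eta> a) (basis_form (fst a) (snd a))"
  have "S ?e = T ?e"
    unfolding linear_op_sum[OF assms(1)] linear_op_sum[OF assms(2)]
      linear_op_scale[OF assms(1)] linear_op_scale[OF assms(2)]
    by (rule sum.cong) (use assms(3) in auto)
  then show ?thesis unfolding form_expand[symmetric] .
qed

lemma linear_op_comp: "linear_op S \<Longrightarrow> linear_op T \<Longrightarrow> linear_op (\<lambda>\<eta>. S (T \<eta>))"
  by (simp add: linear_op_def)

lemma linear_op_plus: "linear_op S \<Longrightarrow> linear_op T \<Longrightarrow> linear_op (\<lambda>\<eta>. S \<eta> + T \<eta>)"
  by (simp add: linear_op_def scale_add algebra_simps)

lemma keys_lin_ext: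
  assumes "k \<in> ks (lin_ext \<phi> \<eta>)"
  obtains \<alpha> I where "(\<alpha>, I) \<in> ks \<eta>" "k \<in> ks (\<phi> \<alpha> I)"
proof -
  from assms have "lk (lin_ext \<phi> \<eta>) k \<noteq> 0" by (simp add: in_keys_iff)
  then obtain a where "a \<in> ks \<eta>" "lk \<eta> a * lk (\<phi> (fst a) (snd a)) k \<noteq> 0"
    unfolding lookup_lin_ext by (meson sum.neutral)
  then show ?thesis using that[of "fst a" "snd a"] by (simp add: in_keys_iff)
qed

subsection \<open>The product of forms\<close>

lemma linear_form_times_left: "linear_op (\<lambda>\<eta>. form_times \<eta> \<zeta>)"
  unfolding form_times_def by (rule linear_lin_ext)

lemma linear_form_times_right: "linear_op (form_times \<eta>)"
proof -
  have *: "linear_op (\<lambda>\<zeta>. lin_ext (\<lambda>\<alpha> I. lin_ext (\<lambda>\<beta> J. basis_times \<alpha> I \<beta> J) \<zeta>) \<eta>)"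
    unfolding linear_op_def
  proof (intro conjI allI)
    fix \<zeta> \<zeta>' :: form and c
    show "lin_ext (\<lambda>\<alpha> I. lin_ext (basis_times \<alpha> I) (\<zeta> + \<zeta>')) \<eta> =
       lin_ext (\<lambda>\<alpha> I. lin_ext (basis_times \<alpha> I) \<zeta>) \<eta> + lin_ext (\<lambda>\<alpha> I. lin_ext (basis_times \<alpha> I) \<zeta>') \<eta>"
      by (rule poly_mapping_eqI)
        (simp add: lookup_lin_ext[of _ \<eta>] lookup_add lin_ext_add sum.distrib ring_distribs)
    show "lin_ext (\<lambda>\<alpha> I. lin_ext (basis_times \<alpha> I) (scale c \<zeta>)) \<eta> =
       scale c (lin_ext (\<lambda>\<alpha> I. lin_ext (basis_times \<alpha> I) \<zeta>) \<eta>)"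
      by (rule poly_mapping_eqI)
        (simp add: lookup_lin_ext[of _ \<eta>] lin_ext_scale sum_distrib_left mult.left_commute)
  qed
  then show ?thesis unfolding form_times_def .
qed

lemma form_times_basis: "form_times (basis_form \<alpha> I) (basis_form \<beta> J) = basis_times \<alpha> I \<beta> J"
  by (simp add: form_times_def)

lemmas form_times_scale_left = linear_op_scale[OF linear_form_times_left]
  and form_times_scale_right = linear_op_scale[OF linear_form_times_right]

lemma basis_times_empty_left: "basis_times \<alpha> {} \<beta> J = basis_form (\<alpha> + \<beta>) J"
  by (simp add: basis_times_def)

lemma form_times_one_left [simp]: "form_times one_form \<eta> = \<eta>"
  by (rule linear_op_eqI[of "form_times one_form" "\<lambda>\<eta>. \<eta>" \<eta>])
    (auto simp: linear_form_times_right one_form_def form_times_basis basis_times_empty_left,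
      simp add: linear_op_def)

lemma basis_times_empty_right: "basis_times \<alpha> I \<beta> {} = basis_form (\<alpha> + \<beta>) I"
  by (simp add: basis_times_def)

lemma form_times_one_right [simp]: "form_times \<eta> one_form = \<eta>"
  by (rule linear_op_eqI[of "\<lambda>\<eta>. form_times \<eta> one_form" "\<lambda>\<eta>. \<eta>" \<eta>])
    (auto simp: linear_form_times_left one_form_def form_times_basis basis_times_empty_right,
      simp add: linear_op_def)

lemma keys_basis_times:
  "k \<in> ks (basis_times \<alpha> I \<beta> J) \<Longrightarrow> k = (\<alpha> + \<beta>, I \<union> J) \<and> I \<inter> J = {}"
  by (auto simp: basis_times_def in_keys_iff lookup_basis_form split: if_splits)

lemma keys_form_times:
  assumes "k \<in> ks (form_times \<eta> \<zeta>)"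
  obtains \<alpha> I \<beta> J where "(\<alpha>, I) \<in> ks \<eta>" "(\<beta>, J) \<in> ks \<zeta>" "k = (\<alpha> + \<beta>, I \<union> J)" "I \<inter> J = {}"
proof -
  from assms obtain \<alpha> I where 1: "(\<alpha>, I) \<in> ks \<eta>" "k \<in> ks (lin_ext (\<lambda>\<beta> J. basis_times \<alpha> I \<beta> J) \<zeta>)"
    unfolding form_times_def by (rule keys_lin_ext)
  from 1(2) obtain \<beta> J where 2: "(\<beta>, J) \<in> ks \<zeta>" "k \<in> ks (basis_times \<alpha> I \<beta> J)"
    by (rule keys_lin_ext)
  show ?thesis using that 1(1) 2(1) keys_basis_times[OF 2(2)] by blast
qed

subsection \<open>Derivatives\<close>

lemma linear_d_x: "linear_op (d_x i)"
  unfolding d_x_def by (rule linear_lin_ext)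

lemma linear_d_theta: "linear_op (d_theta i)"
  unfolding d_theta_def by (rule linear_lin_ext)

lemma linear_funpow: "linear_op T \<Longrightarrow> linear_op (T ^^ k)"
  by (induction k) (auto simp: linear_op_def)

lemma linear_foldr:
  assumes "\<And>i. i \<in> set xs \<Longrightarrow> linear_op (T i)"
  shows "linear_op (foldr T xs)"
  using assms by (induction xs) (auto simp: linear_op_def)

lemma linear_fold:
  assumes "\<And>i. i \<in> set xs \<Longrightarrow> linear_op (T i)"
  shows "linear_op (fold T xs)"
  using assms by (induction xs) (auto simp: linear_op_def)

lemma linear_d_x_power: "linear_op (d_x_power \<alpha>)"
  unfolding d_x_power_def by (rule linear_foldr) (rule linear_funpow[OF linear_d_x])

lemma d_x_basis: "d_x i (basis_form \<alpha> I) =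
    scale (of_nat (lk \<alpha> i)) (basis_form (\<alpha> - xpow i 1) I)"
  by (simp add: d_x_def)

text \<open>As \<open>\<partial>\<^sub>x\<close> does not involve the \<open>\<theta>\<close>'s, it is a derivation without signs.\<close>

lemma d_x_basis_times:
  "d_x j (basis_times \<alpha> I \<beta> J) =
     form_times (d_x j (basis_form \<alpha> I)) (basis_form \<beta> J)
     + form_times (basis_form \<alpha> I) (d_x j (basis_form \<beta> J))"
proof (cases "I \<inter> J = {}")
  case True
  let ?e = "xpow j (1::nat)"
  let ?b = "basis_form (\<alpha> + \<beta> - ?e) (I \<union> J)"
  define s where "s = (-1 :: complex) ^ card {(i, k). i \<in> I \<and> k \<in> J \<and> k < i}"
  have bt: "basis_times \<alpha>' I \<beta>' J = scale s (basis_form (\<alpha>' + \<beta>') (I \<union> J))" for \<alpha>' \<beta>'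
    using True by (simp add: basis_times_def s_def)
  have 1: "scale (of_nat (lk \<alpha> j) * s) (basis_form (\<alpha> - ?e + \<beta>) (I \<union> J)) = scale (of_nat (lk \<alpha> j) * s) ?b"
  proof (cases "lk \<alpha> j = 0")
    case False
    then have "\<alpha> - ?e + \<beta> = \<alpha> + \<beta> - ?e"
      by (intro poly_mapping_eqI) (auto simp: lookup_add lookup_minus lookup_single when_def)
    then show ?thesis by simp
  qed simp
  have 2: "scale (of_nat (lk \<beta> j) * s) (basis_form (\<alpha> + (\<beta> - ?e)) (I \<union> J)) = scale (of_nat (lk \<beta> j) * s) ?b"
  proof (cases "lk \<beta> j = 0")
    case False
    then have "\<alpha> + (\<beta> - ?e) = \<alpha> + \<beta> - ?e"
      by (intro poly_mapping_eqI) (auto simp: lookup_add lookup_minus lookup_single when_def)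
    then show ?thesis by simp
  qed simp
  have "d_x j (basis_times \<alpha> I \<beta> J) = scale (s * (of_nat (lk \<alpha> j) + of_nat (lk \<beta> j))) ?b"
    unfolding bt linear_op_scale[OF linear_d_x] d_x_basis lookup_add of_nat_add scale_simps(4) ..
  also have "\<dots> = scale (of_nat (lk \<alpha> j) * s) ?b + scale (of_nat (lk \<beta> j) * s) ?b"
    unfolding scale_add_left[symmetric] by (simp only: distrib_left mult.commute)
  finally have "d_x j (basis_times \<alpha> I \<beta> J)
    = scale (of_nat (lk \<alpha> j) * s) ?b + scale (of_nat (lk \<beta> j) * s) ?b" .
  then show ?thesis
    unfolding d_x_basis form_times_scale_left form_times_scale_right form_times_basis bt scale_simps(4) 1 2 .
next
  case False
  then have "basis_times \<alpha>' I \<beta>' J = 0" for \<alpha>' \<beta>' by (simp add: basis_times_def)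
  then show ?thesis
    by (simp add: d_x_basis form_times_scale_left form_times_scale_right form_times_basis
        linear_op_zero[OF linear_d_x])
qed

lemma d_x_form_times:
  "d_x j (form_times \<eta> \<zeta>) = form_times (d_x j \<eta>) \<zeta> + form_times \<eta> (d_x j \<zeta>)"
proof -
  have R1: "linear_op (\<lambda>\<zeta>. d_x j (form_times \<eta> \<zeta>))" for \<eta>
    by (rule linear_op_comp[OF linear_d_x linear_form_times_right])
  have R2: "linear_op (\<lambda>\<zeta>. form_times (d_x j \<eta>) \<zeta> + form_times \<eta> (d_x j \<zeta>))" for \<eta>
    by (rule linear_op_plus[OF linear_form_times_right linear_op_comp[OF linear_form_times_right linear_d_x]])
  have L1: "linear_op (\<lambda>\<eta>. d_x j (form_times \<eta> \<zeta>))"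
    by (rule linear_op_comp[OF linear_d_x linear_form_times_left])
  have L2: "linear_op (\<lambda>\<eta>. form_times (d_x j \<eta>) \<zeta> + form_times \<eta> (d_x j \<zeta>))"
    by (rule linear_op_plus[OF linear_op_comp[OF linear_form_times_left linear_d_x] linear_form_times_left])
  have "d_x j (form_times (basis_form \<alpha> I) \<zeta>)
     = form_times (d_x j (basis_form \<alpha> I)) \<zeta> + form_times (basis_form \<alpha> I) (d_x j \<zeta>)" for \<alpha> I
    by (rule linear_op_eqI[OF R1 R2]) (simp only: form_times_basis d_x_basis_times)
  then show ?thesis by (rule linear_op_eqI[OF L1 L2])
qed

lemma minus_single_eq_iff:
  fixes \<alpha> \<beta> :: "nat \<Rightarrow>\<^sub>0 nat"
  assumes "lk \<alpha> i \<noteq> 0"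
  shows "\<beta> = \<alpha> - xpow i 1 \<longleftrightarrow> \<alpha> = \<beta> + xpow i 1"
  using assms by (auto simp: poly_mapping_eq_iff fun_eq_iff lookup_add lookup_minus lookup_single when_def)

lemma lookup_d_x:
  "lk (d_x i \<eta>) (\<beta>, I) = of_nat (lk \<beta> i + 1) * lk \<eta> (\<beta> + xpow i 1, I)"
proof -
  have "lk (d_x i \<eta>) (\<beta>, I) = (\<Sum>a\<in>ks \<eta>. if a = (\<beta> + xpow i 1, I)
      then of_nat (lk \<beta> i + 1) * lk \<eta> a else 0)"
    unfolding d_x_def lookup_lin_ext
  proof (rule sum.cong[OF refl], goal_cases)
    case (1 a)
    show ?case
    proof (cases "lk (fst a) i = 0")
      case True
      then have "fst a \<noteq> \<beta> + xpow i 1" by (auto simp: lookup_add)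
      with True show ?thesis by (cases a) auto
    next
      case False
      then show ?thesis using minus_single_eq_iff[OF False, of \<beta>]
        by (cases a) (auto simp: lookup_basis_form lookup_add)
    qed
  qed
  then show ?thesis by (simp add: in_keys_iff)
qed

text \<open>The factor by which \<open>\<partial>\<^sup>\<alpha>\<close> multiplies \<open>x\<^sup>\<alpha>\<close>. Multiplying the coefficients of a form by this
  weight turns every \<open>\<partial>\<^sup>\<beta>\<close> into a mere shift of exponents by \<open>\<beta>\<close>.\<close>

definition exp_fact :: "(nat \<Rightarrow>\<^sub>0 nat) \<Rightarrow> complex" where
  "exp_fact \<alpha> = (\<Prod>i\<in>ks \<alpha>. fact (lk \<alpha> i))"

lemma exp_fact_superset: "finite A \<Longrightarrow> ks \<alpha> \<subseteq> A \<Longrightarrow> exp_fact \<alpha> = (\<Prod>i\<in>A. fact (lk \<alpha> i))"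
  unfolding exp_fact_def by (rule prod.mono_neutral_left) (auto simp: in_keys_iff)

lemma exp_fact_nonzero [simp]: "exp_fact \<alpha> \<noteq> 0"
  by (simp add: exp_fact_def)

lemma exp_fact_zero [simp]: "exp_fact 0 = 1"
  by (simp add: exp_fact_def)

lemma exp_fact_add_single:
  "exp_fact (\<beta> + xpow i 1) = of_nat (lk \<beta> i + 1) * exp_fact \<beta>"
proof -
  let ?A = "insert i (ks \<beta>)"
  have "ks (\<beta> + xpow i 1) \<subseteq> ?A"
    using Poly_Mapping.keys_add[of \<beta> "xpow i 1"] by auto
  then have "exp_fact (\<beta> + xpow i 1)
      = (\<Prod>j\<in>?A. fact (lk (\<beta> + xpow i 1) j))"
    by (intro exp_fact_superset) auto
  also have "\<dots> = (\<Prod>j\<in>?A. (if j = i then of_nat (lk \<beta> i + 1) else 1) * fact (lk \<beta> j))"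
    by (rule prod.cong) (auto simp: lookup_add lookup_single when_def)
  also have "\<dots> = of_nat (lk \<beta> i + 1) * (\<Prod>j\<in>?A. fact (lk \<beta> j))"
    by (simp add: prod.distrib)
  also have "(\<Prod>j\<in>?A. fact (lk \<beta> j)) = exp_fact \<beta>"
    by (rule exp_fact_superset[symmetric]) auto
  finally show ?thesis .
qed

lemma lookup_d_x_pow:
  "exp_fact \<beta> * lk ((d_x i ^^ k) \<eta>) (\<beta>, I) =
     exp_fact (\<beta> + xpow i k) * lk \<eta> (\<beta> + xpow i k, I)"
proof (induction k arbitrary: \<beta>)
  case (Suc k)
  have "xpow i (Suc k) = xpow i 1 + xpow i k"
    by (simp flip: single_add)
  then have s: "\<beta> + xpow i (Suc k)
      = (\<beta> + xpow i 1) + xpow i k"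
    by (simp add: add.assoc)
  have "exp_fact \<beta> * lk ((d_x i ^^ Suc k) \<eta>) (\<beta>, I) = exp_fact (\<beta> + xpow i 1)
     * lk ((d_x i ^^ k) \<eta>) (\<beta> + xpow i 1, I)"
    by (simp only: funpow.simps comp_def lookup_d_x exp_fact_add_single) (simp add: mult_ac)
  also have "\<dots> = exp_fact (\<beta> + xpow i (Suc k)) * lk \<eta> (\<beta> + xpow i (Suc k), I)"
    unfolding s by (rule Suc.IH)
  finally show ?case .
qed simp

lemma lookup_d_x_power:
  "exp_fact \<beta> * lk (d_x_power \<alpha> \<eta>) (\<beta>, I) = exp_fact (\<alpha> + \<beta>) * lk \<eta> (\<alpha> + \<beta>, I)"
proof -
  have gen: "exp_fact \<beta> * lk (foldr (\<lambda>i. d_x i ^^ lk \<alpha> i) xs \<eta>) (\<beta>, I) =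
     exp_fact ((\<Sum>i\<leftarrow>xs. xpow i (lk \<alpha> i)) + \<beta>)
       * lk \<eta> ((\<Sum>i\<leftarrow>xs. xpow i (lk \<alpha> i)) + \<beta>, I)" for xs \<beta>
  proof (induction xs arbitrary: \<beta>)
    case (Cons j xs)
    show ?case by (simp add: lookup_d_x_pow Cons.IH add_ac)
  qed simp
  have "(\<Sum>i\<leftarrow>sorted_list_of_set (ks \<alpha>). xpow i (lk \<alpha> i))
      = (\<Sum>i\<in>ks \<alpha>. xpow i (lk \<alpha> i))"
    by (simp add: sum_list_distinct_conv_sum_set)
  also have "\<dots> = \<alpha>"
  proof (rule poly_mapping_eqI)
    fix j
    have "(\<Sum>i\<in>ks \<alpha>. lk (xpow i (lk \<alpha> i)) j) = (\<Sum>i\<in>ks \<alpha>. if i = j then lk \<alpha> i else 0)"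
      by (rule sum.cong) (auto simp: lookup_single when_def)
    then show "lk (\<Sum>i\<in>ks \<alpha>. xpow i (lk \<alpha> i)) j = lk \<alpha> j"
      by (simp add: lookup_sum in_keys_iff)
  qed
  finally show ?thesis unfolding d_x_power_def gen by simp
qed

lemma lookup_d_x_power_eq_0_iff:
  "lk (d_x_power \<alpha> \<eta>) (\<beta>, I) = 0 \<longleftrightarrow> lk \<eta> (\<alpha> + \<beta>, I) = 0"
  using lookup_d_x_power[of \<beta> \<alpha> \<eta> I] exp_fact_nonzero
  by (metis mult_eq_0_iff)

lemma keys_d_x_power: "(\<beta>, I) \<in> ks (d_x_power \<alpha> \<eta>) \<longleftrightarrow> (\<alpha> + \<beta>, I) \<in> ks \<eta>"
  by (simp add: in_keys_iff lookup_d_x_power_eq_0_iff)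

lemma lookup_d_theta:
  "lk (d_theta i \<eta>) (\<beta>, J) =
     (if i \<in> J then 0 else (-1) ^ card {j \<in> J. j < i} * lk \<eta> (\<beta>, insert i J))"
proof -
  have "lk (d_theta i \<eta>) (\<beta>, J) = (\<Sum>a\<in>ks \<eta>. if a = (\<beta>, insert i J)
      then (if i \<in> J then 0 else (-1) ^ card {j \<in> J. j < i} * lk \<eta> a) else 0)"
    unfolding d_theta_def lookup_lin_ext
  proof (rule sum.cong[OF refl], goal_cases)
    case (1 a)
    obtain \<alpha> I where a: "a = (\<alpha>, I)" by fastforce
    show ?case
    proof (cases "i \<in> I")
      case True
      have "J = I - {i} \<longleftrightarrow> I = insert i J \<and> i \<notin> J" using True by auto
      moreover have "{j \<in> insert i J. j < i} = {j \<in> J. j < i}" by auto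
      ultimately show ?thesis using True by (auto simp: a lookup_basis_form)
    next
      case False
      then show ?thesis by (auto simp: a)
    qed
  qed
  then show ?thesis by (simp add: in_keys_iff)
qed

lemma lookup_fold_d_theta:
  assumes "distinct xs"
  shows "\<exists>\<epsilon>. \<epsilon> \<noteq> 0 \<and> lk (fold d_theta xs \<eta>) (\<beta>, J) =
     (if set xs \<inter> J = {} then \<epsilon> * lk \<eta> (\<beta>, J \<union> set xs) else 0)"
  using assms
proof (induction xs arbitrary: \<eta>)
  case (Cons i xs)
  then have "distinct xs" by simp
  from Cons.IH[OF this, of "d_theta i \<eta>"] obtain \<epsilon>
    where e: "\<epsilon> \<noteq> 0" "lk (fold d_theta xs (d_theta i \<eta>)) (\<beta>, J) =
     (if set xs \<inter> J = {} then \<epsilon> * lk (d_theta i \<eta>) (\<beta>, J \<union> set xs) else 0)"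
    by (elim exE conjE)
  show ?case
  proof (intro exI conjI)
    show "\<epsilon> * (-1) ^ card {j \<in> J \<union> set xs. j < i} \<noteq> 0" using e(1) by simp
    have "i \<notin> set xs" using Cons.prems by simp
    then show "lk (fold d_theta (i # xs) \<eta>) (\<beta>, J) = (if set (i # xs) \<inter> J = {}
        then \<epsilon> * (-1) ^ card {j \<in> J \<union> set xs. j < i} * lk \<eta> (\<beta>, J \<union> set (i # xs)) else 0)"
      unfolding fold_Cons comp_def e(2) lookup_d_theta by (cases "i \<in> J") auto
  qed
qed (rule exI[of _ 1], simp)

lemma lookup_d_form:
  "lk (d_form \<omega> \<eta>) k = (\<Sum>a\<in>ks \<omega>. cnj (lk \<omega> a) *
     lk (d_x_power (fst a) (fold d_theta (sorted_list_of_set (snd a)) \<eta>)) k)"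
  by (simp add: d_form_def lookup_sum case_prod_unfold)

lemma linear_d_form: "linear_op (d_form \<omega>)"
proof -
  have l: "linear_op (\<lambda>\<eta>. d_x_power \<alpha> (fold d_theta xs \<eta>))" for \<alpha> xs
    by (intro linear_op_comp[OF linear_d_x_power linear_fold] linear_d_theta)
  show ?thesis unfolding linear_op_def
    by (intro conjI allI; rule poly_mapping_eqI)
      (simp_all add: lookup_d_form lookup_add linear_op_add[OF l] linear_op_scale[OF l]
        sum.distrib ring_distribs sum_distrib_left mult_ac)
qed

lemma d_form_zero [simp]: "d_form 0 \<eta> = 0"
  by (simp add: d_form_def)

lemma keys_d_form:
  assumes "(\<beta>, J) \<in> ks (d_form \<omega> \<eta>)" "\<And>\<alpha> I. (\<alpha>, I) \<in> ks \<omega> \<Longrightarrow> finite I"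
  obtains \<alpha> I where "(\<alpha>, I) \<in> ks \<omega>" "(\<alpha> + \<beta>, J \<union> I) \<in> ks \<eta>" "I \<inter> J = {}"
proof -
  have "lk (d_form \<omega> \<eta>) (\<beta>, J) \<noteq> 0" using assms(1) by (simp add: in_keys_iff)
  then obtain a where a: "a \<in> ks \<omega>"
    "lk (d_x_power (fst a) (fold d_theta (sorted_list_of_set (snd a)) \<eta>)) (\<beta>, J) \<noteq> 0"
    unfolding lookup_d_form by (elim sum.not_neutral_contains_not_neutral) simp
  then have nz: "lk (fold d_theta (sorted_list_of_set (snd a)) \<eta>) (fst a + \<beta>, J) \<noteq> 0"
    by (simp add: lookup_d_x_power_eq_0_iff)
  have fin: "finite (snd a)" using assms(2)[of "fst a" "snd a"] a(1) by simp
  obtain \<epsilon> :: complex where "lk (fold d_theta (sorted_list_of_set (snd a)) \<eta>) (fst a + \<beta>, J)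
     = (if snd a \<inter> J = {} then \<epsilon> * lk \<eta> (fst a + \<beta>, J \<union> snd a) else 0)"
    using lookup_fold_d_theta[of "sorted_list_of_set (snd a)" \<eta> "fst a + \<beta>" J]
    unfolding set_sorted_list_of_set[OF fin] by auto
  with nz have "snd a \<inter> J = {}" "lk \<eta> (fst a + \<beta>, J \<union> snd a) \<noteq> 0" by (auto split: if_splits)
  then show ?thesis using a(1) that[of "fst a" "snd a"] by (simp add: in_keys_iff)
qed

lemma xdeg_superset: "finite A \<Longrightarrow> ks \<alpha> \<subseteq> A \<Longrightarrow> xdeg \<alpha> = (\<Sum>i\<in>A. lk \<alpha> i)"
  unfolding xdeg_def by (rule sum.mono_neutral_left) (auto simp: in_keys_iff)

lemma xdeg_add: "xdeg (\<alpha> + \<beta>) = xdeg \<alpha> + xdeg \<beta>"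
proof -
  have "ks (\<alpha> + \<beta>) \<subseteq> ks \<alpha> \<union> ks \<beta>" by (rule Poly_Mapping.keys_add)
  then show ?thesis
    by (simp add: xdeg_superset[of "ks \<alpha> \<union> ks \<beta>"] lookup_add sum.distrib)
qed

lemma xdeg_single [simp]: "xdeg (xpow i k) = k"
  by (simp add: xdeg_def)

lemma xdeg_zero [simp]: "xdeg 0 = 0"
  by (simp add: xdeg_def)

lemma lookup_d_form_superset:
  assumes "finite A" "ks \<omega> \<subseteq> A"
  shows "lk (d_form \<omega> \<eta>) k = (\<Sum>a\<in>A. cnj (lk \<omega> a) *
     lk (d_x_power (fst a) (fold d_theta (sorted_list_of_set (snd a)) \<eta>)) k)"
  unfolding lookup_d_form
  by (rule sum.mono_neutral_left) (use assms in \<open>auto simp: in_keys_iff\<close>)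

lemma d_form_add_left: "d_form (\<omega> + \<omega>') \<eta> = d_form \<omega> \<eta> + d_form \<omega>' \<eta>"
proof (rule poly_mapping_eqI)
  fix k
  let ?A = "ks \<omega> \<union> ks \<omega>'"
  have "ks (\<omega> + \<omega>') \<subseteq> ?A" by (rule Poly_Mapping.keys_add)
  then show "lk (d_form (\<omega> + \<omega>') \<eta>) k = lk (d_form \<omega> \<eta> + d_form \<omega>' \<eta>) k"
    by (simp add: lookup_add lookup_d_form_superset[of ?A] sum.distrib ring_distribs)
qed

lemma d_form_scale_left: "d_form (scale c \<omega>) \<eta> = scale (cnj c) (d_form \<omega> \<eta>)"
  by (rule poly_mapping_eqI)
    (simp add: lookup_d_form_superset[of "ks \<omega>"] keys_scale_subset sum_distrib_left mult.assoc)

lemma d_form_sum_left: "d_form (\<Sum>a\<in>A. \<omega> a) \<eta> = (\<Sum>a\<in>A. d_form (\<omega> a) \<eta>)"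
  by (induction A rule: infinite_finite_induct) (simp_all add: d_form_add_left)

lemma d_form_basis: "d_form (basis_form \<alpha> I) \<eta> = d_x_power \<alpha> (fold d_theta (sorted_list_of_set I) \<eta>)"
  by (rule poly_mapping_eqI) (simp add: lookup_d_form lookup_basis_form)

definition expo :: "nat \<Rightarrow> (nat \<Rightarrow> nat) \<Rightarrow> (nat \<Rightarrow>\<^sub>0 nat)" where
  "expo n f = (\<Sum>i<n. xpow i (f i))"

lemma lookup_expo: "lk (expo n f) i = (if i < n then f i else 0)"
proof -
  have "lk (expo n f) i = (\<Sum>j<n. if j = i then f i else 0)"
    unfolding expo_def lookup_sum by (rule sum.cong) (auto simp: lookup_single when_def)
  then show ?thesis by simp
qed

lemma keys_expo: "ks (expo n f) \<subseteq> {..<n}"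
  by (auto simp: in_keys_iff lookup_expo split: if_splits)

lemma xdeg_expo: "xdeg (expo n f) = (\<Sum>i<n. f i)"
  by (simp add: xdeg_superset[OF _ keys_expo] lookup_expo)

lemma exponent_eqI:
  assumes "ks \<alpha> \<subseteq> {..<n}" "ks \<beta> \<subseteq> {..<n}" "\<And>i. i < n \<Longrightarrow> lk \<alpha> i = lk \<beta> i"
  shows "\<alpha> = \<beta>"
proof (rule poly_mapping_eqI)
  fix i show "lk \<alpha> i = lk \<beta> i"
  proof (cases "i < n")
    case False
    then have "i \<notin> ks \<alpha>" "i \<notin> ks \<beta>" using assms(1,2) by auto
    then show ?thesis by (simp add: in_keys_iff)
  qed (rule assms(3))
qed

lemma exponent_diff_add:
  assumes "\<And>i. lk \<beta> i \<le> lk \<alpha> i"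
  shows "\<beta> + (\<alpha> - \<beta>) = (\<alpha> :: nat \<Rightarrow>\<^sub>0 nat)"
  by (rule poly_mapping_eqI) (simp add: lookup_add lookup_minus assms)

lemma exponent_single_diff:
  assumes "k \<le> lk \<alpha> i"
  shows "xpow i k + (\<alpha> - xpow i k) = (\<alpha> :: nat \<Rightarrow>\<^sub>0 nat)"
proof (rule exponent_diff_add)
  fix j show "lk (xpow i k) j \<le> lk \<alpha> j"
    using assms by (cases "i = j") (simp_all add: lookup_single_not_eq)
qed

section \<open>Monomial matrices and their action on forms\<close>

fun inversions :: "nat list \<Rightarrow> nat" where
  "inversions [] = 0"
| "inversions (x # xs) = card {y \<in> set xs. y < x} + inversions xs"

lemma inversions_sorted: "sorted xs \<Longrightarrow> inversions xs = 0"
  by (induction xs) (auto simp: leD)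

lemma inversions_swap:
  assumes "b < a" "a \<notin> set ys" "b \<notin> set ys"
  shows "inversions (xs @ a # b # ys) = Suc (inversions (xs @ b # a # ys))"
proof (induction xs)
  case Nil
  have 1: "{y \<in> set (b # ys). y < a} = insert b {y \<in> set ys. y < a}"
    and 2: "{y \<in> set (a # ys). y < b} = {y \<in> set ys. y < b}"
    using assms by auto
  show ?case unfolding append_Nil inversions.simps 1 2 using assms by simp
next
  case (Cons x xs)
  have "{y \<in> set (xs @ a # b # ys). y < x} = {y \<in> set (xs @ b # a # ys). y < x}" by auto
  with Cons show ?case by simp
qed

text \<open>Bubble sort: exchanging an adjacent descent removes exactly one inversion and composes the
  permutation with one transposition.\<close>

lemma sign_eq_inversions:
  assumes "\<pi> permutes {..<n}"
  shows "sign \<pi> = (-1) ^ inversions (map \<pi> [0..<n])"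
  using assms
proof (induction "inversions (map \<pi> [0..<n])" arbitrary: \<pi> rule: less_induct)
  case less
  note inj = permutes_inj[OF less.prems]
  show ?case
  proof (cases "sorted (map \<pi> [0..<n])")
    case True
    have eq: "map \<pi> [0..<n] = [0..<n]"
    proof (rule sorted_distinct_set_unique)
      show "distinct (map \<pi> [0..<n])" using inj by (auto simp: distinct_map intro: inj_on_subset)
      show "set (map \<pi> [0..<n]) = set [0..<n]"
        using permutes_image[OF less.prems] by (simp add: lessThan_atLeast0)
    qed (use True in auto)
    have "\<pi> i = i" if "i < n" for i
    proof -
      have "map \<pi> [0..<n] ! i = [0..<n] ! i" by (simp only: eq)
      then show ?thesis using that by simp
    qed
    then have "\<pi> = id" using permutes_not_in[OF less.prems] by (intro ext) (metis id_apply lessThan_iff)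
    then show ?thesis by (simp add: inversions_sorted)
  next
    case False
    then obtain i where i: "Suc i < n" "\<pi> (Suc i) < \<pi> i"
      by (auto simp: sorted_iff_nth_Suc not_le)
    let ?\<tau> = "Transposition.transpose i (Suc i)"
    have t: "?\<tau> permutes {..<n}" using i by (intro permutes_swap_id) auto
    have c: "(\<pi> \<circ> ?\<tau>) permutes {..<n}" by (rule permutes_compose[OF t less.prems])
    have "[i..<n] = i # Suc i # [i+2..<n]"
      using i upt_conv_Cons[of i n] upt_conv_Cons[of "Suc i" n] by simp
    then have "[0..<n] = [0..<i] @ i # Suc i # [i+2..<n]"
      using i upt_add_eq_append[of 0 i "n - i"] by simp
    note d = this
    have e: "map (\<pi> \<circ> ?\<tau>) [0..<i] = map \<pi> [0..<i]" "map (\<pi> \<circ> ?\<tau>) [i+2..<n] = map \<pi> [i+2..<n]"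
      by (auto simp: Transposition.transpose_def)
    have 1: "map \<pi> [0..<n] = map \<pi> [0..<i] @ \<pi> i # \<pi> (Suc i) # map \<pi> [i+2..<n]"
      by (subst d) simp
    have 2: "map (\<pi> \<circ> ?\<tau>) [0..<n] = map \<pi> [0..<i] @ \<pi> (Suc i) # \<pi> i # map \<pi> [i+2..<n]"
      unfolding e[symmetric] by (subst d) simp
    have inv: "inversions (map \<pi> [0..<n]) = Suc (inversions (map (\<pi> \<circ> ?\<tau>) [0..<n]))"
      unfolding 1 2 by (rule inversions_swap) (use i in \<open>auto simp: inj_eq[OF inj]\<close>)
    then have "sign (\<pi> \<circ> ?\<tau>) = (-1) ^ inversions (map (\<pi> \<circ> ?\<tau>) [0..<n])"
      by (intro less.hyps c) simp
    moreover have "sign (\<pi> \<circ> ?\<tau>) = - sign \<pi>"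
      using less.prems t by (subst sign_compose)
        (auto simp: sign_swap_id intro: permutes_imp_permutation[of "{..<n}"])
    ultimately show ?thesis using inv by simp
  qed
qed

definition mon_mat :: "nat \<Rightarrow> (nat \<Rightarrow> nat) \<Rightarrow> (nat \<Rightarrow> complex) \<Rightarrow> complex mat" where
  "mon_mat n \<pi> c = mat n n (\<lambda>(i, j). if i = \<pi> j then c j else 0)"

lemma det_mon_mat:
  assumes "\<pi> permutes {..<n}"
  shows "det (mon_mat n \<pi> c) = of_int (sign \<pi>) * (\<Prod>j<n. c j)"
proof -
  have "det (mon_mat n \<pi> c) =
      (\<Sum>\<rho> | \<rho> permutes {0..<n}. signof \<rho> * (\<Prod>j<n. mon_mat n \<pi> c $$ (\<rho> j, j)))"
    by (rule det_col) (simp add: mon_mat_def)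
  also have "\<dots> = (\<Sum>\<rho> | \<rho> permutes {0..<n}. if \<rho> = \<pi> then signof \<pi> * (\<Prod>j<n. c j) else 0)"
  proof (rule sum.cong[OF refl])
    fix \<rho> assume "\<rho> \<in> {\<rho>. \<rho> permutes {0..<n}}"
    then have r: "\<rho> permutes {..<n}" by (simp add: lessThan_atLeast0)
    then have lt: "\<rho> j < n" if "j < n" for j using that permutes_in_image[OF r, of j] by simp
    show "signof \<rho> * (\<Prod>j<n. mon_mat n \<pi> c $$ (\<rho> j, j))
        = (if \<rho> = \<pi> then signof \<pi> * (\<Prod>j<n. c j) else 0)"
    proof (cases "\<rho> = \<pi>")
      case True
      have "(\<Prod>j<n. mon_mat n \<pi> c $$ (\<rho> j, j)) = (\<Prod>j<n. c j)"
        by (rule prod.cong) (use lt True in \<open>auto simp: mon_mat_def\<close>)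
      then show ?thesis using True by simp
    next
      case False
      then obtain j where j: "\<rho> j \<noteq> \<pi> j" by auto
      then have "j < n" using r assms by (metis lessThan_iff permutes_not_in)
      with j lt have "(\<Prod>j<n. mon_mat n \<pi> c $$ (\<rho> j, j)) = 0"
        by (intro prod_zero) (auto simp: mon_mat_def intro!: bexI[of _ j])
      then show ?thesis using False by simp
    qed
  qed
  also have "\<dots> = signof \<pi> * (\<Prod>j<n. c j)"
    using assms by (simp add: finite_permutations lessThan_atLeast0)
  finally show ?thesis .
qed

lemma prod_nonzero_entries:
  assumes u: "\<And>i j. i < n \<Longrightarrow> j < n \<Longrightarrow> A $$ (i, j) \<noteq> 0 \<longleftrightarrow> i = \<pi> j"
    and p: "\<And>j. j < n \<Longrightarrow> \<pi> j < n"
  shows "(\<Prod>(i, j) \<in> {(i, j). i < n \<and> j < n \<and> A $$ (i, j) \<noteq> (0::complex)}. A $$ (i, j))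
     = (\<Prod>j<n. A $$ (\<pi> j, j))"
proof -
  have S: "{(i, j). i < n \<and> j < n \<and> A $$ (i, j) \<noteq> 0} = (\<lambda>j. (\<pi> j, j)) ` {..<n}"
  proof (intro Set.set_eqI iffI)
    fix a assume "a \<in> {(i, j). i < n \<and> j < n \<and> A $$ (i, j) \<noteq> 0}"
    then obtain i j where "a = (i, j)" "i < n" "j < n" "A $$ (i, j) \<noteq> 0" by blast
    moreover from this have "i = \<pi> j" using u by blast
    ultimately show "a \<in> (\<lambda>j. (\<pi> j, j)) ` {..<n}" by simp
  next
    fix a assume "a \<in> (\<lambda>j. (\<pi> j, j)) ` {..<n}"
    then obtain j where "a = (\<pi> j, j)" "j < n" by blast
    with u[OF p] p show "a \<in> {(i, j). i < n \<and> j < n \<and> A $$ (i, j) \<noteq> 0}" by simp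
  qed
  show ?thesis unfolding S by (subst prod.reindex) (auto simp: inj_on_def)
qed

lemma mon_mat_in_imprim_group:
  assumes m: "1 \<le> m" and perm: "\<pi> permutes {..<n}" and c: "\<And>j. j < n \<Longrightarrow> c j ^ m = 1"
    and pr: "(\<Prod>j<n. c j) ^ (m div p) = 1"
  shows "mon_mat n \<pi> c \<in> imprim_group m p n"
proof -
  define A where "A = mon_mat n \<pi> c"
  have p: "\<pi> j < n" if "j < n" for j using that permutes_in_image[OF perm, of j] by simp
  have nz: "c j \<noteq> 0" if "j < n" for j
    using c[OF that] m by (metis not_one_le_zero power_0_left zero_neq_one)
  have u: "A $$ (i, j) \<noteq> 0 \<longleftrightarrow> i = \<pi> j" if "i < n" "j < n" for i j
    using that nz by (simp add: A_def mon_mat_def)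
  have e: "A $$ (\<pi> j, j) = c j" if "j < n" for j using that p by (simp add: A_def mon_mat_def)
  have "(\<Prod>(i, j) \<in> {(i, j). i < n \<and> j < n \<and> A $$ (i, j) \<noteq> 0}. A $$ (i, j)) = (\<Prod>j<n. A $$ (\<pi> j, j))"
    by (rule prod_nonzero_entries[OF u p])
  also have "\<dots> = (\<Prod>j<n. c j)" by (rule prod.cong) (simp_all add: e)
  finally have 1: "(\<Prod>(i, j) \<in> {(i, j). i < n \<and> j < n \<and> A $$ (i, j) \<noteq> 0}. A $$ (i, j)) ^ (m div p) = 1"
    using pr by simp
  have 2: "\<exists>!j. j < n \<and> A $$ (i, j) \<noteq> 0" if i: "i < n" for i
  proof (rule ex1I[of _ "inv_into UNIV \<pi> i"])
    have "inv_into UNIV \<pi> i < n" using i permutes_in_image[OF permutes_inv[OF perm], of i] by simp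
    then show "inv_into UNIV \<pi> i < n \<and> A $$ (i, inv_into UNIV \<pi> i) \<noteq> 0"
      using u[OF i] permutes_inverses(1)[OF perm, of i] by simp
    show "j = inv_into UNIV \<pi> i" if "j < n \<and> A $$ (i, j) \<noteq> 0" for j
      using that u[OF i, of j] permutes_inverses(2)[OF perm, of j] by simp
  qed
  have 3: "\<exists>!i. i < n \<and> A $$ (i, j) \<noteq> 0" if "j < n" for j
    using u[OF _ that] p[OF that] by (intro ex1I[of _ "\<pi> j"]) blast+
  have 4: "A $$ (i, j) ^ m = 1" if "i < n" "j < n" "A $$ (i, j) \<noteq> 0" for i j
    using that(3) u[OF that(1,2)] e[OF that(2)] c[OF that(2)] by simp
  have "A \<in> carrier_mat n n" by (simp add: A_def mon_mat_def)
  then have "A \<in> imprim_group m p n" unfolding imprim_group_def mem_Collect_eq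
    using 1 2 3 4 by (intro conjI allI impI)
  then show ?thesis by (simp add: A_def)
qed

lemma imprim_groupE:
  assumes "A \<in> imprim_group m p n"
  obtains \<pi> c where "\<pi> permutes {..<n}" "\<And>j. j < n \<Longrightarrow> c j ^ m = 1"
    "(\<Prod>j<n. c j) ^ (m div p) = 1" "A = mon_mat n \<pi> c"
proof -
  note A = assms[unfolded imprim_group_def mem_Collect_eq]
  have car: "A \<in> carrier_mat n n" using A by (rule conjunct1)
  have row: "\<exists>!j. j < n \<and> A $$ (i, j) \<noteq> 0" if "i < n" for i
    using A[THEN conjunct2, THEN conjunct1] that by (elim allE impE)
  have col: "\<exists>!i. i < n \<and> A $$ (i, j) \<noteq> 0" if "j < n" for j
    using A[THEN conjunct2, THEN conjunct2, THEN conjunct1] that by (elim allE impE)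
  have pw: "A $$ (i, j) ^ m = 1" if "i < n" "j < n" "A $$ (i, j) \<noteq> 0" for i j
    using A[THEN conjunct2, THEN conjunct2, THEN conjunct2, THEN conjunct1] that by simp
  have pr: "(\<Prod>(i, j) \<in> {(i, j). i < n \<and> j < n \<and> A $$ (i, j) \<noteq> 0}. A $$ (i, j)) ^ (m div p) = 1"
    using A[THEN conjunct2, THEN conjunct2, THEN conjunct2, THEN conjunct2] .
  define \<pi> where "\<pi> j = (if j < n then THE i. i < n \<and> A $$ (i, j) \<noteq> 0 else j)" for j
  have p: "\<pi> j < n" "A $$ (\<pi> j, j) \<noteq> 0" if "j < n" for j
    using theI'[OF col[OF that]] that by (simp_all add: \<pi>_def)
  have u: "A $$ (i, j) \<noteq> 0 \<longleftrightarrow> i = \<pi> j" if "i < n" "j < n" for i j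
    using p[OF that(2)] col[OF that(2)] that(1) by blast
  have inj: "inj_on \<pi> {..<n}"
  proof (rule inj_onI)
    fix i j assume "i \<in> {..<n}" "j \<in> {..<n}" and eq: "\<pi> i = \<pi> j"
    then have ij: "i < n" "j < n" by simp_all
    from p(2)[OF ij(1)] have "A $$ (\<pi> j, i) \<noteq> 0" unfolding eq .
    with row[OF p(1)[OF ij(2)]] p(2)[OF ij(2)] ij show "i = j" by blast
  qed
  have img: "\<pi> ` {..<n} = {..<n}"
  proof (rule card_subset_eq)
    show "\<pi> ` {..<n} \<subseteq> {..<n}" using p(1) by blast
  qed (simp_all add: card_image[OF inj])
  have perm: "\<pi> permutes {..<n}"
  proof (rule bij_imp_permutes)
    show "bij_betw \<pi> {..<n} {..<n}" using inj img by (simp only: bij_betw_def)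
    show "\<pi> j = j" if "j \<notin> {..<n}" for j using that by (simp add: \<pi>_def)
  qed
  have eq: "A = mon_mat n \<pi> (\<lambda>j. A $$ (\<pi> j, j))"
  proof (rule eq_matI)
    fix i j assume "i < dim_row (mon_mat n \<pi> (\<lambda>j. A $$ (\<pi> j, j)))"
      "j < dim_col (mon_mat n \<pi> (\<lambda>j. A $$ (\<pi> j, j)))"
    then have ij: "i < n" "j < n" by (simp_all add: mon_mat_def)
    show "A $$ (i, j) = mon_mat n \<pi> (\<lambda>j. A $$ (\<pi> j, j)) $$ (i, j)"
      using ij u[OF ij] by (cases "i = \<pi> j") (simp_all add: mon_mat_def)
  qed (use car in \<open>simp_all add: mon_mat_def\<close>)
  have "(\<Prod>(i, j) \<in> {(i, j). i < n \<and> j < n \<and> A $$ (i, j) \<noteq> 0}. A $$ (i, j)) = (\<Prod>j<n. A $$ (\<pi> j, j))"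
    by (rule prod_nonzero_entries[OF u p(1)])
  with pr have "(\<Prod>j<n. A $$ (\<pi> j, j)) ^ (m div p) = 1" by (rule subst[rotated])
  then show ?thesis using that[OF perm _ _ eq] pw p by blast
qed

lemma form_prod_simps [simp]: "form_prod [] = one_form"
  "form_prod (\<eta> # \<eta>s) = form_times \<eta> (form_prod \<eta>s)"
  by (simp_all add: form_prod_def)

lemma form_prod_theta:
  assumes "distinct (map \<pi> xs)"
  shows "form_prod (map (\<lambda>j. scale (c j) (var_theta (\<pi> j))) xs) =
    scale ((\<Prod>j\<leftarrow>xs. c j) * (-1) ^ inversions (map \<pi> xs)) (basis_form 0 (\<pi> ` set xs))"
  using assms
proof (induction xs)
  case (Cons j xs)
  let ?S = "\<pi> ` set xs"
  have nin: "\<pi> j \<notin> ?S" using Cons.prems by simp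
  have "{(i, k). i \<in> {\<pi> j} \<and> k \<in> ?S \<and> k < i} = Pair (\<pi> j) ` {y \<in> set (map \<pi> xs). y < \<pi> j}"
    by auto
  then have "card {(i, k). i \<in> {\<pi> j} \<and> k \<in> ?S \<and> k < i} = card {y \<in> set (map \<pi> xs). y < \<pi> j}"
    by (simp add: card_image inj_on_def)
  then have "basis_times 0 {\<pi> j} 0 ?S
      = scale ((-1) ^ card {y \<in> set (map \<pi> xs). y < \<pi> j}) (basis_form 0 (insert (\<pi> j) ?S))"
    using nin by (simp add: basis_times_def)
  then show ?case using Cons
    by (simp add: form_times_scale_left form_times_scale_right var_theta_def form_times_basis
        power_add mult_ac)
qed (simp add: one_form_def)

lemma form_prod_x:
  "form_prod (map (\<lambda>j. scale (c j) (basis_form (b j) {})) xs) =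
     scale (\<Prod>j\<leftarrow>xs. c j) (basis_form (\<Sum>j\<leftarrow>xs. b j) {})"
  by (induction xs) (simp_all add: one_form_def form_times_scale_left form_times_scale_right
      form_times_basis basis_times_empty_left mult_ac)

lemma prod_list_concat_replicate:
  fixes f :: "'a \<Rightarrow> 'b::comm_monoid_mult"
  shows "(\<Prod>j\<leftarrow>concat (map (\<lambda>j. replicate (k j) j) xs). f j) = (\<Prod>j\<leftarrow>xs. f j ^ k j)"
  by (induction xs) (simp_all add: prod_list_replicate)

lemma sum_list_replicate_single:
  "sum_list (replicate k (xpow i (1::nat))) = xpow i k"
proof (induction k)
  case (Suc k)
  then show ?case using single_add[of i 1 k] by simp
qed simp

lemma sum_list_concat_replicate:
  "(\<Sum>j\<leftarrow>concat (map (\<lambda>j. replicate (k j) j) xs). xpow (\<pi> j) (1::nat))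
     = (\<Sum>j\<leftarrow>xs. xpow (\<pi> j) (k j))"
  by (induction xs) (simp_all add: sum_list_replicate_single[simplified])

definition perm_exp :: "(nat \<Rightarrow> nat) \<Rightarrow> (nat \<Rightarrow>\<^sub>0 nat) \<Rightarrow> (nat \<Rightarrow>\<^sub>0 nat)" where
  "perm_exp \<pi> \<alpha> = (\<Sum>j\<in>ks \<alpha>. xpow (\<pi> j) (lk \<alpha> j))"

lemma lookup_perm_exp:
  assumes "inj \<pi>"
  shows "lk (perm_exp \<pi> \<alpha>) (\<pi> i) = lk \<alpha> i"
proof -
  have "lk (perm_exp \<pi> \<alpha>) (\<pi> i) = (\<Sum>j\<in>ks \<alpha>. if j = i then lk \<alpha> i else 0)"
    unfolding perm_exp_def lookup_sum
    by (rule sum.cong) (auto simp: lookup_single when_def inj_eq[OF assms])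
  also have "\<dots> = lk \<alpha> i" by (simp add: in_keys_iff)
  finally show ?thesis .
qed

lemma perm_exp_eqI:
  assumes "bij \<pi>" "\<And>i. lk \<beta> (\<pi> i) = lk \<alpha> i"
  shows "perm_exp \<pi> \<alpha> = \<beta>"
proof (rule poly_mapping_eqI)
  fix k
  obtain i where "k = \<pi> i" using assms(1) by (meson bij_pointE)
  then show "lk (perm_exp \<pi> \<alpha>) k = lk \<beta> k"
    using lookup_perm_exp[OF bij_is_inj[OF assms(1)]] assms(2) by simp
qed

lemma perm_exp_inject:
  assumes "inj \<pi>" "perm_exp \<pi> \<alpha> = perm_exp \<pi> \<beta>"
  shows "\<alpha> = \<beta>"
  by (rule poly_mapping_eqI) (metis assms lookup_perm_exp)

lemma perm_exp_id [simp]: "perm_exp id \<alpha> = \<alpha>"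
  by (rule perm_exp_eqI) auto

lemma perm_exp_expo:
  assumes perm: "\<pi> permutes {..<n}" and fg: "\<And>i. i < n \<Longrightarrow> g (\<pi> i) = f i"
  shows "perm_exp \<pi> (expo n f) = expo n g"
proof (rule perm_exp_eqI)
  show "bij \<pi>" using perm by (rule permutes_bij)
  fix i
  have "\<pi> i < n \<longleftrightarrow> i < n" using permutes_in_image[OF perm, of i] by simp
  then show "lk (expo n g) (\<pi> i) = lk (expo n f) i" by (simp add: lookup_expo fg)
qed

text \<open>A monomial matrix with non-zero entries \<open>c\<^sub>j\<close> maps \<open>x\<^sup>\<alpha> \<theta>\<^sub>I\<close> to a multiple of a permuted
  basis element; the multiplier is this weight times the sign from sorting the \<open>\<theta>\<close>'s.\<close>

definition weight :: "nat \<Rightarrow> (nat \<Rightarrow> complex) \<Rightarrow> (nat \<Rightarrow>\<^sub>0 nat) \<Rightarrow> nat set \<Rightarrow> complex" where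
  "weight n c \<alpha> I = (\<Prod>j<n. cnj (c j) ^ (lk \<alpha> j + (if j \<in> I then 1 else 0)))"

definition sort_sign :: "(nat \<Rightarrow> nat) \<Rightarrow> nat set \<Rightarrow> complex" where
  "sort_sign \<pi> I = (-1) ^ inversions (map \<pi> (sorted_list_of_set I))"

lemma sort_sign_id [simp]: "sort_sign id I = 1"
  by (simp add: sort_sign_def inversions_sorted)

lemma act_x_mon_mat:
  assumes "j < n" "\<pi> j < n"
  shows "act_x (mon_mat n \<pi> c) j = scale (cnj (c j)) (basis_form (xpow (\<pi> j) 1) {})"
proof -
  have "act_x (mon_mat n \<pi> c) j = (\<Sum>i<n. if i = \<pi> j then scale (cnj (c j)) (var_x i) else 0)"
    unfolding act_x_def by (rule sum.cong) (use assms in \<open>simp_all add: mon_mat_def\<close>)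
  also have "\<dots> = scale (cnj (c j)) (var_x (\<pi> j))" using assms by (simp add: sum.delta)
  finally show ?thesis by (simp add: var_x_def)
qed

lemma act_theta_mon_mat:
  assumes "j < n" "\<pi> j < n"
  shows "act_theta (mon_mat n \<pi> c) j = scale (cnj (c j)) (var_theta (\<pi> j))"
proof -
  have "act_theta (mon_mat n \<pi> c) j = (\<Sum>i<n. if i = \<pi> j then scale (cnj (c j)) (var_theta i) else 0)"
    unfolding act_theta_def by (rule sum.cong) (use assms in \<open>simp_all add: mon_mat_def\<close>)
  also have "\<dots> = scale (cnj (c j)) (var_theta (\<pi> j))" using assms by (simp add: sum.delta)
  finally show ?thesis .
qed

lemma act_mon_mat_basis:
  assumes perm: "\<pi> permutes {..<n}" and a: "ks \<alpha> \<subseteq> {..<n}" and I: "I \<subseteq> {..<n}"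
  shows "act (mon_mat n \<pi> c) (basis_form \<alpha> I)
     = scale (weight n c \<alpha> I * sort_sign \<pi> I) (basis_form (perm_exp \<pi> \<alpha>) (\<pi> ` I))"
proof -
  have p: "\<pi> j < n" if "j < n" for j using that permutes_in_image[OF perm, of j] by simp
  have finI: "finite I" using I by (rule finite_subset) simp
  let ?A = "sorted_list_of_set (ks \<alpha>)" and ?I = "sorted_list_of_set I"
  have "concat (map (\<lambda>j. replicate (lk \<alpha> j) (act_x (mon_mat n \<pi> c) j)) ?A)
     = map (\<lambda>j. scale (cnj (c j)) (basis_form (xpow (\<pi> j) 1) {}))
         (concat (map (\<lambda>j. replicate (lk \<alpha> j) j) ?A))"
    unfolding map_concat map_map comp_def map_replicate
    by (rule arg_cong[of _ _ concat], rule map_cong[OF refl])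
      (use a p in \<open>auto simp: subset_iff act_x_mon_mat\<close>)
  then have X: "form_prod (concat (map (\<lambda>j. replicate (lk \<alpha> j) (act_x (mon_mat n \<pi> c) j)) ?A))
     = scale (\<Prod>j\<in>ks \<alpha>. cnj (c j) ^ lk \<alpha> j) (basis_form (perm_exp \<pi> \<alpha>) {})"
    by (simp only: form_prod_x prod_list_concat_replicate sum_list_concat_replicate perm_exp_def)
      (simp add: sum_list_distinct_conv_sum_set prod.distinct_set_conv_list[symmetric])
  have "map (act_theta (mon_mat n \<pi> c)) ?I = map (\<lambda>j. scale (cnj (c j)) (var_theta (\<pi> j))) ?I"
    by (rule map_cong[OF refl]) (use I p finI in \<open>auto simp: subset_iff act_theta_mon_mat\<close>)
  moreover have "distinct (map \<pi> ?I)"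
    using permutes_inj_on[OF perm] by (simp add: distinct_map)
  ultimately have "form_prod (map (act_theta (mon_mat n \<pi> c)) ?I)
     = scale ((\<Prod>j\<leftarrow>?I. cnj (c j)) * (-1) ^ inversions (map \<pi> ?I)) (basis_form 0 (\<pi> ` set ?I))"
    by (simp only: form_prod_theta)
  then have T: "form_prod (map (act_theta (mon_mat n \<pi> c)) ?I)
     = scale ((\<Prod>j\<in>I. cnj (c j)) * sort_sign \<pi> I) (basis_form 0 (\<pi> ` I))"
    using finI by (simp add: sort_sign_def prod.distinct_set_conv_list[symmetric])
  have 1: "(\<Prod>j\<in>ks \<alpha>. cnj (c j) ^ lk \<alpha> j) = (\<Prod>j<n. cnj (c j) ^ lk \<alpha> j)"
    by (rule prod.mono_neutral_left) (use a in \<open>auto simp: in_keys_iff\<close>)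
  have 2: "(\<Prod>j\<in>I. cnj (c j)) = (\<Prod>j<n. cnj (c j) ^ (if j \<in> I then 1 else 0))"
    by (rule prod.mono_neutral_cong_left) (use I in auto)
  show ?thesis
    unfolding act_def lin_ext_basis X T weight_def power_add prod.distrib 1 2
    by (simp add: form_times_scale_left form_times_scale_right form_times_basis
        basis_times_empty_left mult_ac)
qed

lemma linear_act: "linear_op (act \<sigma>)"
  unfolding act_def by (rule linear_lin_ext)

lemma forms_keysD:
  assumes "\<eta> \<in> forms K n" "(\<alpha>, I) \<in> ks \<eta>"
  shows "ks \<alpha> \<subseteq> {..<n}" "I \<subseteq> {..<n}" "lk \<eta> (\<alpha>, I) \<in> K" "finite I"
proof -
  show 1: "ks \<alpha> \<subseteq> {..<n}" "I \<subseteq> {..<n}" "lk \<eta> (\<alpha>, I) \<in> K"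
    using assms unfolding forms_def by blast+
  show "finite I" using 1(2) by (rule finite_subset) simp
qed

text \<open>Distinct basis elements have distinct images under the permutation, so coefficients are never
  added up.\<close>

lemma lookup_act_mon_mat:
  assumes perm: "\<pi> permutes {..<n}" and eta: "\<eta> \<in> forms K n"
  shows "lk (act (mon_mat n \<pi> c) \<eta>) (perm_exp \<pi> \<alpha>, \<pi> ` I)
    = weight n c \<alpha> I * sort_sign \<pi> I * lk \<eta> (\<alpha>, I)"
proof -
  note inj = permutes_inj[OF perm]
  have e: "\<eta> = (\<Sum>a\<in>ks \<eta>. scale (lk \<eta> a) (basis_form (fst a) (snd a)))"
    by (rule form_expand)
  have "lk (act (mon_mat n \<pi> c) \<eta>) (perm_exp \<pi> \<alpha>, \<pi> ` I)
    = (\<Sum>a\<in>ks \<eta>. lk \<eta> a * lk (act (mon_mat n \<pi> c) (basis_form (fst a) (snd a))) (perm_exp \<pi> \<alpha>, \<pi> ` I))"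
    by (subst e, simp only: linear_op_sum[OF linear_act] linear_op_scale[OF linear_act] lookup_sum lookup_scale)
  also have "\<dots> = (\<Sum>a\<in>ks \<eta>. if a = (\<alpha>, I) then weight n c \<alpha> I * sort_sign \<pi> I * lk \<eta> (\<alpha>, I) else 0)"
  proof (rule sum.cong[OF refl])
    fix a assume a: "a \<in> ks \<eta>"
    obtain \<beta> J where b: "a = (\<beta>, J)" by fastforce
    have "(perm_exp \<pi> \<alpha>, \<pi> ` I) = (perm_exp \<pi> \<beta>, \<pi> ` J) \<longleftrightarrow> a = (\<alpha>, I)"
      using perm_exp_inject[OF inj, of \<alpha> \<beta>] inj_image_eq_iff[OF inj, of I J] by (auto simp: b)
    then show "lk \<eta> a * lk (act (mon_mat n \<pi> c) (basis_form (fst a) (snd a))) (perm_exp \<pi> \<alpha>, \<pi> ` I)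
      = (if a = (\<alpha>, I) then weight n c \<alpha> I * sort_sign \<pi> I * lk \<eta> (\<alpha>, I) else 0)"
      using forms_keysD[OF eta a[unfolded b]]
      by (simp add: b act_mon_mat_basis[OF perm] lookup_basis_form)
  qed
  also have "\<dots> = weight n c \<alpha> I * sort_sign \<pi> I * lk \<eta> (\<alpha>, I)" by (simp add: in_keys_iff)
  finally show ?thesis .
qed

lemma lookup_act_diag:
  assumes "\<eta> \<in> forms K n"
  shows "lk (act (mon_mat n id c) \<eta>) (\<alpha>, I) = weight n c \<alpha> I * lk \<eta> (\<alpha>, I)"
  using lookup_act_mon_mat[OF permutes_id assms, of c \<alpha> I] by simp

lemma sort_sign_top:
  assumes "\<pi> permutes {..<n}"
  shows "sort_sign \<pi> {..<n} = of_int (sign \<pi>)"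
  unfolding sort_sign_def sign_eq_inversions[OF assms]
  by (simp add: lessThan_atLeast0)

text \<open>Sorting \<open>\<theta>\<^sub>I\<close> after exchanging its two smallest indices takes a single transposition.\<close>

lemma sort_sign_transpose:
  assumes I: "finite I" "a \<in> I" "b \<in> I" "a < b" and min: "\<And>k. k \<in> I \<Longrightarrow> k \<noteq> a \<Longrightarrow> b \<le> k"
  shows "sort_sign (Transposition.transpose a b) I = -1"
proof -
  let ?\<tau> = "Transposition.transpose a b" and ?R = "I - {a, b}"
  have "Min I = a"
    by (rule Min_eqI) (use I min in \<open>auto simp: order.order_iff_strict intro: order.strict_trans2\<close>)
  moreover have "Min (I - {a}) = b" by (rule Min_eqI) (use I min in auto)
  moreover have "I - {a} - {b} = ?R" by blast
  moreover have "I \<noteq> {}" "I - {a} \<noteq> {}" using I by auto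
  ultimately have s: "sorted_list_of_set I = a # b # sorted_list_of_set ?R"
    using I(1) sorted_list_of_set_nonempty[of I] sorted_list_of_set_nonempty[of "I - {a}"] by simp
  have r: "map ?\<tau> (sorted_list_of_set ?R) = sorted_list_of_set ?R"
    by (rule map_idI) (use I in \<open>auto simp: Transposition.transpose_def\<close>)
  have "inversions (map ?\<tau> (sorted_list_of_set I)) = Suc (inversions (a # b # sorted_list_of_set ?R))"
    unfolding s list.map r using inversions_swap[of a b "sorted_list_of_set ?R" "[]"] I by simp
  also have "\<dots> = 1" unfolding s[symmetric] by (simp add: inversions_sorted)
  finally show ?thesis by (simp add: sort_sign_def)
qed

section \<open>Characters of the diagonal subgroup\<close>

definition prim_root :: "nat \<Rightarrow> complex" where
  "prim_root m = cis (2 * pi / real m)"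

lemma prim_root_power_eq_1_iff:
  assumes m: "m \<ge> 1"
  shows "prim_root m ^ k = 1 \<longleftrightarrow> m dvd k"
proof -
  have z: "prim_root m ^ l = cis (2 * pi * real l / real m)" for l
    unfolding prim_root_def Complex.DeMoivre by (simp add: mult_ac)
  have inj: "inj_on (\<lambda>l. cis (2 * pi * real l / real m)) {..<m}"
    using bij_betw_roots_unity[of m] m by (simp add: bij_betw_def)
  have one: "prim_root m ^ m = 1" unfolding z using m by simp
  have "prim_root m ^ (m * (k div m) + k mod m) = (prim_root m ^ m) ^ (k div m) * prim_root m ^ (k mod m)"
    by (simp only: power_add power_mult)
  then have red: "prim_root m ^ k = prim_root m ^ (k mod m)" unfolding mult_div_mod_eq one by simp
  show ?thesis
  proof
    assume "prim_root m ^ k = 1"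
    then have "cis (2 * pi * real (k mod m) / real m) = cis (2 * pi * real 0 / real m)"
      unfolding red z[of "k mod m"] by simp
    then have "k mod m = 0" using m by (intro inj_onD[OF inj]) simp_all
    then show "m dvd k" by (rule mod_0_imp_dvd)
  next
    assume "m dvd k"
    then show "prim_root m ^ k = 1" unfolding red by simp
  qed
qed

text \<open>The group acts on coordinate functions through conjugated entries; for roots of unity these are
  the inverses.\<close>

lemma root_of_unity_cnj:
  assumes "c ^ m = 1" "m \<ge> 1"
  shows "cnj c = inverse c" "c \<noteq> 0"
proof -
  have "norm c = 1" using power_eq_1_iff[OF assms(1)] assms(2) by auto
  then have "c * cnj c = 1" by (simp add: complex_norm_square[symmetric])
  then show "cnj c = inverse c" by (rule inverse_unique[symmetric])
  show "c \<noteq> 0" using \<open>norm c = 1\<close> by auto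
qed

text \<open>Two diagonal matrices test a character: one with \<open>\<zeta>\<close> and \<open>\<zeta>\<^sup>-\<^sup>1\<close> in two places compares two
  exponents modulo \<open>m\<close>, one with \<open>\<zeta>\<^sup>p\<close> in a single place, whose determinant has \<open>q\<close>-th power \<open>1\<close>,
  relates an exponent to the power of the determinant.\<close>

lemma diagonal_character:
  fixes e :: "nat \<Rightarrow> nat"
  assumes char: "\<And>c. (\<And>j. j < n \<Longrightarrow> c j ^ m = 1) \<Longrightarrow> (\<Prod>j<n. c j) ^ q = 1 \<Longrightarrow>
      (\<Prod>j<n. c j ^ e j) * (\<Prod>j<n. c j) ^ k = (1::complex)"
    and m: "m = p * q" "m \<ge> 1" and ij: "i < n" "j < n"
  shows "e i mod m = e j mod m" "q dvd e i + k"
proof -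
  let ?z = "prim_root m"
  have z: "?z ^ m = 1" using prim_root_power_eq_1_iff[OF m(2), of m] by simp
  have znz: "?z \<noteq> 0" using root_of_unity_cnj[OF z m(2)] by simp
  show "q dvd e i + k"
  proof -
    let ?c = "\<lambda>l. if l = i then ?z ^ p else 1"
    have P: "(\<Prod>l<n. ?c l ^ f l) = ?z ^ (p * f i)" for f :: "nat \<Rightarrow> nat"
    proof -
      have "(\<Prod>l<n. ?c l ^ f l) = (\<Prod>l<n. if l = i then ?z ^ (p * f i) else 1)"
        by (rule prod.cong) (auto simp: power_mult)
      then show ?thesis using ij by simp
    qed
    have P1: "(\<Prod>l<n. ?c l) = ?z ^ p" using P[of "\<lambda>_. 1"] by simp
    have "(\<Prod>l<n. ?c l ^ e l) * (\<Prod>l<n. ?c l) ^ k = 1"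
    proof (rule char)
      show "?c l ^ m = 1" for l
      proof -
        have "(?z ^ p) ^ m = (?z ^ m) ^ p" by (simp only: power_mult[symmetric] mult.commute)
        then show ?thesis by (simp add: z)
      qed
      show "(\<Prod>l<n. ?c l) ^ q = 1" unfolding P1
        by (simp only: power_mult[symmetric] m(1)[symmetric] z)
    qed
    then have "?z ^ (p * (e i + k)) = 1"
      unfolding P P1 by (simp only: power_mult[symmetric] power_add[symmetric] distrib_left)
    then have "m dvd p * (e i + k)" by (simp only: prim_root_power_eq_1_iff[OF m(2)])
    then have "p * q dvd p * (e i + k)" by (simp only: m(1)[symmetric])
    moreover have "0 < p" using m by (cases p) simp_all
    ultimately show ?thesis by (simp only: nat_mult_dvd_cancel1)
  qed
  show "e i mod m = e j mod m"
  proof (cases "i = j")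
    case False
    let ?c = "\<lambda>l. if l = i then ?z else if l = j then inverse ?z else 1"
    have P: "(\<Prod>l<n. ?c l ^ f l) = ?z ^ f i * inverse ?z ^ f j" for f :: "nat \<Rightarrow> nat"
    proof -
      have "(\<Prod>l<n. ?c l ^ f l) = (\<Prod>l<n. (if l = i then ?z ^ f i else 1) * (if l = j then inverse ?z ^ f j else 1))"
        by (rule prod.cong) (use False in auto)
      then show ?thesis using ij by (simp add: prod.distrib)
    qed
    have P1: "(\<Prod>l<n. ?c l) = 1" using P[of "\<lambda>_. 1"] znz by simp
    have "(\<Prod>l<n. ?c l ^ e l) * (\<Prod>l<n. ?c l) ^ k = 1"
    proof (rule char)
      show "?c l ^ m = 1" for l using z power_inverse[of ?z m] by simp
      show "(\<Prod>l<n. ?c l) ^ q = 1" unfolding P1 by simp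
    qed
    then have "?z ^ e i * inverse ?z ^ e j = 1" unfolding P P1 by simp
    moreover have "inverse ?z ^ e j * ?z ^ e j = 1"
      unfolding power_mult_distrib[symmetric] using znz by simp
    ultimately have eq: "?z ^ e i = ?z ^ e j" by (metis mult.assoc mult_1_left mult_1_right)
    have *: "a mod m = b mod m" if "a \<le> b" "?z ^ a = ?z ^ b" for a b
    proof -
      have "?z ^ a * ?z ^ (b - a) = ?z ^ b" unfolding power_add[symmetric] using that(1) by simp
      then have "?z ^ a * ?z ^ (b - a) = ?z ^ a * 1" using that(2) by simp
      then have "?z ^ (b - a) = 1" using znz by simp
      then have "m dvd b - a" using prim_root_power_eq_1_iff[OF m(2)] by simp
      then show ?thesis using that(1) by (metis mod_eq_dvd_iff_nat)
    qed
    show ?thesis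
    proof (cases "e i \<le> e j")
      case True
      then show ?thesis using eq by (rule *)
    next
      case False
      then have "e j \<le> e i" by simp
      then show ?thesis using eq[symmetric] by (rule *[symmetric])
    qed
  qed simp
qed

section \<open>The setting\<close>

text \<open>With \<open>q = m / p\<close>, the case \<open>q = 1\<close> is that of the groups \<open>G(m, m, n)\<close>, so the last assumption leaves out
  \<open>G(m, m, 2)\<close>.\<close>

locale imprimitive =
  fixes K :: "complex set" and m p q n :: nat
  assumes subfield: "subfield K class_ring"
    and cnj_closed: "\<And>z. z \<in> K \<Longrightarrow> cnj z \<in> K"
    and roots_in: "\<And>z. z ^ m = 1 \<Longrightarrow> z \<in> K"
    and m_eq: "m = p * q" and m_ge: "3 \<le> m" and p_ge: "2 \<le> p" and n_ge: "2 \<le> n"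
    and n_ge_3: "q = 1 \<Longrightarrow> 3 \<le> n"
begin

abbreviation G :: "complex mat set" where "G \<equiv> imprim_group m p n"

lemma q_ge: "1 \<le> q" using m_eq m_ge by (cases q) auto
lemma q_lt: "q < m" using m_eq p_ge q_ge by (cases p) auto
lemma m_div_p: "m div p = q" using m_eq p_ge by simp
lemma m_ge_1: "1 \<le> m" using m_ge by simp

lemma K_closed:
  shows zero_in: "0 \<in> K" and one_in: "1 \<in> K"
    and add_in: "\<And>a b. a \<in> K \<Longrightarrow> b \<in> K \<Longrightarrow> a + b \<in> K"
    and mult_in: "\<And>a b. a \<in> K \<Longrightarrow> b \<in> K \<Longrightarrow> a * b \<in> K"
    and uminus_in: "\<And>a. a \<in> K \<Longrightarrow> - a \<in> K"
    and inverse_in: "\<And>a. a \<in> K \<Longrightarrow> inverse a \<in> K"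
proof -
  have R: "ring (class_ring :: complex ring)"
    by (rule cring.axioms(1)[OF domain.axioms(1)[OF field.axioms(1)[OF class_field]]])
  note sr = subringE[OF subfieldE(1)[OF subfield]]
  show "0 \<in> K" "1 \<in> K" using sr(2,3) by simp_all
  show "a + b \<in> K" "a * b \<in> K" if "a \<in> K" "b \<in> K" for a b
    using sr(6,7)[OF that] by simp_all
  show "- a \<in> K" if "a \<in> K" for a
  proof -
    have "a \<oplus>\<^bsub>class_ring\<^esub> (\<ominus>\<^bsub>class_ring\<^esub> a) = \<zero>\<^bsub>class_ring\<^esub>" by (rule abelian_group.r_neg[OF ring.is_abelian_group[OF R]]) simp
    then have "\<ominus>\<^bsub>class_ring\<^esub> a = - a" by (simp add: eq_neg_iff_add_eq_0 add.commute)
    then show ?thesis using sr(5)[OF that] by simp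
  qed
  show "inverse a \<in> K" if "a \<in> K" for a
  proof (cases "a = 0")
    case False
    then have a: "a \<in> K - {\<zero>\<^bsub>class_ring\<^esub>}" using that by simp
    have "inverse a = inv\<^bsub>class_ring\<^esub> a"
    proof (rule inverse_unique)
      show "a * inv\<^bsub>class_ring\<^esub> a = 1" using ring.subfield_m_inv(2)[OF R subfield a] by simp
    qed
    then show ?thesis using ring.subfield_m_inv(1)[OF R subfield a] by simp
  qed (use that in simp)
qed

lemma of_nat_in: "of_nat k \<in> K"
  by (induction k) (simp_all add: zero_in one_in add_in)

lemma power_in: "a \<in> K \<Longrightarrow> a ^ k \<in> K"
  by (induction k) (simp_all add: one_in mult_in)

lemma prod_in: "(\<And>i. i \<in> A \<Longrightarrow> f i \<in> K) \<Longrightarrow> prod f A \<in> K"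
  by (induction A rule: infinite_finite_induct) (simp_all add: one_in mult_in)

lemma sum_in: "(\<And>i. i \<in> A \<Longrightarrow> f i \<in> K) \<Longrightarrow> sum f A \<in> K"
  by (induction A rule: infinite_finite_induct) (simp_all add: zero_in add_in)

lemma in_GE:
  assumes "\<sigma> \<in> G"
  obtains \<pi> c where "\<pi> permutes {..<n}" "\<And>j. j < n \<Longrightarrow> c j ^ m = 1" "(\<Prod>j<n. c j) ^ q = 1"
    "\<sigma> = mon_mat n \<pi> c"
  by (rule imprim_groupE[OF assms, unfolded m_div_p]) (rule that)

lemma mon_mat_in_G:
  assumes "\<pi> permutes {..<n}" "\<And>j. j < n \<Longrightarrow> c j ^ m = 1" "(\<Prod>j<n. c j) ^ q = 1"
  shows "mon_mat n \<pi> c \<in> G"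
  using mon_mat_in_imprim_group[OF m_ge_1 assms(1,2)] assms(3) by (simp add: m_div_p)

lemma perm_mat_in_G: "\<pi> permutes {..<n} \<Longrightarrow> mon_mat n \<pi> (\<lambda>_. 1) \<in> G"
  by (rule mon_mat_in_G) simp_all

lemma weight_one [simp]: "weight n (\<lambda>_. 1) \<alpha> I = 1"
  by (simp add: weight_def)

text \<open>The diagonal matrices of the group constrain the monomials of a semi-invariant whose character
  is a power of the determinant.\<close>

lemma semi_invariant_exponents:
  assumes eta: "\<eta> \<in> forms K n" and semi: "\<And>\<sigma>. \<sigma> \<in> G \<Longrightarrow> act \<sigma> \<eta> = scale (det \<sigma> ^ k) \<eta>"
    and key: "(\<alpha>, I) \<in> ks \<eta>" and ij: "i < n" "j < n"
  shows "(lk \<alpha> i + (if i \<in> I then 1 else 0)) mod m = (lk \<alpha> j + (if j \<in> I then 1 else 0)) mod m"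
    and "q dvd lk \<alpha> i + (if i \<in> I then 1 else 0) + k"
proof -
  let ?e = "\<lambda>i. lk \<alpha> i + (if i \<in> I then 1 else 0 :: nat)"
  have char: "(\<Prod>j<n. c j ^ ?e j) * (\<Prod>j<n. c j) ^ k = 1"
    if c: "\<And>j. j < n \<Longrightarrow> c j ^ m = 1" "(\<Prod>j<n. c j) ^ q = 1" for c :: "nat \<Rightarrow> complex"
  proof -
    have "det (mon_mat n id c) = (\<Prod>j<n. c j)" by (simp add: det_mon_mat permutes_id)
    then have "act (mon_mat n id c) \<eta> = scale ((\<Prod>j<n. c j) ^ k) \<eta>"
      using semi[OF mon_mat_in_G[OF permutes_id c]] by simp
    then have "lk (act (mon_mat n id c) \<eta>) (\<alpha>, I) = (\<Prod>j<n. c j) ^ k * lk \<eta> (\<alpha>, I)"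
      by (simp only: lookup_scale)
    then have "weight n c \<alpha> I * lk \<eta> (\<alpha>, I) = (\<Prod>j<n. c j) ^ k * lk \<eta> (\<alpha>, I)"
      unfolding lookup_act_diag[OF eta] .
    then have w: "weight n c \<alpha> I = (\<Prod>j<n. c j) ^ k"
      using key unfolding in_keys_iff by (metis mult_right_cancel)
    have "(\<Prod>j<n. c j ^ ?e j) * weight n c \<alpha> I = (\<Prod>j<n. (c j * cnj (c j)) ^ ?e j)"
      by (simp only: weight_def prod.distrib[symmetric] power_mult_distrib)
    also have "\<dots> = 1"
      by (rule prod.neutral) (use root_of_unity_cnj[OF c(1) m_ge_1] in auto)
    finally show ?thesis unfolding w .
  qed
  show "?e i mod m = ?e j mod m" "q dvd ?e i + k"
    by (rule diagonal_character[of n m q ?e k p i j, OF char m_eq m_ge_1 ij]; assumption)+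
qed

end

section \<open>The monomial ideal of top super harmonics\<close>

context imprimitive
begin

text \<open>The exponents of the monomials in the ideal generated by all \<open>x\<^sub>j\<^bsup>m-1\<^esup>\<close> and
  \<open>(x\<^sub>1 \<cdots> x\<^sub>n)\<^sup>q / x\<^sub>j\<close>, which are, up to scalars, the partial derivatives of the invariants
  \<open>\<Sum> x\<^sub>i\<^sup>m\<close> and \<open>(x\<^sub>1 \<cdots> x\<^sub>n)\<^sup>q\<close>.\<close>

definition bad :: "(nat \<Rightarrow>\<^sub>0 nat) \<Rightarrow> bool" where
  "bad \<alpha> \<longleftrightarrow> (\<exists>i<n. m - 1 \<le> lk \<alpha> i) \<or>
     (\<exists>j<n. \<forall>i<n. (if i = j then q - 1 else q) \<le> lk \<alpha> i)"

lemma bad_add: "bad \<alpha> \<Longrightarrow> bad (\<alpha> + \<beta>)"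
  unfolding bad_def lookup_add by (meson trans_le_add1)

lemma bad_add': "bad \<alpha> \<Longrightarrow> bad (\<beta> + \<alpha>)"
  using bad_add[of \<alpha> \<beta>] by (simp add: add.commute)

text \<open>Let \<open>\<gamma>\<^sub>i\<close> be \<open>\<beta>\<^sub>i\<close>, plus \<open>1\<close> if \<open>i \<in> I\<close>. Invariance under diagonal matrices makes all \<open>\<gamma>\<^sub>i\<close> congruent
  modulo \<open>m\<close> to a residue \<open>c\<close> divisible by \<open>q\<close>. If some \<open>\<gamma>\<^sub>i\<close> is at least \<open>m\<close>, then \<open>x\<^sub>i\<^bsup>m-1\<^esup>\<close> divides \<open>x\<^sup>\<beta>\<close>.
  Otherwise all \<open>\<gamma>\<^sub>i\<close> equal \<open>c \<ge> q\<close>, and \<open>x\<^sup>\<beta>\<close> is divisible by some \<open>(x\<^sub>1 \<cdots> x\<^sub>n)\<^sup>q / x\<^sub>j\<close> unless \<open>c = q\<close>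
  and \<open>I\<close> has two elements.\<close>

lemma invariant_key_bad:
  assumes om: "\<omega> \<in> forms K n" and inv: "\<And>\<sigma>. \<sigma> \<in> G \<Longrightarrow> act \<sigma> \<omega> = \<omega>"
    and key: "(\<beta>, I) \<in> ks \<omega>" and nz: "(\<beta>, I) \<noteq> (0, {})"
  shows "bad \<beta>"
proof -
  note keyD = forms_keysD[OF om key]
  define g where "g i = lk \<beta> i + (if i \<in> I then 1 else 0)" for i
  have inv': "\<And>\<sigma>. \<sigma> \<in> G \<Longrightarrow> act \<sigma> \<omega> = scale (det \<sigma> ^ 0) \<omega>" using inv by simp
  have cong: "g i mod m = g j mod m" if "i < n" "j < n" for i j
    unfolding g_def by (rule semi_invariant_exponents(1)[OF om inv' key that])
  have dvd: "q dvd g i" if "i < n" for i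
    using semi_invariant_exponents(2)[OF om inv' key that that] unfolding g_def by simp
  have le: "g i - 1 \<le> lk \<beta> i" for i unfolding g_def by simp
  obtain i0 where i0: "i0 < n" "g i0 \<noteq> 0"
  proof (cases "I = {}")
    case True
    with nz have "\<beta> \<noteq> 0" by simp
    then have "ks \<beta> \<noteq> {}" by simp
    then obtain i where i: "i \<in> ks \<beta>" by blast
    with keyD(1) have "i < n" by blast
    with i show ?thesis by (intro that[of i]) (simp_all add: g_def in_keys_iff)
  next
    case False
    then obtain i where "i \<in> I" by blast
    with keyD(2) show ?thesis by (intro that[of i]) (auto simp: g_def)
  qed
  show ?thesis
  proof (cases "g i0 mod m = 0")
    case True
    then have "m \<le> g i0" using i0(2) by (simp add: dvd_imp_le mod_eq_0_iff_dvd)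
    then have "m - 1 \<le> lk \<beta> i0" using le[of i0] by linarith
    then show ?thesis unfolding bad_def using i0(1) by blast
  next
    case False
    define c where "c = g i0 mod m"
    have c: "g i mod m = c" if "i < n" for i using cong[OF that i0(1)] by (simp add: c_def)
    have "q dvd c" unfolding c_def using dvd[OF i0(1)] m_eq by (simp add: dvd_mod)
    moreover have "0 < c" using False by (simp add: c_def)
    ultimately have qc: "q \<le> c" by (simp add: dvd_imp_le)
    have cg: "c \<le> g i" if "i < n" for i using c[OF that] by (metis mod_less_eq_dividend)
    show ?thesis
    proof (cases "\<exists>i<n. g i \<noteq> c")
      case True
      then obtain i where i: "i < n" "g i \<noteq> c" by blast
      have "m \<le> g i"
      proof (rule ccontr)
        assume "\<not> m \<le> g i"
        then show False using c[OF i(1)] i(2) by simp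
      qed
      then have "m - 1 \<le> lk \<beta> i" using le[of i] by linarith
      then show ?thesis unfolding bad_def using i(1) by blast
    next
      case False
      then have gc: "g i = c" if "i < n" for i using that by blast
      show ?thesis
      proof (cases "\<exists>a\<in>I. \<exists>b\<in>I. a \<noteq> b")
        case False
        \<comment> \<open>At most one \<open>\<theta>\<close>: the exponent is \<open>c\<close> with \<open>1\<close> subtracted in at most one place.\<close>
        obtain j where j: "j < n" "\<And>i. i \<in> I \<Longrightarrow> i = j"
        proof (cases "I = {}")
          case True then show ?thesis using that[of 0] n_ge by simp
        next
          case False
          then obtain j where "j \<in> I" by blast
          with keyD(2) \<open>\<not> (\<exists>a\<in>I. \<exists>b\<in>I. a \<noteq> b)\<close> show ?thesis by (intro that[of j]) auto
        qed
        have "(if i = j then q - 1 else q) \<le> lk \<beta> i" if "i < n" for i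
          using gc[OF that] qc le[of i] j(2)[of i] by (auto simp: g_def split: if_splits)
        then show ?thesis unfolding bad_def using j(1) by blast
      next
        case True
        show ?thesis
        proof (cases "c = q")
          case False
          then have "(if i = 0 then q - 1 else q) \<le> lk \<beta> i" if "i < n" for i
            using gc[OF that] qc le[of i] by auto
          then show ?thesis unfolding bad_def using n_ge by (intro disjI2 exI[of _ 0]) auto
        next
          case c: True
          \<comment> \<open>Exchanging the two smallest indices in \<open>I\<close> fixes the monomial up to sign \<open>-1\<close>.\<close>
          define a where "a = Min I"
          define b where "b = Min (I - {a})"
          have ne: "I \<noteq> {}" "I - {a} \<noteq> {}" using True by auto
          have ab: "a \<in> I" "b \<in> I - {a}"
            using Min_in[OF keyD(4) ne(1)] Min_in[OF finite_Diff[OF keyD(4)] ne(2)]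
            by (simp_all add: a_def b_def)
          have min: "b \<le> k" if "k \<in> I" "k \<noteq> a" for k
            unfolding b_def using that keyD(4) by (intro Min_le) auto
          have "a \<le> b" unfolding a_def using ab(2) keyD(4) by (intro Min_le) auto
          with ab have less: "a < b" by auto
          have lt: "a < n" "b < n" using ab keyD(2) by auto
          let ?\<tau> = "Transposition.transpose a b"
          have t: "?\<tau> permutes {..<n}" using lt by (intro permutes_swap_id) auto
          have eq: "lk \<beta> a = lk \<beta> b" using gc[OF lt(1)] gc[OF lt(2)] ab by (simp add: g_def)
          have "perm_exp ?\<tau> \<beta> = \<beta>"
            by (rule perm_exp_eqI) (use eq in \<open>simp_all add: Transposition.transpose_def\<close>)
          moreover have "?\<tau> ` I = I"
            using ab by (simp add: transpose_image_eq)
          moreover have "sort_sign ?\<tau> I = -1"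
            by (rule sort_sign_transpose[OF keyD(4) ab(1) _ less min]) (use ab in auto)
          ultimately have "lk (act (mon_mat n ?\<tau> (\<lambda>_. 1)) \<omega>) (\<beta>, I) = - lk \<omega> (\<beta>, I)"
            using lookup_act_mon_mat[OF t om, of "\<lambda>_. 1" \<beta> I] by simp
          then have "lk \<omega> (\<beta>, I) = - lk \<omega> (\<beta>, I)"
            unfolding inv[OF perm_mat_in_G[OF t]] .
          then show ?thesis using key by (simp add: in_keys_iff)
        qed
      qed
    qed
  qed
qed

lemma invariant_ideal_key_bad:
  assumes "\<omega> \<in> invariant_ideal K n G" "(\<beta>, I) \<in> ks \<omega>"
  shows "bad \<beta> \<and> finite I"
  using assms unfolding invariant_ideal_def
proof (induction \<omega> arbitrary: \<beta> I rule: ideal_gen.induct)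
  case zero
  then show ?case by simp
next
  case (gen \<omega>)
  then obtain i k where om: "\<omega> \<in> forms K n" and bi: "bihomogeneous i k \<omega>" "i + int k > 0"
    and inv: "\<And>\<sigma>. \<sigma> \<in> G \<Longrightarrow> act \<sigma> \<omega> = \<omega>" by blast
  have "int (xdeg \<beta>) = i \<and> card I = k" using bi(1) gen.prems unfolding bihomogeneous_def by blast
  then have "(\<beta>, I) \<noteq> (0, {})" using bi(2) by auto
  then show ?case using invariant_key_bad[OF om inv gen.prems] forms_keysD(4)[OF om gen.prems] by simp
next
  case (add \<eta> \<zeta>)
  have "(\<beta>, I) \<in> ks \<eta> \<or> (\<beta>, I) \<in> ks \<zeta>" using add.prems Poly_Mapping.keys_add[of \<eta> \<zeta>] by blast
  then show ?case using add.IH by blast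
next
  case (left \<omega> \<eta>)
  from left.prems obtain \<alpha>' I' \<beta>' J' where "(\<alpha>', I') \<in> ks \<omega>" "(\<beta>', J') \<in> ks \<eta>"
    "(\<beta>, I) = (\<alpha>' + \<beta>', I' \<union> J')" by (rule keys_form_times)
  then show ?case using left.IH[of \<beta>' J'] forms_keysD(4)[OF left.hyps(1)] bad_add' by simp
next
  case (right \<omega> \<eta>)
  from right.prems obtain \<alpha>' I' \<beta>' J' where "(\<alpha>', I') \<in> ks \<eta>" "(\<beta>', J') \<in> ks \<omega>"
    "(\<beta>, I) = (\<alpha>' + \<beta>', I' \<union> J')" by (rule keys_form_times)
  then show ?case using right.IH[of \<alpha>' I'] forms_keysD(4)[OF right.hyps(1)] bad_add by simp
qed

text \<open>Bad exponents form an up-set, so \<open>\<partial>\<^sup>\<beta>\<close> with \<open>\<beta>\<close> bad kills every monomial that is not bad.\<close>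

lemma super_harmonic_if_no_bad:
  assumes "\<eta> \<in> forms K n" "\<And>\<alpha> I. (\<alpha>, I) \<in> ks \<eta> \<Longrightarrow> \<not> bad \<alpha>"
  shows "\<eta> \<in> super_harmonics K n G"
  unfolding super_harmonics_def
proof (intro CollectI conjI ballI)
  fix \<omega> assume om: "\<omega> \<in> invariant_ideal K n G"
  have "ks (d_form \<omega> \<eta>) = {}"
  proof (rule ccontr)
    assume "ks (d_form \<omega> \<eta>) \<noteq> {}"
    then obtain \<beta> J where "(\<beta>, J) \<in> ks (d_form \<omega> \<eta>)" by fastforce
    then obtain \<alpha> I where "(\<alpha>, I) \<in> ks \<omega>" "(\<alpha> + \<beta>, J \<union> I) \<in> ks \<eta>"
      by (rule keys_d_form) (use invariant_ideal_key_bad[OF om] in blast)+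
    then show False using assms(2) invariant_ideal_key_bad[OF om] bad_add by blast
  qed
  then show "d_form \<omega> \<eta> = 0" by simp
qed (rule assms(1))

lemma invariant_one_form:
  assumes b: "\<And>\<pi> j. \<pi> permutes {..<n} \<Longrightarrow> j < n \<Longrightarrow> perm_exp \<pi> (b j) = b (\<pi> j)"
    and b_supp: "\<And>j. j < n \<Longrightarrow> ks (b j) \<subseteq> {..<n}"
    and deg: "\<And>j. j < n \<Longrightarrow> xdeg (b j) = d"
    and w: "\<And>c j. (\<And>j. j < n \<Longrightarrow> c j ^ m = 1) \<Longrightarrow> (\<Prod>j<n. c j) ^ q = 1 \<Longrightarrow> j < n \<Longrightarrow>
        weight n c (b j) {j} = 1"
  shows "(\<Sum>j<n. basis_form (b j) {j}) \<in> invariant_ideal K n G"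
proof -
  let ?\<omega> = "\<Sum>j<n. basis_form (b j) {j}"
  have keys: "ks ?\<omega> \<subseteq> (\<lambda>j. (b j, {j})) ` {..<n}"
    using keys_sum[of "\<lambda>j. basis_form (b j) {j}" "{..<n}"] by auto
  have lkK: "lk ?\<omega> a \<in> K" for a
    unfolding lookup_sum by (rule sum_in) (simp add: lookup_basis_form zero_in one_in)
  have key: "ks \<alpha> \<subseteq> {..<n} \<and> I \<subseteq> {..<n} \<and> xdeg \<alpha> = d \<and> card I = 1" if a: "(\<alpha>, I) \<in> ks ?\<omega>" for \<alpha> I
  proof -
    obtain j where "j < n" "\<alpha> = b j" "I = {j}" using keys a by blast
    then show ?thesis using b_supp[of j] deg[of j] by simp
  qed
  have "?\<omega> \<in> forms K n"
    unfolding forms_def using key lkK by blast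
  moreover have "bihomogeneous (int d) 1 ?\<omega>"
    unfolding bihomogeneous_def using key by auto
  moreover have "act \<sigma> ?\<omega> = ?\<omega>" if "\<sigma> \<in> G" for \<sigma>
  proof -
    from that obtain \<pi> c where perm: "\<pi> permutes {..<n}"
      and c: "\<And>j. j < n \<Longrightarrow> c j ^ m = 1" "(\<Prod>j<n. c j) ^ q = 1" and s: "\<sigma> = mon_mat n \<pi> c"
      by (rule in_GE) blast
    have "act \<sigma> ?\<omega> = (\<Sum>j<n. act \<sigma> (basis_form (b j) {j}))"
      by (rule linear_op_sum[OF linear_act])
    also have "\<dots> = (\<Sum>j<n. basis_form (b (\<pi> j)) {\<pi> j})"
    proof (rule sum.cong[OF refl])
      fix j assume "j \<in> {..<n}"
      then have j: "j < n" by simp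
      have "sort_sign \<pi> {j} = 1" by (simp add: sort_sign_def)
      then show "act \<sigma> (basis_form (b j) {j}) = basis_form (b (\<pi> j)) {\<pi> j}"
        unfolding s using j act_mon_mat_basis[OF perm b_supp[OF j], of "{j}" c] w[OF c j] b[OF perm j]
        by simp
    qed
    also have "\<dots> = ?\<omega>"
      using sum.permute[OF perm, of "\<lambda>j. basis_form (b j) {j}"] by (simp add: comp_def)
    finally show ?thesis .
  qed
  ultimately show ?thesis
    unfolding invariant_ideal_def by (intro ideal_gen.gen) force
qed

text \<open>An invariant of the form \<open>\<Sum>\<^sub>j x\<^bsup>b j\<^esup> \<theta>\<^sub>j\<close> annihilates \<open>F \<theta>\<^sub>1 \<cdots> \<theta>\<^sub>n\<close> only if each
  \<open>\<partial>\<^bsup>b j\<^esup>\<close> annihilates \<open>F\<close>, as different \<open>j\<close> remove different \<open>\<theta>\<close>'s.\<close>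

lemma top_key_not_above:
  assumes om: "(\<Sum>j<n. basis_form (b j) {j}) \<in> invariant_ideal K n G"
    and eta: "\<eta> \<in> super_harmonics K n G" and top: "\<And>\<alpha> I. (\<alpha>, I) \<in> ks \<eta> \<Longrightarrow> I = {..<n}"
    and j: "j < n"
  shows "(b j + \<beta>, {..<n}) \<notin> ks \<eta>"
proof -
  let ?J = "{..<n} - {j}"
  have "d_form (\<Sum>j<n. basis_form (b j) {j}) \<eta> = 0"
    using eta om unfolding super_harmonics_def by blast
  then have "(\<Sum>i<n. lk (d_x_power (b i) (d_theta i \<eta>)) (\<beta>, ?J)) = 0"
    unfolding d_form_sum_left d_form_basis by (simp flip: lookup_sum)
  moreover have "lk (d_x_power (b i) (d_theta i \<eta>)) (\<beta>, ?J) = 0" if "i \<in> {..<n} - {j}" for i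
    unfolding lookup_d_x_power_eq_0_iff lookup_d_theta using that by simp
  then have "(\<Sum>i<n. lk (d_x_power (b i) (d_theta i \<eta>)) (\<beta>, ?J))
     = (\<Sum>i\<in>{j}. lk (d_x_power (b i) (d_theta i \<eta>)) (\<beta>, ?J))"
    by (intro sum.mono_neutral_right) (use j in auto)
  ultimately have "lk (d_x_power (b j) (d_theta j \<eta>)) (\<beta>, ?J) = 0" by simp
  moreover have "insert j ?J = {..<n}" using j by auto
  ultimately show ?thesis
    unfolding lookup_d_x_power_eq_0_iff lookup_d_theta by (simp add: in_keys_iff)
qed

lemma power_one_form_in: "(\<Sum>j<n. basis_form (xpow j (m - 1)) {j}) \<in> invariant_ideal K n G"
proof (rule invariant_one_form)
  fix \<pi> j assume p: "\<pi> permutes {..<n}" and j: "j < n"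
  show "perm_exp \<pi> (xpow j (m - 1)) = xpow (\<pi> j) (m - 1)"
    by (rule perm_exp_eqI)
      (use permutes_bij[OF p] in \<open>auto simp: lookup_single when_def inj_eq[OF permutes_inj[OF p]]\<close>)
next
  fix c :: "nat \<Rightarrow> complex" and j assume c: "\<And>j. j < n \<Longrightarrow> c j ^ m = 1" and j: "j < n"
  have "cnj (c i) ^ (lk (xpow j (m - 1)) i + (if i \<in> {j} then 1 else 0)) = 1"
    if i: "i < n" for i
  proof (cases "i = j")
    case True
    then show ?thesis using c[OF i] m_ge by (simp flip: complex_cnj_power)
  qed (simp add: lookup_single when_def)
  then show "weight n c (xpow j (m - 1)) {j} = 1"
    unfolding weight_def by (intro prod.neutral) simp
qed auto

lemma product_one_form_in:
  "(\<Sum>j<n. basis_form (expo n (\<lambda>i. if i = j then q - 1 else q)) {j}) \<in> invariant_ideal K n G"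
proof (rule invariant_one_form)
  fix \<pi> j assume p: "\<pi> permutes {..<n}" and j: "j < n"
  show "perm_exp \<pi> (expo n (\<lambda>i. if i = j then q - 1 else q)) = expo n (\<lambda>i. if i = \<pi> j then q - 1 else q)"
    by (rule perm_exp_expo[OF p]) (simp add: inj_eq[OF permutes_inj[OF p]])
next
  fix c :: "nat \<Rightarrow> complex" and j assume c: "(\<Prod>j<n. c j) ^ q = 1" and j: "j < n"
  have "weight n c (expo n (\<lambda>i. if i = j then q - 1 else q)) {j} = (\<Prod>i<n. cnj (c i) ^ q)"
    unfolding weight_def by (rule prod.cong) (use q_ge in \<open>auto simp: lookup_expo\<close>)
  also have "\<dots> = cnj ((\<Prod>i<n. c i) ^ q)" by (simp add: prod_power_distrib)
  finally show "weight n c (expo n (\<lambda>i. if i = j then q - 1 else q)) {j} = 1" unfolding c by simp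
next
  fix j assume "j < n"
  have "(\<Sum>i<n. if i = j then q - 1 else q) + 1 = (\<Sum>i<n. q)"
  proof -
    have "(\<Sum>i<n. q) = (\<Sum>i<n. (if i = j then q - 1 else q) + (if i = j then 1 else 0))"
      by (rule sum.cong) (use q_ge in auto)
    then show ?thesis using \<open>j < n\<close> by (simp add: sum.distrib)
  qed
  then show "xdeg (expo n (\<lambda>i. if i = j then q - 1 else q)) = n * q - 1"
    unfolding xdeg_expo by simp
qed (rule keys_expo)

lemma top_key_not_bad:
  assumes eta: "\<eta> \<in> super_harmonics K n G" and top: "\<And>\<alpha> I. (\<alpha>, I) \<in> ks \<eta> \<Longrightarrow> I = {..<n}"
    and key: "(\<alpha>, I) \<in> ks \<eta>"
  shows "\<not> bad \<alpha>"
proof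
  assume "bad \<alpha>"
  have I: "I = {..<n}" by (rule top[OF key])
  from \<open>bad \<alpha>\<close> show False unfolding bad_def
  proof (elim disjE exE conjE)
    fix i assume i: "i < n" "m - 1 \<le> lk \<alpha> i"
    have "xpow i (m - 1) + (\<alpha> - xpow i (m - 1)) = \<alpha>"
      by (rule exponent_single_diff[OF i(2)])
    then show False
      using top_key_not_above[OF power_one_form_in eta top i(1), where \<beta> = "\<alpha> - xpow i (m - 1)"]
        key I by simp
  next
    fix j assume j: "j < n" "\<forall>i<n. (if i = j then q - 1 else q) \<le> lk \<alpha> i"
    let ?b = "expo n (\<lambda>i. if i = j then q - 1 else q)"
    have "?b + (\<alpha> - ?b) = \<alpha>"
      by (rule exponent_diff_add) (use j in \<open>simp add: lookup_expo\<close>)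
    then show False
      using top_key_not_above[OF product_one_form_in eta top j(1), where \<beta> = "\<alpha> - ?b"] key I by simp
  qed
qed

lemma zero_in_forms: "0 \<in> forms K n"
  by (simp add: forms_def)

lemma scale_basis_in_forms:
  "c \<in> K \<Longrightarrow> ks \<alpha> \<subseteq> {..<n} \<Longrightarrow> I \<subseteq> {..<n} \<Longrightarrow> scale c (basis_form \<alpha> I) \<in> forms K n"
  by (cases "c = 0") (simp_all add: zero_in_forms, simp add: forms_def lookup_basis_form)

lemma basis_in_forms: "ks \<alpha> \<subseteq> {..<n} \<Longrightarrow> I \<subseteq> {..<n} \<Longrightarrow> basis_form \<alpha> I \<in> forms K n"
  using scale_basis_in_forms[OF one_in] by simp

lemma forms_lookup: "\<eta> \<in> forms K n \<Longrightarrow> lk \<eta> a \<in> K"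
  using forms_keysD(3)[of \<eta> K n "fst a" "snd a"] zero_in by (cases "a \<in> ks \<eta>") (auto simp: in_keys_iff)

lemma formsI:
  assumes "\<And>\<alpha> I. (\<alpha>, I) \<in> ks \<eta> \<Longrightarrow> ks \<alpha> \<subseteq> {..<n} \<and> I \<subseteq> {..<n}" "\<And>a. lk \<eta> a \<in> K"
  shows "\<eta> \<in> forms K n"
  using assms unfolding forms_def by blast

lemma forms_add: "\<eta> \<in> forms K n \<Longrightarrow> \<zeta> \<in> forms K n \<Longrightarrow> \<eta> + \<zeta> \<in> forms K n"
proof (rule formsI)
  assume a: "\<eta> \<in> forms K n" "\<zeta> \<in> forms K n"
  show "lk (\<eta> + \<zeta>) k \<in> K" for k
    using a by (simp add: lookup_add add_in forms_lookup)
  fix \<alpha> I assume "(\<alpha>, I) \<in> ks (\<eta> + \<zeta>)"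
  then have "(\<alpha>, I) \<in> ks \<eta> \<or> (\<alpha>, I) \<in> ks \<zeta>" using Poly_Mapping.keys_add[of \<eta> \<zeta>] by blast
  then show "ks \<alpha> \<subseteq> {..<n} \<and> I \<subseteq> {..<n}" using forms_keysD(1,2)[OF a(1)] forms_keysD(1,2)[OF a(2)] by blast
qed

lemma forms_scale: "c \<in> K \<Longrightarrow> \<eta> \<in> forms K n \<Longrightarrow> scale c \<eta> \<in> forms K n"
proof (rule formsI)
  assume a: "c \<in> K" "\<eta> \<in> forms K n"
  show "lk (scale c \<eta>) k \<in> K" for k
    using a by (simp add: mult_in forms_lookup)
  show "ks \<alpha> \<subseteq> {..<n} \<and> I \<subseteq> {..<n}" if "(\<alpha>, I) \<in> ks (scale c \<eta>)" for \<alpha> I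
    using forms_keysD(1,2)[OF a(2)] that keys_scale_subset by blast
qed

lemma forms_sum: "(\<And>a. a \<in> A \<Longrightarrow> \<eta> a \<in> forms K n) \<Longrightarrow> (\<Sum>a\<in>A. \<eta> a) \<in> forms K n"
  by (induction A rule: infinite_finite_induct) (simp_all add: zero_in_forms forms_add)

lemma SH_compD:
  assumes "\<eta> \<in> SH_comp K n G i k"
  shows "\<eta> \<in> forms K n" "\<eta> \<in> super_harmonics K n G"
    and "\<And>\<alpha> I. (\<alpha>, I) \<in> ks \<eta> \<Longrightarrow> int (xdeg \<alpha>) = i \<and> card I = k"
proof -
  have 1: "\<eta> \<in> super_harmonics K n G" "bihomogeneous i k \<eta>"
    using assms by (simp_all add: SH_comp_def)
  show "\<eta> \<in> super_harmonics K n G" by (rule 1(1))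
  then show "\<eta> \<in> forms K n" unfolding super_harmonics_def by simp
  show "int (xdeg \<alpha>) = i \<and> card I = k" if "(\<alpha>, I) \<in> ks \<eta>" for \<alpha> I
    using 1(2) that unfolding bihomogeneous_def by auto
qed

lemma zero_in_SH_comp: "0 \<in> SH_comp K n G i k"
  unfolding SH_comp_def bihomogeneous_def
  by (auto intro!: super_harmonic_if_no_bad zero_in_forms)

lemma SH_comp_nonzeroE:
  assumes "SH_comp K n G i k \<inter> W \<noteq> {0}" "0 \<in> W"
  obtains \<eta> \<alpha> I where "\<eta> \<in> SH_comp K n G i k" "\<eta> \<in> W" "(\<alpha>, I) \<in> ks \<eta>"
proof -
  have "0 \<in> SH_comp K n G i k \<inter> W" using zero_in_SH_comp assms(2) by blast
  with assms(1) obtain \<eta> where e: "\<eta> \<in> SH_comp K n G i k" "\<eta> \<in> W" "\<eta> \<noteq> 0" by blast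
  then have "ks \<eta> \<noteq> {}" by simp
  then obtain a where "a \<in> ks \<eta>" by blast
  with e show ?thesis using that[of \<eta> "fst a" "snd a"] by simp
qed

lemma SH_comp_subset_SH: "\<eta> \<in> SH_comp K n G i k \<Longrightarrow> \<eta> \<in> SH K n G k"
  unfolding SH_def by (intro CollectI exI[of _ "{i}"] exI[of _ "\<lambda>_. \<eta>"]) simp

lemma SH_keyE:
  assumes "\<eta> \<in> SH K n G k" "a \<in> ks \<eta>"
  obtains i \<zeta> where "\<zeta> \<in> SH_comp K n G i k" "a \<in> ks \<zeta>"
proof -
  from assms(1) obtain F \<zeta> where "\<And>i. i \<in> F \<Longrightarrow> \<zeta> i \<in> SH_comp K n G i k" "\<eta> = (\<Sum>i\<in>F. \<zeta> i)"
    unfolding SH_def by blast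
  then show ?thesis using that assms(2) keys_sum[of \<zeta> F] by blast
qed

lemma SH_in_forms: "\<eta> \<in> SH K n G k \<Longrightarrow> \<eta> \<in> forms K n"
  unfolding SH_def by (auto intro!: forms_sum dest: SH_compD(1))

lemma super_harmonics_add:
  assumes "\<eta> \<in> super_harmonics K n G" "\<zeta> \<in> super_harmonics K n G"
  shows "\<eta> + \<zeta> \<in> super_harmonics K n G"
  using assms unfolding super_harmonics_def
  by (simp add: forms_add linear_op_add[OF linear_d_form])

lemma SH_in_super_harmonics: "\<eta> \<in> SH K n G k \<Longrightarrow> \<eta> \<in> super_harmonics K n G"
proof -
  assume "\<eta> \<in> SH K n G k"
  then obtain F \<zeta> where z: "\<And>i. i \<in> F \<Longrightarrow> \<zeta> i \<in> SH_comp K n G i k" "\<eta> = (\<Sum>i\<in>F. \<zeta> i)"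
    unfolding SH_def by blast
  have "(\<Sum>i\<in>F. \<zeta> i) \<in> super_harmonics K n G" if "F \<subseteq> F'" "\<And>i. i \<in> F' \<Longrightarrow> \<zeta> i \<in> SH_comp K n G i k" for F F'
    using that(1)
  proof (induction F rule: infinite_finite_induct)
    case (insert x F)
    then show ?case using that(2)[of x] by (simp add: super_harmonics_add SH_compD(2))
  qed (use SH_compD(2)[OF zero_in_SH_comp] in simp_all)
  then show ?thesis using z by blast
qed

lemma card_top: "I \<subseteq> {..<n} \<Longrightarrow> card I = n \<Longrightarrow> I = {..<n}"
  by (rule card_subset_eq) simp_all

lemma SH_comp_top_key:
  assumes "\<eta> \<in> SH_comp K n G i n" "(\<alpha>, I) \<in> ks \<eta>"
  shows "I = {..<n}" "\<not> bad \<alpha>" "ks \<alpha> \<subseteq> {..<n}" "int (xdeg \<alpha>) = i"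
proof -
  note D = SH_compD[OF assms(1)]
  have top: "J = {..<n}" if "(\<beta>, J) \<in> ks \<eta>" for \<beta> J
    using D(3)[OF that] forms_keysD(2)[OF D(1) that] card_top by blast
  show "I = {..<n}" by (rule top[OF assms(2)])
  show "\<not> bad \<alpha>" using D(2) top assms(2) by (rule top_key_not_bad)
  show "ks \<alpha> \<subseteq> {..<n}" by (rule forms_keysD(1)[OF D(1) assms(2)])
  show "int (xdeg \<alpha>) = i" using D(3)[OF assms(2)] by simp
qed

lemma basis_top_in_SH_comp:
  assumes "ks \<alpha> \<subseteq> {..<n}" "\<not> bad \<alpha>"
  shows "basis_form \<alpha> {..<n} \<in> SH_comp K n G (int (xdeg \<alpha>)) n"
  unfolding SH_comp_def bihomogeneous_def
  by (intro CollectI conjI super_harmonic_if_no_bad basis_in_forms) (use assms in auto)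

subsection \<open>The determinant component\<close>

text \<open>For \<open>q = 1\<close> the truncated difference \<open>q - 2\<close> is the right value \<open>0\<close>.\<close>

lemma residue_minus_two:
  assumes "\<not> q \<le> a" and "q dvd a + 2"
  shows "a = q - 2"
proof -
  obtain d where d: "a + 2 = q * d" using assms(2) by (rule dvdE)
  show ?thesis
  proof (cases "d \<le> 1")
    case True
    with d show ?thesis by (cases d) auto
  next
    case False
    then have "q * 2 \<le> q * d" by simp
    with d assms(1) show ?thesis by linarith
  qed
qed

text \<open>As \<open>\<sigma>\<close> multiplies \<open>\<theta>\<^sub>1 \<cdots> \<theta>\<^sub>n\<close> by \<open>det \<sigma>\<^sup>-\<^sup>1\<close>, the polynomial factor transforms by \<open>det\<^sup>2\<close>. Its
  exponents are congruent modulo \<open>m\<close> and below \<open>m - 1\<close>, hence all equal; the common value is congruent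
  to \<open>-2\<close> modulo \<open>q\<close> and smaller than \<open>q\<close>.\<close>

lemma SH_det_key:
  assumes eta: "\<eta> \<in> SH_det K n G n" and key: "(\<alpha>, I) \<in> ks \<eta>"
  shows "\<alpha> = expo n (\<lambda>_. q - 2)" "I = {..<n}"
proof -
  have sh: "\<eta> \<in> SH K n G n" and det: "\<And>\<sigma>. \<sigma> \<in> G \<Longrightarrow> act \<sigma> \<eta> = scale (det \<sigma> ^ 1) \<eta>"
    using eta unfolding SH_det_def by simp_all
  obtain i \<zeta> where "\<zeta> \<in> SH_comp K n G i n" "(\<alpha>, I) \<in> ks \<zeta>" using sh key by (rule SH_keyE)
  note k = SH_comp_top_key(1-3)[OF this]
  show "I = {..<n}" by (rule k(1))
  have n0: "0 < n" using n_ge by simp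
  have cong: "(lk \<alpha> i + 1) mod m = (lk \<alpha> 0 + 1) mod m" if "i < n" for i
    using semi_invariant_exponents(1)[OF SH_in_forms[OF sh] det key that n0] that n0 by (simp add: k(1))
  have lt: "lk \<alpha> i + 1 < m" if "i < n" for i
  proof -
    have "\<not> m - 1 \<le> lk \<alpha> i" using k(2) that unfolding bad_def by blast
    then show ?thesis by linarith
  qed
  have eq: "lk \<alpha> i = lk \<alpha> 0" if "i < n" for i
    using cong[OF that] lt[OF that] lt[OF n0] by simp
  have "\<not> q \<le> lk \<alpha> 0"
  proof
    assume "q \<le> lk \<alpha> 0"
    then have "(if i = 0 then q - 1 else q) \<le> lk \<alpha> i" if "i < n" for i
    proof -
      have "(if i = 0 then q - 1 else q) \<le> q" by simp
      also have "q \<le> lk \<alpha> i" using \<open>q \<le> lk \<alpha> 0\<close> eq[OF that] by simp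
      finally show ?thesis .
    qed
    then show False using k(2) n0 unfolding bad_def by blast
  qed
  moreover have "q dvd lk \<alpha> 0 + 1 + 1"
    using semi_invariant_exponents(2)[OF SH_in_forms[OF sh] det key n0 n0] n0 by (simp add: k(1))
  ultimately have a: "lk \<alpha> 0 = q - 2" by (intro residue_minus_two) simp_all
  show "\<alpha> = expo n (\<lambda>_. q - 2)"
    by (rule exponent_eqI[OF k(3) keys_expo]) (simp add: lookup_expo eq[unfolded a])
qed

lemma not_bad_const: "\<not> bad (expo n (\<lambda>_. q - 2))"
proof
  assume "bad (expo n (\<lambda>_. q - 2))"
  then show False unfolding bad_def
  proof (elim disjE exE conjE)
    fix i assume "i < n" "m - 1 \<le> lk (expo n (\<lambda>_. q - 2)) i"
    then show False using q_lt m_ge by (simp add: lookup_expo)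
  next
    fix j assume j: "\<forall>i<n. (if i = j then q - 1 else q) \<le> lk (expo n (\<lambda>_. q - 2)) i"
    define i where "i = (if j = 0 then 1 else 0 :: nat)"
    have "i < n" "i \<noteq> j" using n_ge by (auto simp: i_def)
    then show False using j[rule_format, of i] q_ge by (simp add: lookup_expo)
  qed
qed

text \<open>The weight of the monomial under a matrix with entries \<open>c\<^sub>j\<close> is the conjugate of \<open>C = \<Prod> c\<^sub>j\<close> to a power
  that is congruent to \<open>-1\<close> modulo \<open>q\<close>, and \<open>C\<^sup>q = 1\<close>, so the weight is \<open>C\<close>.\<close>

lemma det_witness: "basis_form (expo n (\<lambda>_. q - 2)) {..<n} \<in> SH_det K n G n"
  unfolding SH_det_def
proof (intro CollectI conjI ballI)
  let ?a = "expo n (\<lambda>_. q - 2)"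
  show "basis_form ?a {..<n} \<in> SH K n G n"
    by (rule SH_comp_subset_SH[OF basis_top_in_SH_comp[OF keys_expo not_bad_const]])
  fix \<sigma> assume "\<sigma> \<in> G"
  then obtain \<pi> c where perm: "\<pi> permutes {..<n}"
    and c: "\<And>j. j < n \<Longrightarrow> c j ^ m = 1" "(\<Prod>j<n. c j) ^ q = 1" and s: "\<sigma> = mon_mat n \<pi> c"
    by (rule in_GE) blast
  let ?C = "\<Prod>j<n. c j"
  have "weight n c ?a {..<n} = (\<Prod>j<n. cnj (c j) ^ (q - 2 + 1))"
    unfolding weight_def by (rule prod.cong) (simp_all add: lookup_expo)
  also have "\<dots> = cnj ?C ^ (q - 2 + 1)" by (simp only: prod_power_distrib cnj_prod)
  also have "\<dots> = ?C"
  proof (cases "q = 1")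
    case True
    then show ?thesis using c(2) by simp
  next
    case False
    then have "q - 2 + 1 + 1 = q" using q_ge by simp
    then have "cnj ?C ^ (q - 2 + 1) * cnj ?C = cnj (?C ^ q)"
      by (metis complex_cnj_power power_add power_one_right)
    then have "cnj ?C * cnj ?C ^ (q - 2 + 1) = 1" unfolding c(2) by (simp add: mult.commute)
    then have "cnj ?C ^ (q - 2 + 1) = inverse (cnj ?C)" by (rule inverse_unique[symmetric])
    also have "\<dots> = ?C" unfolding root_of_unity_cnj(1)[OF c(2) q_ge] by simp
    finally show ?thesis .
  qed
  finally have w: "weight n c ?a {..<n} = ?C" .
  have "perm_exp \<pi> ?a = ?a" by (rule perm_exp_expo[OF perm]) simp
  then show "act \<sigma> (basis_form ?a {..<n}) = scale (det \<sigma>) (basis_form ?a {..<n})"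
    unfolding s act_mon_mat_basis[OF perm keys_expo subset_refl] w det_mon_mat[OF perm]
      sort_sign_top[OF perm] permutes_image[OF perm] by (simp add: mult.commute)
qed

lemma top_degree_det:
  "is_top_degree (\<lambda>i. SH_comp K n G i n \<inter> SH_det K n G n) (int (n * (q - 2)))"
  unfolding is_top_degree_def
proof (intro conjI allI impI)
  let ?a = "expo n (\<lambda>_. q - 2)"
  have "xdeg ?a = n * (q - 2)" by (simp add: xdeg_expo)
  then have "basis_form ?a {..<n} \<in> SH_comp K n G (int (n * (q - 2))) n \<inter> SH_det K n G n"
    using basis_top_in_SH_comp[OF keys_expo not_bad_const] det_witness by simp
  moreover have "basis_form ?a {..<n} \<noteq> 0" by (metis keys_basis_form insert_not_empty keys_zero)
  ultimately show "SH_comp K n G (int (n * (q - 2))) n \<inter> SH_det K n G n \<noteq> {0}" by blast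
  fix i assume ne: "SH_comp K n G i n \<inter> SH_det K n G n \<noteq> {0}"
  have "0 \<in> SH_det K n G n"
    unfolding SH_det_def by (simp add: SH_comp_subset_SH[OF zero_in_SH_comp] linear_op_zero[OF linear_act])
  with ne obtain \<eta> \<alpha> I where e: "\<eta> \<in> SH_comp K n G i n" "\<eta> \<in> SH_det K n G n" "(\<alpha>, I) \<in> ks \<eta>"
    by (rule SH_comp_nonzeroE)
  have "int (xdeg \<alpha>) = i" by (rule SH_comp_top_key(4)[OF e(1,3)])
  moreover have "xdeg \<alpha> = n * (q - 2)"
    unfolding SH_det_key(1)[OF e(2,3)] by (simp add: xdeg_expo)
  ultimately show "i \<le> int (n * (q - 2))" by simp
qed

subsection \<open>The full top component\<close>

definition top_deg :: nat where
  "top_deg = Max (xdeg ` {\<alpha>. ks \<alpha> \<subseteq> {..<n} \<and> \<not> bad \<alpha>})"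

lemma degrees_finite: "finite (xdeg ` {\<alpha>. ks \<alpha> \<subseteq> {..<n} \<and> \<not> bad \<alpha>})"
proof (rule finite_subset)
  show "xdeg ` {\<alpha>. ks \<alpha> \<subseteq> {..<n} \<and> \<not> bad \<alpha>} \<subseteq> {..n * m}"
  proof (intro subsetI, elim imageE)
    fix d \<alpha> assume "\<alpha> \<in> {\<alpha>. ks \<alpha> \<subseteq> {..<n} \<and> \<not> bad \<alpha>}" and d: "d = xdeg \<alpha>"
    then have a: "ks \<alpha> \<subseteq> {..<n}" "\<not> bad \<alpha>" by simp_all
    have "lk \<alpha> i \<le> m" if "i < n" for i
    proof -
      have "\<not> m - 1 \<le> lk \<alpha> i" using a(2) that unfolding bad_def by blast
      then show ?thesis by linarith
    qed
    then have "(\<Sum>i<n. lk \<alpha> i) \<le> (\<Sum>i<n. m)" by (intro sum_mono) simp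
    then show "d \<in> {..n * m}" unfolding d xdeg_superset[OF finite_lessThan a(1)] by simp
  qed
qed simp

lemma xdeg_le_top_deg: "ks \<alpha> \<subseteq> {..<n} \<Longrightarrow> \<not> bad \<alpha> \<Longrightarrow> xdeg \<alpha> \<le> top_deg"
  unfolding top_deg_def by (rule Max_ge[OF degrees_finite]) blast

lemma top_deg_attained:
  obtains \<alpha> where "ks \<alpha> \<subseteq> {..<n}" "\<not> bad \<alpha>" "xdeg \<alpha> = top_deg"
proof -
  have "top_deg \<in> xdeg ` {\<alpha>. ks \<alpha> \<subseteq> {..<n} \<and> \<not> bad \<alpha>}"
    unfolding top_deg_def
  proof (rule Max_in[OF degrees_finite])
    have "expo n (\<lambda>_. q - 2) \<in> {\<alpha>. ks \<alpha> \<subseteq> {..<n} \<and> \<not> bad \<alpha>}"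
      using keys_expo not_bad_const by simp
    then show "xdeg ` {\<alpha>. ks \<alpha> \<subseteq> {..<n} \<and> \<not> bad \<alpha>} \<noteq> {}" by blast
  qed
  then obtain \<alpha> where "\<alpha> \<in> {\<alpha>. ks \<alpha> \<subseteq> {..<n} \<and> \<not> bad \<alpha>}" "top_deg = xdeg \<alpha>" by (rule imageE)
  then show ?thesis using that[of \<alpha>] by simp
qed

lemma top_degree_full: "is_top_degree (\<lambda>i. SH_comp K n G i n) (int top_deg)"
  unfolding is_top_degree_def
proof (intro conjI allI impI)
  obtain \<alpha> where a: "ks \<alpha> \<subseteq> {..<n}" "\<not> bad \<alpha>" "xdeg \<alpha> = top_deg" by (rule top_deg_attained)
  have "basis_form \<alpha> {..<n} \<in> SH_comp K n G (int top_deg) n"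
    using basis_top_in_SH_comp[OF a(1,2)] a(3) by simp
  moreover have "basis_form \<alpha> {..<n} \<noteq> 0" by (metis keys_basis_form insert_not_empty keys_zero)
  ultimately show "SH_comp K n G (int top_deg) n \<noteq> {0}" by blast
  fix i assume "SH_comp K n G i n \<noteq> {0}"
  then have "SH_comp K n G i n \<inter> UNIV \<noteq> {0}" by simp
  then obtain \<eta> \<alpha> I where e: "\<eta> \<in> SH_comp K n G i n" "(\<alpha>, I) \<in> ks \<eta>"
    by (rule SH_comp_nonzeroE) simp
  show "i \<le> int top_deg"
    using xdeg_le_top_deg[OF SH_comp_top_key(3,2)[OF e]] SH_comp_top_key(4)[OF e] by simp
qed

text \<open>Outside the ideal, one exponent may stay below \<open>q - 1\<close> while all others go up to \<open>m - 2\<close>;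
  for \<open>q = 1\<close> two exponents have to vanish instead.\<close>

lemma det_deg_less_top_deg: "n * (q - 2) < top_deg"
proof -
  define f where "f i = (if i = 0 \<or> (q = 1 \<and> i = 1) then q - 2 else m - 2)" for i :: nat
  have "\<not> bad (expo n f)"
  proof
    assume "bad (expo n f)"
    then show False unfolding bad_def
    proof (elim disjE exE conjE)
      fix i assume "i < n" "m - 1 \<le> lk (expo n f) i"
      then show False using q_lt m_ge by (auto simp: lookup_expo f_def split: if_splits)
    next
      fix j assume j: "\<forall>i<n. (if i = j then q - 1 else q) \<le> lk (expo n f) i"
      show False
      proof (cases "q = 1")
        case True
        define i where "i = (if j = 0 then 1 else 0 :: nat)"
        have "i < n" "i \<noteq> j" "f i = 0" using n_ge True by (auto simp: i_def f_def)
        then show False using j[rule_format, of i] q_ge by (simp add: lookup_expo)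
      next
        case False
        have "q - 1 \<le> (if (0::nat) = j then q - 1 else q)" by simp
        also have "\<dots> \<le> q - 2" using j[rule_format, of 0] n_ge by (simp add: lookup_expo f_def)
        finally show False using False q_ge by linarith
      qed
    qed
  qed
  then have le: "(\<Sum>i<n. f i) \<le> top_deg" using xdeg_le_top_deg[OF keys_expo] by (simp add: xdeg_expo)
  define l where "l = (if q = 1 then 2 else 1 :: nat)"
  have l: "l < n" "q - 2 < m - 2"
    using n_ge n_ge_3 q_lt m_ge by (auto simp: l_def)
  have "(\<Sum>i<n. q - 2) < (\<Sum>i<n. f i)"
  proof (rule sum_strict_mono_ex1)
    show "\<forall>i\<in>{..<n}. q - 2 \<le> f i" using l(2) by (simp add: f_def)
    have "f l = m - 2" using q_ge by (auto simp: f_def l_def)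
    then show "\<exists>i\<in>{..<n}. q - 2 < f i" using l by (intro bexI[of _ l]) simp_all
  qed simp
  then show ?thesis using le by simp
qed

lemma diff_closure_key:
  assumes "\<eta> \<in> diff_closure K n (SH_det K n G n)" "(\<beta>, J) \<in> ks \<eta>"
  shows "xdeg \<beta> \<le> n * (q - 2)"
  using assms unfolding diff_closure_def
proof (induction \<eta> arbitrary: rule: lin_span.induct)
  case zero
  then show ?case by simp
next
  case (add \<eta> c \<zeta>)
  have "(\<beta>, J) \<in> ks \<eta> \<or> (\<beta>, J) \<in> ks \<zeta>"
    using add.prems Poly_Mapping.keys_add[of \<eta> "scale c \<zeta>"] keys_scale_subset by blast
  then show ?case
  proof
    assume "(\<beta>, J) \<in> ks \<zeta>"
    moreover from add.hyps obtain g \<xi> where z: "\<zeta> = d_form g \<xi>" "g \<in> polys K n" "\<xi> \<in> SH_det K n G n"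
      by blast
    ultimately have "(\<beta>, J) \<in> ks (d_form g \<xi>)" by simp
    then obtain \<alpha> I where "(\<alpha> + \<beta>, J \<union> I) \<in> ks \<xi>"
      by (rule keys_d_form) (use z(2) in \<open>auto simp: polys_def\<close>)
    then have "\<alpha> + \<beta> = expo n (\<lambda>_. q - 2)" by (rule SH_det_key(1)[OF z(3)])
    then have "xdeg \<alpha> + xdeg \<beta> = n * (q - 2)" by (simp add: xdeg_expo flip: xdeg_add)
    then show ?thesis by simp
  qed (rule add.IH)
qed

text \<open>Derivatives lower the \<open>x\<close>-degree, so they cannot reach the top degree from the determinant
  component.\<close>

lemma SH_neq_diff_closure: "SH K n G n \<noteq> diff_closure K n (SH_det K n G n)"
proof
  assume eq: "SH K n G n = diff_closure K n (SH_det K n G n)"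
  obtain \<alpha> where a: "ks \<alpha> \<subseteq> {..<n}" "\<not> bad \<alpha>" "xdeg \<alpha> = top_deg" by (rule top_deg_attained)
  have "basis_form \<alpha> {..<n} \<in> diff_closure K n (SH_det K n G n)"
    using SH_comp_subset_SH[OF basis_top_in_SH_comp[OF a(1,2)]] unfolding eq .
  then have "xdeg \<alpha> \<le> n * (q - 2)" by (rule diff_closure_key) simp
  then show False using det_deg_less_top_deg a(3) by simp
qed

end

section \<open>The reflection rank\<close>

text \<open>Quotienting by the zero subspace replaces every vector by its singleton.\<close>

context imprimitive
begin

lemma fixed_space_trivial: "fixed_space K n G = {0\<^sub>v n}"
proof
  show "{0\<^sub>v n} \<subseteq> fixed_space K n G"
  proof
    fix v :: "complex vec" assume v: "v \<in> {0\<^sub>v n}"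
    have "\<sigma> *\<^sub>v 0\<^sub>v n = 0\<^sub>v n" if s: "\<sigma> \<in> G" for \<sigma>
    proof -
      have "\<sigma> \<in> carrier_mat n n" using s unfolding imprim_group_def by simp
      then show ?thesis by (intro eq_vecI) auto
    qed
    then show "v \<in> fixed_space K n G"
      using v by (simp add: fixed_space_def vec_space_over_def zero_in)
  qed
  show "fixed_space K n G \<subseteq> {0\<^sub>v n}"
  proof
    fix v assume "v \<in> fixed_space K n G"
    then have v: "v \<in> carrier_vec n" and fix': "\<And>\<sigma>. \<sigma> \<in> G \<Longrightarrow> \<sigma> *\<^sub>v v = v"
      unfolding fixed_space_def vec_space_over_def by simp_all
    have "v $ i = 0" if i: "i < n" for i
    proof -
      let ?z = "prim_root m"
      have z: "?z ^ m = 1" using prim_root_power_eq_1_iff[OF m_ge_1, of m] by simp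
      have z0: "?z \<noteq> 0" using root_of_unity_cnj(2)[OF z m_ge_1] .
      have z1: "?z \<noteq> 1" using prim_root_power_eq_1_iff[OF m_ge_1, of 1] m_ge by simp
      obtain j where j: "j < n" "j \<noteq> i"
        using n_ge that by (cases "i = 0") (auto intro: that[of 1] that[of 0])
      define c where "c l = (if l = i then ?z else if l = j then inverse ?z else 1)" for l
      have "(\<Prod>l<n. c l) = (\<Prod>l<n. (if l = i then ?z else 1) * (if l = j then inverse ?z else 1))"
        by (rule prod.cong) (use j(2) in \<open>auto simp: c_def\<close>)
      also have "\<dots> = 1" using i j(1) z0 by (simp add: prod.distrib)
      finally have "mon_mat n id c \<in> G"
        by (intro mon_mat_in_G permutes_id) (simp_all add: c_def z power_inverse)
      then have "mon_mat n id c *\<^sub>v v = v" by (rule fix')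
      then have "(mon_mat n id c *\<^sub>v v) $ i = v $ i" by simp
      moreover have "(mon_mat n id c *\<^sub>v v) $ i = ?z * v $ i"
      proof -
        have "(mon_mat n id c *\<^sub>v v) $ i = (\<Sum>l\<in>{0..<n}. row (mon_mat n id c) i $ l * v $ l)"
          using i v by (simp add: mon_mat_def scalar_prod_def)
        also have "\<dots> = (\<Sum>l\<in>{0..<n}. if l = i then ?z * v $ i else 0)"
          by (rule sum.cong) (use i in \<open>auto simp: mon_mat_def c_def\<close>)
        also have "\<dots> = ?z * v $ i" using i by simp
        finally show ?thesis .
      qed
      ultimately have "(?z - 1) * v $ i = 0" by (simp add: algebra_simps)
      then show ?thesis using z1 by simp
    qed
    then have "v = 0\<^sub>v n" using v by (intro eq_vecI) auto
    then show "v \<in> {0\<^sub>v n}" by simp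
  qed
qed

abbreviation (input) V where "V \<equiv> vec_space_over K n"
abbreviation (input) Q where "Q \<equiv> quotient_module (vec_space_over K n) {0\<^sub>v n}"

lemma V_simps: "carrier V = {v \<in> carrier_vec n. \<forall>i<n. v $ i \<in> K}" "x \<oplus>\<^bsub>V\<^esub> y = x + y"
   "c \<odot>\<^bsub>V\<^esub> x = c \<cdot>\<^sub>v x"
  by (simp_all add: vec_space_over_def module_vec_simps)

lemma Q_add: "add Q X Y = {x + y | x y. x \<in> X \<and> y \<in> Y}"
  unfolding quotient_module_def set_add_def set_mult_def by (auto simp: V_simps)

lemma Q_carrier: "carrier Q = (\<lambda>v. {v}) ` carrier V"
proof -
  have "{0\<^sub>v n} #>\<^bsub>add_monoid V\<^esub> v = {v}" if "v \<in> carrier V" for v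
    using that unfolding r_coset_def by (auto simp: V_simps)
  then show ?thesis unfolding quotient_module_def A_RCOSETS_def RCOSETS_def
    by (auto simp: image_iff)
qed

lemma Q_single: "v \<in> carrier V \<Longrightarrow> w \<in> carrier V \<Longrightarrow> {v} \<oplus>\<^bsub>Q\<^esub> {w} = {v + w}"
  "\<zero>\<^bsub>Q\<^esub> = {0\<^sub>v n}"
  unfolding Q_add by (simp_all add: quotient_module_def)

lemma Q_smult: "v \<in> carrier V \<Longrightarrow> c \<odot>\<^bsub>Q\<^esub> {v} = {c \<cdot>\<^sub>v v}"
proof -
  assume v: "v \<in> carrier V"
  then have "c \<cdot>\<^sub>v v \<in> carrier_vec n" by (simp add: V_simps)
  then have "{0\<^sub>v n} +>\<^bsub>V\<^esub> (c \<cdot>\<^sub>v v) = {c \<cdot>\<^sub>v v}"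
    unfolding a_r_coset_def r_coset_def by (auto simp: V_simps)
  then show ?thesis by (simp add: quotient_module_def V_simps)
qed

lemma V_closed: "v \<in> carrier V \<Longrightarrow> w \<in> carrier V \<Longrightarrow> v + w \<in> carrier V" "0\<^sub>v n \<in> carrier V"
  "c \<in> K \<Longrightarrow> v \<in> carrier V \<Longrightarrow> c \<cdot>\<^sub>v v \<in> carrier V"
  by (auto simp: V_simps add_in mult_in zero_in)

lemma scalar_field: "field (scalar_ring K)"
proof -
  have R: "ring (class_ring :: complex ring)"
    by (rule cring.axioms(1)[OF domain.axioms(1)[OF field.axioms(1)[OF class_field]]])
  have "field (class_ring\<lparr>carrier := K\<rparr>)" by (rule ring.subfield_iff(2)[OF R subfield])
  then show ?thesis by (simp add: scalar_ring_def)
qed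

lemma Q_vectorspace: "vectorspace (scalar_ring K) Q"
proof -
  interpret F: field "scalar_ring K" by (rule scalar_field)
  have S: "carrier (scalar_ring K) = K" "x \<oplus>\<^bsub>scalar_ring K\<^esub> y = x + y" "x \<otimes>\<^bsub>scalar_ring K\<^esub> y = x * y"
    "\<one>\<^bsub>scalar_ring K\<^esub> = 1" for x y by (simp_all add: scalar_ring_def)
  have "module (scalar_ring K) Q"
  proof (rule moduleI)
    show "cring (scalar_ring K)" by (rule F.is_cring)
    show "abelian_group Q"
    proof (rule abelian_groupI)
      fix X Y Z assume "X \<in> carrier Q" "Y \<in> carrier Q" "Z \<in> carrier Q"
      then obtain x y z where e: "X = {x}" "Y = {y}" "Z = {z}" "x \<in> carrier V" "y \<in> carrier V" "z \<in> carrier V"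
        unfolding Q_carrier by blast
      then have car: "x \<in> carrier_vec n" "y \<in> carrier_vec n" "z \<in> carrier_vec n" by (simp_all add: V_simps)
      show "X \<oplus>\<^bsub>Q\<^esub> Y \<oplus>\<^bsub>Q\<^esub> Z = X \<oplus>\<^bsub>Q\<^esub> (Y \<oplus>\<^bsub>Q\<^esub> Z)"
        using e car by (simp add: Q_single V_closed assoc_add_vec)
    next
      fix X Y assume "X \<in> carrier Q" "Y \<in> carrier Q"
      then obtain x y where e: "X = {x}" "Y = {y}" "x \<in> carrier V" "y \<in> carrier V"
        unfolding Q_carrier by blast
      then have car: "x \<in> carrier_vec n" "y \<in> carrier_vec n" by (simp_all add: V_simps)
      show "X \<oplus>\<^bsub>Q\<^esub> Y = Y \<oplus>\<^bsub>Q\<^esub> X" using e car by (simp add: Q_single comm_add_vec)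
      show "X \<oplus>\<^bsub>Q\<^esub> Y \<in> carrier Q" using e by (simp add: Q_single Q_carrier V_closed)
    next
      show "\<zero>\<^bsub>Q\<^esub> \<in> carrier Q" by (simp add: Q_single Q_carrier V_closed)
      fix X assume "X \<in> carrier Q"
      then obtain x where e: "X = {x}" "x \<in> carrier V" unfolding Q_carrier by blast
      then have car: "x \<in> carrier_vec n" by (simp add: V_simps)
      show "\<zero>\<^bsub>Q\<^esub> \<oplus>\<^bsub>Q\<^esub> X = X" using e car by (simp add: Q_single V_closed)
      have m1: "-1 \<in> K" by (rule uminus_in[OF one_in])
      have neg: "(-1) \<cdot>\<^sub>v x \<in> carrier V" by (rule V_closed(3)[OF m1 e(2)])
      have "(-1) \<cdot>\<^sub>v x + x = 0\<^sub>v n" using car by (intro eq_vecI) auto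
      then show "\<exists>Y\<in>carrier Q. Y \<oplus>\<^bsub>Q\<^esub> X = \<zero>\<^bsub>Q\<^esub>"
        using neg e by (intro bexI[of _ "{(-1) \<cdot>\<^sub>v x}"]) (simp_all add: Q_single Q_carrier)
    qed
  next
    fix a X assume "a \<in> carrier (scalar_ring K)" "X \<in> carrier Q"
    then obtain x where e: "a \<in> K" "X = {x}" "x \<in> carrier V" unfolding Q_carrier S by blast
    show "a \<odot>\<^bsub>Q\<^esub> X \<in> carrier Q" using e by (simp add: Q_smult Q_carrier V_closed)
  next
    fix a b X assume "a \<in> carrier (scalar_ring K)" "b \<in> carrier (scalar_ring K)" "X \<in> carrier Q"
    then obtain x where e: "a \<in> K" "b \<in> K" "X = {x}" "x \<in> carrier V" unfolding Q_carrier S by blast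
    then have car: "x \<in> carrier_vec n" by (simp add: V_simps)
    show "(a \<oplus>\<^bsub>scalar_ring K\<^esub> b) \<odot>\<^bsub>Q\<^esub> X = a \<odot>\<^bsub>Q\<^esub> X \<oplus>\<^bsub>Q\<^esub> b \<odot>\<^bsub>Q\<^esub> X"
      using e car by (simp add: S Q_smult Q_single V_closed add_smult_distrib_vec)
    show "(a \<otimes>\<^bsub>scalar_ring K\<^esub> b) \<odot>\<^bsub>Q\<^esub> X = a \<odot>\<^bsub>Q\<^esub> (b \<odot>\<^bsub>Q\<^esub> X)"
      using e car by (simp add: S Q_smult V_closed smult_smult_assoc)
  next
    fix a X Y assume "a \<in> carrier (scalar_ring K)" "X \<in> carrier Q" "Y \<in> carrier Q"
    then obtain x y where e: "a \<in> K" "X = {x}" "Y = {y}" "x \<in> carrier V" "y \<in> carrier V"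
      unfolding Q_carrier S by blast
    then have car: "x \<in> carrier_vec n" "y \<in> carrier_vec n" by (simp_all add: V_simps)
    show "a \<odot>\<^bsub>Q\<^esub> (X \<oplus>\<^bsub>Q\<^esub> Y) = a \<odot>\<^bsub>Q\<^esub> X \<oplus>\<^bsub>Q\<^esub> a \<odot>\<^bsub>Q\<^esub> Y"
      using e car by (simp add: Q_smult Q_single V_closed smult_add_distrib_vec)
  next
    fix X assume "X \<in> carrier Q"
    then obtain x where e: "X = {x}" "x \<in> carrier V" unfolding Q_carrier by blast
    then show "\<one>\<^bsub>scalar_ring K\<^esub> \<odot>\<^bsub>Q\<^esub> X = X" by (simp add: S Q_smult V_simps)
  qed
  then show ?thesis by (simp add: vectorspace_def scalar_field)
qed

lemma Q_dim: "vectorspace.dim (scalar_ring K) Q = n"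
proof -
  interpret vectorspace "scalar_ring K" Q by (rule Q_vectorspace)
  have S: "carrier (scalar_ring K) = K" "\<zero>\<^bsub>scalar_ring K\<^esub> = 0" by (simp_all add: scalar_ring_def)
  let ?u = "\<lambda>i. {unit_vec n i :: complex vec}"
  let ?B = "?u ` {..<n}"
  have inj: "inj_on ?u {..<n}" by (rule inj_onI) (simp add: unit_vec_eq)
  have uV: "unit_vec n i \<in> carrier V" for i
    by (auto simp: V_simps index_unit_vec(1) unit_vec_def zero_in one_in)
  have BQ: "?B \<subseteq> carrier Q" unfolding Q_carrier using uV by blast
  have part: "(\<Oplus>\<^bsub>Q\<^esub>i\<in>A. f i \<odot>\<^bsub>Q\<^esub> ?u i) = {vec n (\<lambda>i. if i \<in> A then f i else 0)}"
    if f: "\<And>i. i < n \<Longrightarrow> f i \<in> K" and A: "finite A" "A \<subseteq> {..<n}" for f A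
    using A
  proof (induction A)
    case empty
    have "vec n (\<lambda>i. 0 :: complex) = 0\<^sub>v n" by (rule eq_vecI) auto
    then show ?case by (simp add: Q_single)
  next
    case (insert a A)
    have fK: "f i \<in> K" if "i \<in> insert a A" for i using f that insert.prems by blast
    have mem: "f i \<odot>\<^bsub>Q\<^esub> ?u i \<in> carrier Q" if "i \<in> insert a A" for i
      using fK[OF that] uV by (simp add: Q_smult Q_carrier V_closed)
    have vV: "vec n (\<lambda>i. if i \<in> A then f i else 0) \<in> carrier V"
      using fK by (auto simp: V_simps zero_in)
    have "(\<Oplus>\<^bsub>Q\<^esub>i\<in>insert a A. f i \<odot>\<^bsub>Q\<^esub> ?u i) = f a \<odot>\<^bsub>Q\<^esub> ?u a \<oplus>\<^bsub>Q\<^esub> (\<Oplus>\<^bsub>Q\<^esub>i\<in>A. f i \<odot>\<^bsub>Q\<^esub> ?u i)"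
      by (rule finsum_insert[OF insert.hyps(1,2)]) (use mem in auto)
    also have "\<dots> = {f a \<cdot>\<^sub>v unit_vec n a} \<oplus>\<^bsub>Q\<^esub> {vec n (\<lambda>i. if i \<in> A then f i else 0)}"
      using insert by (simp add: Q_smult uV)
    also have "\<dots> = {f a \<cdot>\<^sub>v unit_vec n a + vec n (\<lambda>i. if i \<in> A then f i else 0)}"
      by (rule Q_single(1)) (use uV vV fK V_closed(3) in auto)
    also have "f a \<cdot>\<^sub>v unit_vec n a + vec n (\<lambda>i. if i \<in> A then f i else 0)
        = vec n (\<lambda>i. if i \<in> insert a A then f i else 0)"
      by (rule eq_vecI) (use insert in \<open>auto simp: unit_vec_def\<close>)
    finally show ?case .
  qed
  have lc: "lincomb f ?B = {vec n (\<lambda>i. f (?u i))}" if f: "f \<in> ?B \<rightarrow> K" for f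
  proof -
    have "(\<lambda>v. f v \<odot>\<^bsub>Q\<^esub> v) \<in> ?B \<rightarrow> carrier Q"
    proof
      fix X assume X: "X \<in> ?B"
      then obtain i where "X = ?u i" by blast
      moreover have "f X \<in> K" using f X by blast
      ultimately show "f X \<odot>\<^bsub>Q\<^esub> X \<in> carrier Q" using uV by (simp add: Q_smult Q_carrier V_closed)
    qed
    then have "lincomb f ?B = (\<Oplus>\<^bsub>Q\<^esub>i\<in>{..<n}. f (?u i) \<odot>\<^bsub>Q\<^esub> ?u i)"
      unfolding lincomb_def by (rule finsum_reindex[OF _ inj])
    also have "\<dots> = {vec n (\<lambda>i. if i \<in> {..<n} then f (?u i) else 0)}"
      by (rule part) (use f in auto)
    also have "vec n (\<lambda>i. if i \<in> {..<n} then f (?u i) else 0) = vec n (\<lambda>i. f (?u i))"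
      by (rule eq_vecI) auto
    finally show ?thesis .
  qed
  have "lin_indpt ?B"
  proof (rule finite_lin_indpt2)
    fix f assume "f \<in> ?B \<rightarrow> carrier (scalar_ring K)" and z: "lincomb f ?B = \<zero>\<^bsub>Q\<^esub>"
    then have f: "f \<in> ?B \<rightarrow> K" by (simp add: S)
    have eq: "vec n (\<lambda>i. f (?u i)) = 0\<^sub>v n" using z unfolding lc[OF f] Q_single(2) by simp
    have "f (?u i) = 0" if "i < n" for i
      using arg_cong[OF eq, of "\<lambda>v. v $ i"] that by simp
    then show "\<forall>v\<in>?B. f v = \<zero>\<^bsub>scalar_ring K\<^esub>" unfolding S by blast
  qed (use BQ in auto)
  moreover have "span ?B = carrier Q"
  proof (rule equalityI)
    show "span ?B \<subseteq> carrier Q" by (rule span_is_subset2[OF BQ])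
    show "carrier Q \<subseteq> span ?B"
    proof
      fix X assume "X \<in> carrier Q"
      then obtain x where x: "X = {x}" "x \<in> carrier V" unfolding Q_carrier by blast
      define f where "f Y = x $ (THE i. i < n \<and> ?u i = Y)" for Y
      have fu: "f (?u i) = x $ i" if "i < n" for i
      proof -
        have "(THE j. j < n \<and> ?u j = ?u i) = i"
          by (rule the_equality) (use that inj in \<open>auto dest: inj_onD\<close>)
        then show ?thesis by (simp add: f_def)
      qed
      have f: "f \<in> ?B \<rightarrow> K" using x(2) by (auto simp: fu V_simps)
      have "lincomb f ?B = {vec n (\<lambda>i. f (?u i))}" by (rule lc[OF f])
      also have "vec n (\<lambda>i. f (?u i)) = x"
        by (rule eq_vecI) (use x(2) in \<open>auto simp: fu V_simps\<close>)
      finally have "X = lincomb f ?B" using x(1) by simp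
      then show "X \<in> span ?B" unfolding span_def using f S by blast
    qed
  qed
  ultimately have "basis ?B" unfolding basis_def using BQ by simp
  then have "dim = card ?B" by (intro dim_basis) auto
  then show ?thesis by (simp add: card_image[OF inj])
qed

lemma refl_rank_eq: "refl_rank K n G = n"
  unfolding refl_rank_def fixed_space_trivial by (rule Q_dim)

end

section \<open>Polynomials and the ideal of partial derivatives\<close>

context imprimitive
begin

text \<open>A sum of monomials over a set of exponents stable under permutations is invariant as soon as
  the diagonal matrices fix each monomial.\<close>

lemma invariant_monomial_sum:
  assumes S: "finite S" "\<And>\<alpha>. \<alpha> \<in> S \<Longrightarrow> ks \<alpha> \<subseteq> {..<n}"
    and perm: "\<And>\<pi> \<alpha>. \<pi> permutes {..<n} \<Longrightarrow> \<alpha> \<in> S \<Longrightarrow> perm_exp \<pi> \<alpha> \<in> S"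
    and deg: "\<And>\<alpha>. \<alpha> \<in> S \<Longrightarrow> xdeg \<alpha> = d" and d: "0 < d"
    and w: "\<And>c \<alpha>. (\<And>j. j < n \<Longrightarrow> c j ^ m = 1) \<Longrightarrow> (\<Prod>j<n. c j) ^ q = 1 \<Longrightarrow> \<alpha> \<in> S \<Longrightarrow>
        weight n c \<alpha> {} = 1"
  shows "(\<Sum>\<alpha>\<in>S. basis_form \<alpha> {}) \<in> polys K n"
    and "\<And>\<sigma>. \<sigma> \<in> G \<Longrightarrow> act \<sigma> (\<Sum>\<alpha>\<in>S. basis_form \<alpha> {}) = (\<Sum>\<alpha>\<in>S. basis_form \<alpha> {})"
    and "(\<Sum>\<alpha>\<in>S. basis_form \<alpha> {}) \<in> invariant_ideal K n G"
proof -
  let ?\<omega> = "\<Sum>\<alpha>\<in>S. basis_form \<alpha> {}"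
  have keys: "\<exists>\<alpha>\<in>S. a = (\<alpha>, {})" if "a \<in> ks ?\<omega>" for a
    using that keys_sum[of "\<lambda>\<alpha>. basis_form \<alpha> {}" S] by auto
  have forms: "?\<omega> \<in> forms K n"
    by (rule forms_sum) (simp add: basis_in_forms S(2))
  then show "?\<omega> \<in> polys K n" unfolding polys_def using keys by fastforce
  show inv: "act \<sigma> ?\<omega> = ?\<omega>" if "\<sigma> \<in> G" for \<sigma>
  proof -
    from that obtain \<pi> c where p: "\<pi> permutes {..<n}"
      and c: "\<And>j. j < n \<Longrightarrow> c j ^ m = 1" "(\<Prod>j<n. c j) ^ q = 1" and s: "\<sigma> = mon_mat n \<pi> c"
      by (rule in_GE) blast
    have inj: "inj_on (perm_exp \<pi>) S"
      by (rule inj_onI) (rule perm_exp_inject[OF permutes_inj[OF p]])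
    have "perm_exp \<pi> ` S \<subseteq> S" using perm[OF p] by blast
    then have img: "perm_exp \<pi> ` S = S" using inj S(1) by (intro endo_inj_surj)
    have "act \<sigma> ?\<omega> = (\<Sum>\<alpha>\<in>S. act \<sigma> (basis_form \<alpha> {}))"
      by (rule linear_op_sum[OF linear_act])
    also have "\<dots> = (\<Sum>\<alpha>\<in>S. basis_form (perm_exp \<pi> \<alpha>) {})"
    proof (rule sum.cong[OF refl])
      fix \<alpha> assume a: "\<alpha> \<in> S"
      have "sort_sign \<pi> {} = 1" by (simp add: sort_sign_def)
      then show "act \<sigma> (basis_form \<alpha> {}) = basis_form (perm_exp \<pi> \<alpha>) {}"
        unfolding s using act_mon_mat_basis[OF p S(2)[OF a] empty_subsetI, of c] w[OF c a] by simp
    qed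
    also have "\<dots> = (\<Sum>\<alpha>\<in>perm_exp \<pi> ` S. basis_form \<alpha> {})"
      by (simp add: sum.reindex[OF inj])
    finally show ?thesis unfolding img .
  qed
  have "bihomogeneous (int d) 0 ?\<omega>"
    unfolding bihomogeneous_def using keys deg by fastforce
  then have "\<exists>i k. bihomogeneous i k ?\<omega> \<and> i + int k > 0"
    using d by (intro exI[of _ "int d"] exI[of _ 0]) simp
  then show "?\<omega> \<in> invariant_ideal K n G"
    unfolding invariant_ideal_def using forms inv by (intro ideal_gen.gen) blast
qed

lemma product_invariant:
  "basis_form (expo n (\<lambda>_. q)) {} \<in> invariant_ideal K n G"
proof -
  have "(\<Sum>\<alpha>\<in>{expo n (\<lambda>_. q)}. basis_form \<alpha> {}) \<in> invariant_ideal K n G"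
  proof (rule invariant_monomial_sum(3))
    show "perm_exp \<pi> \<alpha> \<in> {expo n (\<lambda>_. q)}" if "\<pi> permutes {..<n}" "\<alpha> \<in> {expo n (\<lambda>_. q)}" for \<pi> \<alpha>
      using that perm_exp_expo[OF that(1), of "\<lambda>_. q" "\<lambda>_. q"] by simp
    show "xdeg \<alpha> = n * q" if "\<alpha> \<in> {expo n (\<lambda>_. q)}" for \<alpha> using that by (simp add: xdeg_expo)
    show "0 < n * q" using n_ge q_ge by simp
    fix c :: "nat \<Rightarrow> complex" and \<alpha> assume c: "(\<Prod>j<n. c j) ^ q = 1" and a: "\<alpha> \<in> {expo n (\<lambda>_. q)}"
    have "weight n c \<alpha> {} = (\<Prod>i<n. cnj (c i) ^ q)"
      unfolding weight_def by (rule prod.cong) (use a in \<open>simp_all add: lookup_expo\<close>)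
    also have "\<dots> = cnj ((\<Prod>i<n. c i) ^ q)" by (simp add: prod_power_distrib)
    finally show "weight n c \<alpha> {} = 1" unfolding c by simp
  qed (use keys_expo in simp_all)
  then show ?thesis by simp
qed

lemma power_sum_invariant:
  "(\<Sum>\<alpha>\<in>(\<lambda>j. xpow j m) ` {..<n}. basis_form \<alpha> {}) \<in> polys K n"
  "\<And>\<sigma>. \<sigma> \<in> G \<Longrightarrow> act \<sigma> (\<Sum>\<alpha>\<in>(\<lambda>j. xpow j m) ` {..<n}. basis_form \<alpha> {})
     = (\<Sum>\<alpha>\<in>(\<lambda>j. xpow j m) ` {..<n}. basis_form \<alpha> {})"
proof -
  let ?S = "(\<lambda>j. xpow j m) ` {..<n}"
  have fin: "finite ?S" by simp
  have supp: "ks \<alpha> \<subseteq> {..<n}" if "\<alpha> \<in> ?S" for \<alpha> using that by (auto split: if_splits)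
  have perm: "perm_exp \<pi> \<alpha> \<in> ?S" if p: "\<pi> permutes {..<n}" and a: "\<alpha> \<in> ?S" for \<pi> \<alpha>
  proof -
    obtain j where j: "j < n" "\<alpha> = xpow j m" using a by blast
    have "perm_exp \<pi> \<alpha> = xpow (\<pi> j) m"
      unfolding j(2) by (rule perm_exp_eqI)
        (use permutes_bij[OF p] in \<open>auto simp: lookup_single when_def inj_eq[OF permutes_inj[OF p]]\<close>)
    then show ?thesis using permutes_in_image[OF p, of j] j(1) by simp
  qed
  have deg: "xdeg \<alpha> = m" if "\<alpha> \<in> ?S" for \<alpha> using that by auto
  have w: "weight n c \<alpha> {} = 1" if c: "\<And>j. j < n \<Longrightarrow> c j ^ m = 1" and a: "\<alpha> \<in> ?S"
    for c :: "nat \<Rightarrow> complex" and \<alpha>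
  proof -
    obtain j where j: "j < n" "\<alpha> = xpow j m" using a by blast
    have "cnj (c i) ^ (lk \<alpha> i + (if i \<in> {} then 1 else 0)) = 1" if "i < n" for i
      using c[OF that] by (cases "i = j") (simp_all add: j(2) lookup_single_not_eq flip: complex_cnj_power)
    then show ?thesis unfolding weight_def by (intro prod.neutral) simp
  qed
  have m0: "0 < m" using m_ge by simp
  show "(\<Sum>\<alpha>\<in>?S. basis_form \<alpha> {}) \<in> polys K n"
    by (rule invariant_monomial_sum(1)[OF fin supp perm deg m0 w]) 
  show "act \<sigma> (\<Sum>\<alpha>\<in>?S. basis_form \<alpha> {}) = (\<Sum>\<alpha>\<in>?S. basis_form \<alpha> {})" if "\<sigma> \<in> G" for \<sigma>
    by (rule invariant_monomial_sum(2)[OF fin supp perm deg m0 w that])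
qed

lemma forms_closed_lin_ext:
  assumes "\<eta> \<in> forms K n" "\<And>\<alpha> I. (\<alpha>, I) \<in> ks \<eta> \<Longrightarrow> \<phi> \<alpha> I \<in> forms K n"
  shows "lin_ext \<phi> \<eta> \<in> forms K n"
  unfolding lin_ext_def
proof (rule forms_sum)
  fix a assume a: "a \<in> ks \<eta>"
  obtain \<alpha> I where e: "a = (\<alpha>, I)" by fastforce
  show "(case a of (\<alpha>, I) \<Rightarrow> scale (lk \<eta> (\<alpha>, I)) (\<phi> \<alpha> I)) \<in> forms K n"
    using a assms(2) forms_scale[OF forms_lookup[OF assms(1)]] by (simp add: e)
qed

lemma exponent_add_support:
  "ks \<alpha> \<subseteq> {..<n} \<Longrightarrow> ks \<beta> \<subseteq> {..<n} \<Longrightarrow> ks (\<alpha> + \<beta> :: nat \<Rightarrow>\<^sub>0 nat) \<subseteq> {..<n}"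
  using Poly_Mapping.keys_add[of \<alpha> \<beta>] by blast

lemma forms_closed_times:
  assumes "\<eta> \<in> forms K n" "\<zeta> \<in> forms K n"
  shows "form_times \<eta> \<zeta> \<in> forms K n"
  unfolding form_times_def
proof (intro forms_closed_lin_ext assms)
  fix \<alpha> I \<beta> J assume "(\<alpha>, I) \<in> ks \<eta>" "(\<beta>, J) \<in> ks \<zeta>"
  note 1 = forms_keysD(1,2)[OF assms(1) this(1)] forms_keysD(1,2)[OF assms(2) this(2)]
  have "(-1 :: complex) ^ k \<in> K" for k by (rule power_in[OF uminus_in[OF one_in]])
  moreover have "ks (\<alpha> + \<beta>) \<subseteq> {..<n}" by (rule exponent_add_support[OF 1(1) 1(3)])
  moreover have "I \<union> J \<subseteq> {..<n}" using 1(2,4) by blast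
  ultimately show "basis_times \<alpha> I \<beta> J \<in> forms K n"
    unfolding basis_times_def by (cases "I \<inter> J = {}") (simp_all add: scale_basis_in_forms zero_in_forms)
qed

lemma polysI: "\<eta> \<in> forms K n \<Longrightarrow> (\<And>\<alpha> I. (\<alpha>, I) \<in> ks \<eta> \<Longrightarrow> I = {}) \<Longrightarrow> \<eta> \<in> polys K n"
  unfolding polys_def by blast

lemma polysD: "\<eta> \<in> polys K n \<Longrightarrow> \<eta> \<in> forms K n"
  "\<eta> \<in> polys K n \<Longrightarrow> (\<alpha>, I) \<in> ks \<eta> \<Longrightarrow> I = {}"
  unfolding polys_def by auto

lemma polys_add: "\<eta> \<in> polys K n \<Longrightarrow> \<zeta> \<in> polys K n \<Longrightarrow> \<eta> + \<zeta> \<in> polys K n"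
proof (rule polysI)
  assume a: "\<eta> \<in> polys K n" "\<zeta> \<in> polys K n"
  show "\<eta> + \<zeta> \<in> forms K n" by (intro forms_add polysD a)
  fix \<alpha> I assume "(\<alpha>, I) \<in> ks (\<eta> + \<zeta>)"
  then have "(\<alpha>, I) \<in> ks \<eta> \<or> (\<alpha>, I) \<in> ks \<zeta>" using Poly_Mapping.keys_add[of \<eta> \<zeta>] by blast
  then show "I = {}" using polysD(2)[OF a(1)] polysD(2)[OF a(2)] by blast
qed

lemma polys_scale: "c \<in> K \<Longrightarrow> \<eta> \<in> polys K n \<Longrightarrow> scale c \<eta> \<in> polys K n"
proof (rule polysI)
  assume a: "c \<in> K" "\<eta> \<in> polys K n"
  show "scale c \<eta> \<in> forms K n" by (intro forms_scale polysD a)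
  show "I = {}" if "(\<alpha>, I) \<in> ks (scale c \<eta>)" for \<alpha> I
    using polysD(2)[OF a(2), of \<alpha> I] that keys_scale_subset by blast
qed

lemma polys_times: "\<eta> \<in> polys K n \<Longrightarrow> \<zeta> \<in> polys K n \<Longrightarrow> form_times \<eta> \<zeta> \<in> polys K n"
proof (rule polysI)
  assume a: "\<eta> \<in> polys K n" "\<zeta> \<in> polys K n"
  show "form_times \<eta> \<zeta> \<in> forms K n" by (intro forms_closed_times polysD a)
  fix \<alpha> I assume "(\<alpha>, I) \<in> ks (form_times \<eta> \<zeta>)"
  then obtain \<alpha>' I' \<beta>' J' where "(\<alpha>', I') \<in> ks \<eta>" "(\<beta>', J') \<in> ks \<zeta>" "(\<alpha>, I) = (\<alpha>' + \<beta>', I' \<union> J')"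
    by (rule keys_form_times)
  then show "I = {}" using polysD(2)[OF a(1)] polysD(2)[OF a(2)] by simp
qed

lemma basis_in_polys: "ks \<alpha> \<subseteq> {..<n} \<Longrightarrow> basis_form \<alpha> {} \<in> polys K n"
  by (rule polysI) (simp_all add: basis_in_forms)

lemma one_in_polys: "one_form \<in> polys K n"
  unfolding one_form_def by (rule basis_in_polys) simp

lemma jacobian_ideal_scale:
  assumes "c \<in> K" "g \<in> jacobian_ideal K n f"
  shows "scale c g \<in> jacobian_ideal K n f"
proof -
  have "form_times (scale c one_form) g \<in> jacobian_ideal K n f"
    using assms polys_scale[OF assms(1) one_in_polys] unfolding jacobian_ideal_def
    by (intro ideal_gen.left)
  then show ?thesis by (simp add: form_times_scale_left)
qed

text \<open>The polynomials all of whose partial derivatives lie in the ideal form a subalgebra, by the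
  product rule. It contains the generators \<open>f\<^sub>i\<close>, hence every invariant polynomial.\<close>

definition jac_algebra :: "(nat \<Rightarrow> form) \<Rightarrow> form set" where
  "jac_algebra f = {g \<in> polys K n. \<forall>j<n. d_x j g \<in> jacobian_ideal K n f}"

lemma jac_algebra_zero: "0 \<in> jac_algebra f"
  unfolding jac_algebra_def jacobian_ideal_def
  by (auto intro!: polysI zero_in_forms ideal_gen.zero simp: linear_op_zero[OF linear_d_x])

lemma jac_algebra_one: "one_form \<in> jac_algebra f"
proof -
  have "d_x j one_form = 0" for j by (simp add: one_form_def d_x_basis)
  then show ?thesis
    unfolding jac_algebra_def jacobian_ideal_def by (simp add: one_in_polys ideal_gen.zero)
qed

lemma jac_algebra_add: "g \<in> jac_algebra f \<Longrightarrow> h \<in> jac_algebra f \<Longrightarrow> g + h \<in> jac_algebra f"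
  unfolding jac_algebra_def jacobian_ideal_def
  by (auto intro!: polys_add ideal_gen.add simp: linear_op_add[OF linear_d_x])

lemma jac_algebra_scale: "c \<in> K \<Longrightarrow> g \<in> jac_algebra f \<Longrightarrow> scale c g \<in> jac_algebra f"
  unfolding jac_algebra_def
  by (auto intro!: polys_scale jacobian_ideal_scale simp: linear_op_scale[OF linear_d_x])

lemma jac_algebra_times: "g \<in> jac_algebra f \<Longrightarrow> h \<in> jac_algebra f \<Longrightarrow> form_times g h \<in> jac_algebra f"
proof -
  assume a: "g \<in> jac_algebra f" "h \<in> jac_algebra f"
  then have p: "g \<in> polys K n" "h \<in> polys K n" by (simp_all add: jac_algebra_def)
  have "d_x j (form_times g h) \<in> jacobian_ideal K n f" if "j < n" for j
    unfolding d_x_form_times jacobian_ideal_def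
    by (intro ideal_gen.add ideal_gen.right[OF p(2)] ideal_gen.left[OF p(1)])
      (use a that in \<open>simp_all add: jac_algebra_def jacobian_ideal_def\<close>)
  with polys_times[OF p] show ?thesis by (simp add: jac_algebra_def)
qed

lemma jac_algebra_sum: "(\<And>a. a \<in> A \<Longrightarrow> g a \<in> jac_algebra f) \<Longrightarrow> (\<Sum>a\<in>A. g a) \<in> jac_algebra f"
  by (induction A rule: infinite_finite_induct) (simp_all add: jac_algebra_zero jac_algebra_add)

lemma jac_algebra_prod: "(\<And>g. g \<in> set gs \<Longrightarrow> g \<in> jac_algebra f) \<Longrightarrow> form_prod gs \<in> jac_algebra f"
  by (induction gs) (simp_all add: jac_algebra_one jac_algebra_times)

lemma invariant_in_jac_algebra:
  assumes f: "basic_invariants K n G f" and g: "g \<in> polys K n" "\<And>\<sigma>. \<sigma> \<in> G \<Longrightarrow> act \<sigma> g = g"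
  shows "g \<in> jac_algebra f"
proof -
  have img: "subst_poly f ` polys K n = {g \<in> polys K n. \<forall>\<sigma>\<in>G. act \<sigma> g = g}"
    and fp: "\<And>i. i < n \<Longrightarrow> f i \<in> polys K n"
    using f unfolding basic_invariants_def by blast+
  have gen: "f i \<in> jac_algebra f" if "i < n" for i
    unfolding jac_algebra_def jacobian_ideal_def using fp that by (auto intro!: ideal_gen.gen)
  have "g \<in> subst_poly f ` polys K n" unfolding img using g by simp
  then obtain P where P: "P \<in> polys K n" "g = subst_poly f P" by blast
  show ?thesis
    unfolding P(2) subst_poly_def lin_ext_def
  proof (rule jac_algebra_sum)
    fix a assume a: "a \<in> ks P"
    obtain \<alpha> I where e: "a = (\<alpha>, I)" by fastforce
    have ks: "ks \<alpha> \<subseteq> {..<n}" by (rule forms_keysD(1)[OF polysD(1)[OF P(1)] a[unfolded e]])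
    have "form_prod (concat (map (\<lambda>i. replicate (lk \<alpha> i) (f i)) (sorted_list_of_set (ks \<alpha>)))) \<in> jac_algebra f"
      by (rule jac_algebra_prod) (use ks gen in auto)
    then show "(case a of (\<alpha>, I) \<Rightarrow> scale (lk P (\<alpha>, I)) (form_prod
        (concat (map (\<lambda>i. replicate (lk \<alpha> i) (f i)) (sorted_list_of_set (ks \<alpha>)))))) \<in> jac_algebra f"
      unfolding e prod.case by (rule jac_algebra_scale[OF forms_lookup[OF polysD(1)[OF P(1)]]])
  qed
qed

text \<open>This is the partial derivative of the invariant \<open>\<Sum> x\<^sub>j\<^sup>m\<close>.\<close>

lemma power_in_jacobian_ideal:
  assumes f: "basic_invariants K n G f" and i: "i < n"
  shows "scale (of_nat m) (basis_form (xpow i (m - 1)) {}) \<in> jacobian_ideal K n f"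
proof -
  let ?S = "(\<lambda>j. xpow j m) ` {..<n}"
  have m0: "m \<noteq> 0" using m_ge by simp
  have inj: "inj_on (\<lambda>j. xpow j m) {..<n}"
  proof (rule inj_onI)
    fix i j assume "xpow i m = xpow j m"
    then have "lk (xpow i m) i = lk (xpow j m) i" by simp
    then show "i = j" using m0 by (simp add: lookup_single when_def split: if_splits)
  qed
  have "d_x i (\<Sum>\<alpha>\<in>?S. basis_form \<alpha> {}) \<in> jacobian_ideal K n f"
    using invariant_in_jac_algebra[OF f power_sum_invariant] i unfolding jac_algebra_def by blast
  also have "d_x i (\<Sum>\<alpha>\<in>?S. basis_form \<alpha> {}) = (\<Sum>j<n. d_x i (basis_form (xpow j m) {}))"
    by (simp add: sum.reindex[OF inj] linear_op_sum[OF linear_d_x])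
  also have "\<dots> = (\<Sum>j<n. if j = i then scale (of_nat m) (basis_form (xpow i (m - 1)) {}) else 0)"
    by (rule sum.cong) (auto simp: d_x_basis lookup_single_not_eq single_diff)
  also have "\<dots> = scale (of_nat m) (basis_form (xpow i (m - 1)) {})" using i by simp
  finally show ?thesis .
qed

text \<open>The exponents of a monomial in a non-constant invariant polynomial are congruent modulo \<open>m\<close> with
  residue divisible by \<open>q\<close>; they are either all divisible by \<open>m\<close> or all at least \<open>q\<close>. Lowering one
  exponent leaves a bad one.\<close>

lemma jacobian_ideal_key_bad:
  assumes f: "basic_invariants K n G f" and g: "g \<in> jacobian_ideal K n f" "(\<beta>, I) \<in> ks g"
  shows "bad \<beta>"
  using g unfolding jacobian_ideal_def
proof (induction g arbitrary: \<beta> I rule: ideal_gen.induct)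
  case (gen g)
  then obtain i j where ij: "i < n" "j < n" and g: "g = d_x j (f i)" by blast
  have fp: "f i \<in> polys K n" using f ij(1) unfolding basic_invariants_def by blast
  have inv: "act \<sigma> (f i) = f i" if "\<sigma> \<in> G" for \<sigma>
  proof -
    have "basis_form (xpow i 1) {} \<in> polys K n" using ij(1) by (intro basis_in_polys) simp
    then have "subst_poly f (basis_form (xpow i 1) {}) \<in> {g \<in> polys K n. \<forall>\<sigma>\<in>G. act \<sigma> g = g}"
      using f unfolding basic_invariants_def by blast
    also have "subst_poly f (basis_form (xpow i 1) {}) = f i"
      by (simp add: subst_poly_def)
    finally show ?thesis using that by simp
  qed
  let ?\<alpha> = "\<beta> + xpow j 1"
  have "lk (f i) (?\<alpha>, I) \<noteq> 0" using gen.prems unfolding g in_keys_iff lookup_d_x by simp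
  then have key: "(?\<alpha>, I) \<in> ks (f i)" by (simp add: in_keys_iff)
  have I: "I = {}" by (rule polysD(2)[OF fp key])
  have inv': "\<And>\<sigma>. \<sigma> \<in> G \<Longrightarrow> act \<sigma> (f i) = scale (det \<sigma> ^ 0) (f i)" using inv by simp
  have cong: "lk ?\<alpha> l mod m = lk ?\<alpha> j mod m" if "l < n" for l
    using semi_invariant_exponents(1)[OF polysD(1)[OF fp] inv' key that ij(2)] by (simp add: I)
  have dvd: "q dvd lk ?\<alpha> j"
    using semi_invariant_exponents(2)[OF polysD(1)[OF fp] inv' key ij(2) ij(2)] by (simp add: I)
  have aj: "lk ?\<alpha> j = lk \<beta> j + 1" by (simp add: lookup_add)
  have al: "lk ?\<alpha> l = lk \<beta> l" if "l \<noteq> j" for l using that by (simp add: lookup_add lookup_single_not_eq)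
  show ?case
  proof (cases "lk ?\<alpha> j mod m = 0")
    case True
    then have "m dvd lk ?\<alpha> j" by (rule mod_0_imp_dvd)
    then have "m \<le> lk \<beta> j + 1" unfolding aj by (rule dvd_imp_le) simp
    then have "m - 1 \<le> lk \<beta> j" by simp
    then show ?thesis unfolding bad_def using ij(2) by blast
  next
    case False
    have "q dvd lk ?\<alpha> j mod m" using dvd m_eq by (simp add: dvd_mod)
    then have "q \<le> lk ?\<alpha> j mod m" using False by (intro dvd_imp_le) simp_all
    then have ge: "q \<le> lk ?\<alpha> l" if "l < n" for l
      using cong[OF that] by (metis mod_less_eq_dividend order_trans)
    have "(if l = j then q - 1 else q) \<le> lk \<beta> l" if "l < n" for l
    proof (cases "l = j")
      case True
      then show ?thesis using ge[OF ij(2)] unfolding aj by simp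
    next
      case False
      then show ?thesis using ge[OF that] al[OF False] by simp
    qed
    then show ?thesis unfolding bad_def using ij(2) by blast
  qed
next
  case (add \<eta> \<zeta>)
  have "(\<beta>, I) \<in> ks \<eta> \<or> (\<beta>, I) \<in> ks \<zeta>" using add.prems Poly_Mapping.keys_add[of \<eta> \<zeta>] by blast
  then show ?case using add.IH by blast
next
  case (left \<omega> \<eta>)
  from left.prems obtain \<alpha>' I' \<beta>' J' where "(\<alpha>', I') \<in> ks \<omega>" "(\<beta>', J') \<in> ks \<eta>"
    "(\<beta>, I) = (\<alpha>' + \<beta>', I' \<union> J')" by (rule keys_form_times)
  then show ?case using left.IH[of \<beta>' J'] bad_add' by simp
next
  case (right \<omega> \<eta>)
  from right.prems obtain \<alpha>' I' \<beta>' J' where "(\<alpha>', I') \<in> ks \<eta>" "(\<beta>', J') \<in> ks \<omega>"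
    "(\<beta>, I) = (\<alpha>' + \<beta>', I' \<union> J')" by (rule keys_form_times)
  then show ?case using right.IH[of \<alpha>' I'] bad_add by simp
qed simp

section \<open>The annihilator of the second determinant power\<close>

lemma SH_0_key:
  assumes "\<eta> \<in> SH K n G 0" "(\<alpha>, I) \<in> ks \<eta>"
  shows "I = {}"
proof -
  obtain i \<zeta> where z: "\<zeta> \<in> SH_comp K n G i 0" "(\<alpha>, I) \<in> ks \<zeta>" using assms by (rule SH_keyE)
  have "card I = 0" using SH_compD(3)[OF z] by simp
  then show ?thesis using forms_keysD(4)[OF SH_compD(1)[OF z(1)] z(2)] by simp
qed

lemma killed_by_monomial_key:
  assumes "d_form (scale c (basis_form \<alpha> {})) \<eta> = 0" "c \<noteq> 0"
  shows "(\<alpha> + \<beta>, I) \<notin> ks \<eta>"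
proof -
  have "scale (cnj c) (d_x_power \<alpha> \<eta>) = 0"
    using assms(1) by (simp add: d_form_scale_left d_form_basis)
  then have "lk (scale (cnj c) (d_x_power \<alpha> \<eta>)) (\<beta>, I) = 0" by simp
  then have "lk (d_x_power \<alpha> \<eta>) (\<beta>, I) = 0" using assms(2) by simp
  then show ?thesis by (simp add: lookup_d_x_power_eq_0_iff in_keys_iff)
qed

text \<open>The power \<open>x\<^sub>0\<^bsup>q-1\<^esup>\<close> (\<open>x\<^sub>0\<close>, if \<open>q = 1\<close>) is the smallest one that annihilates \<open>(x\<^sub>1 \<cdots> x\<^sub>n)\<^bsup>q-2\<^esup>\<close>.\<close>

lemma not_bad_single: "\<not> bad (xpow 0 (max (q - 1) 1))" (is "\<not> bad ?\<alpha>")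
proof
  assume "bad ?\<alpha>"
  then show False unfolding bad_def
  proof (elim disjE exE conjE)
    fix i assume "m - 1 \<le> lk ?\<alpha> i"
    then show False using q_lt m_ge q_ge by (cases "i = 0") (auto simp: lookup_single_not_eq)
  next
    fix j assume j: "\<forall>i<n. (if i = j then q - 1 else q) \<le> lk ?\<alpha> i"
    define i where "i = (if q = 1 \<and> j = 1 then 2 else 1 :: nat)"
    have i: "i < n" "i \<noteq> 0" "q \<noteq> 1 \<or> i \<noteq> j" using n_ge n_ge_3 by (auto simp: i_def)
    have "(if i = j then q - 1 else q) \<le> 0"
      using j[rule_format, OF i(1)] i(2) by (simp add: lookup_single_not_eq)
    then show False using i(3) q_ge by (auto split: if_splits)
  qed
qed

text \<open>If the ideals agreed, \<open>x\<^sub>j\<^bsup>m-1\<^esup>\<close> would annihilate \<open>\<Gamma>\<close>; since \<open>\<Gamma>\<close> transforms by \<open>det\<^sup>2\<close> and is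
  annihilated by \<open>(x\<^sub>1 \<cdots> x\<^sub>n)\<^sup>q\<close>, its only monomial would be \<open>(x\<^sub>1 \<cdots> x\<^sub>n)\<^bsup>q-2\<^esup>\<close>.\<close>

lemma Ann_neq_jacobian_ideal:
  assumes f: "basic_invariants K n G f" and Gamma: "is_Gamma K n G \<Gamma>"
  shows "Ann K n \<Gamma> \<noteq> jacobian_ideal K n f"
proof
  assume eq: "Ann K n \<Gamma> = jacobian_ideal K n f"
  have nz: "\<Gamma> \<noteq> 0" and sh: "\<Gamma> \<in> SH K n G 0"
    and det: "\<And>\<sigma>. \<sigma> \<in> G \<Longrightarrow> act \<sigma> \<Gamma> = scale (det \<sigma> ^ 2) \<Gamma>"
    using Gamma unfolding is_Gamma_def by blast+
  have forms: "\<Gamma> \<in> forms K n" by (rule SH_in_forms[OF sh])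
  have m0: "of_nat m \<noteq> (0::complex)" using m_ge by simp
  have n0: "0 < n" using n_ge by simp
  have key: "\<alpha> = expo n (\<lambda>_. q - 2)" if k: "(\<alpha>, I) \<in> ks \<Gamma>" for \<alpha> I
  proof -
    have I: "I = {}" by (rule SH_0_key[OF sh k])
    have supp: "ks \<alpha> \<subseteq> {..<n}" by (rule forms_keysD(1)[OF forms k])
    have lt: "lk \<alpha> i < m - 1" if i: "i < n" for i
    proof (rule ccontr)
      assume ge: "\<not> lk \<alpha> i < m - 1"
      have "d_form (scale (of_nat m) (basis_form (xpow i (m - 1)) {})) \<Gamma> = 0"
        using power_in_jacobian_ideal[OF f i] unfolding eq[symmetric] Ann_def by simp
      then have "(xpow i (m - 1) + (\<alpha> - xpow i (m - 1)), I) \<notin> ks \<Gamma>"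
        by (rule killed_by_monomial_key[OF _ m0])
      moreover have "xpow i (m - 1) + (\<alpha> - xpow i (m - 1)) = \<alpha>"
        using ge by (intro exponent_single_diff) simp
      ultimately show False using k by simp
    qed
    have cong: "lk \<alpha> i = lk \<alpha> 0" if i: "i < n" for i
      using semi_invariant_exponents(1)[OF forms det k i n0] lt[OF i] lt[OF n0] by (simp add: I)
    have "\<not> q \<le> lk \<alpha> 0"
    proof
      assume ge: "q \<le> lk \<alpha> 0"
      have "d_form (scale 1 (basis_form (expo n (\<lambda>_. q)) {})) \<Gamma> = 0"
        using SH_in_super_harmonics[OF sh] product_invariant unfolding super_harmonics_def by simp
      then have "(expo n (\<lambda>_. q) + (\<alpha> - expo n (\<lambda>_. q)), I) \<notin> ks \<Gamma>"
        by (rule killed_by_monomial_key) simp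
      moreover have "expo n (\<lambda>_. q) + (\<alpha> - expo n (\<lambda>_. q)) = \<alpha>"
      proof (rule exponent_diff_add)
        fix i show "lk (expo n (\<lambda>_. q)) i \<le> lk \<alpha> i"
          using ge cong[of i] by (cases "i < n") (simp_all add: lookup_expo)
      qed
      ultimately show False using k by simp
    qed
    moreover have "q dvd lk \<alpha> 0 + 2"
      using semi_invariant_exponents(2)[OF forms det k n0 n0] by (simp add: I)
    ultimately have a: "lk \<alpha> 0 = q - 2" by (rule residue_minus_two)
    show ?thesis
      by (rule exponent_eqI[OF supp keys_expo]) (simp add: lookup_expo cong[unfolded a])
  qed
  let ?x = "basis_form (xpow 0 (max (q - 1) 1)) {}"
  have "ks (d_form ?x \<Gamma>) = {}"
  proof (rule ccontr)
    assume "ks (d_form ?x \<Gamma>) \<noteq> {}"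
    then obtain \<beta> J where "(\<beta>, J) \<in> ks (d_form ?x \<Gamma>)" by fastforce
    then have "(xpow 0 (max (q - 1) 1) + \<beta>, J) \<in> ks \<Gamma>"
      by (simp add: d_form_basis keys_d_x_power)
    from key[OF this] have "lk (xpow 0 (max (q - 1) 1) + \<beta>) 0 = q - 2"
      using n0 by (simp add: lookup_expo)
    then show False by (simp add: lookup_add)
  qed
  then have "?x \<in> Ann K n \<Gamma>" unfolding Ann_def using n0 by (simp add: basis_in_polys)
  then have "bad (xpow 0 (max (q - 1) 1))"
    unfolding eq by (rule jacobian_ideal_key_bad[OF f]) simp
  then show False using not_bad_single by simp
qed

end

section \<open>The degree of the top harmonic polynomial\<close>

text \<open>Exponents all of whose entries are multiples of \<open>m\<close> and which have degree \<open>k m\<close>: the sum of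
  these monomials is the complete homogeneous symmetric polynomial \<open>h\<^sub>k(x\<^sub>i\<^sup>m : i \<in> A)\<close>.\<close>

definition hom_exps :: "nat \<Rightarrow> nat set \<Rightarrow> nat \<Rightarrow> (nat \<Rightarrow>\<^sub>0 nat) set" where
  "hom_exps m A k = {\<alpha>. ks \<alpha> \<subseteq> A \<and> (\<forall>i. m dvd lk \<alpha> i) \<and> xdeg \<alpha> = k * m}"

lemma finite_hom_exps:
  assumes "finite A"
  shows "finite (hom_exps m A k)"
proof (rule finite_subset)
  let ?F = "A \<rightarrow>\<^sub>E {..k * m}"
  have le: "lk \<alpha> i \<le> xdeg \<alpha>" for \<alpha> i
  proof (cases "i \<in> ks \<alpha>")
    case True
    then show ?thesis unfolding xdeg_def by (intro member_le_sum) auto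
  qed (simp add: in_keys_iff)
  show "hom_exps m A k \<subseteq> (\<lambda>f. \<Sum>i\<in>A. xpow i (f i)) ` ?F"
  proof
    fix \<alpha> assume a: "\<alpha> \<in> hom_exps m A k"
    let ?f = "restrict (lk \<alpha>) A"
    have "?f \<in> ?F" using a le[of \<alpha>] by (auto simp: hom_exps_def)
    moreover have "\<alpha> = (\<Sum>i\<in>A. xpow i (?f i))"
    proof (rule poly_mapping_eqI)
      fix j
      have "lk (\<Sum>i\<in>A. xpow i (?f i)) j = (\<Sum>i\<in>A. if i = j then lk \<alpha> j else 0)"
        unfolding lookup_sum by (rule sum.cong) (auto simp: lookup_single when_def)
      also have "\<dots> = lk \<alpha> j"
        using a assms by (auto simp: hom_exps_def in_keys_iff)
      finally show "lk \<alpha> j = lk (\<Sum>i\<in>A. xpow i (?f i)) j" by simp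
    qed
    ultimately show "\<alpha> \<in> (\<lambda>f. \<Sum>i\<in>A. xpow i (f i)) ` ?F" by blast
  qed
  show "finite ((\<lambda>f. \<Sum>i\<in>A. xpow i (f i)) ` ?F)"
    using assms by (intro finite_imageI finite_PiE) auto
qed

text \<open>\<open>h\<^sub>k\<^sub>+\<^sub>1(A \<union> {a}) = h\<^sub>k\<^sub>+\<^sub>1(A) + x\<^sub>a\<^sup>m h\<^sub>k(A \<union> {a})\<close>, according to whether \<open>x\<^sub>a\<close> occurs.\<close>

lemma hom_exps_insert:
  assumes "a \<notin> A"
  shows "hom_exps m (insert a A) (Suc k) = hom_exps m A (Suc k)
      \<union> (\<lambda>\<alpha>. xpow a m + \<alpha>) ` hom_exps m (insert a A) k" (is "?L = ?R \<union> ?M")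
    and "m > 0 \<Longrightarrow> hom_exps m A (Suc k)
      \<inter> (\<lambda>\<alpha>. xpow a m + \<alpha>) ` hom_exps m (insert a A) k = {}"
proof -
  let ?s = "xpow a m"
  show "?L = ?R \<union> ?M"
  proof (rule equalityI; rule subsetI)
    fix \<alpha> assume a: "\<alpha> \<in> ?L"
    then have supp: "ks \<alpha> \<subseteq> insert a A" and dvd: "\<And>i. m dvd lk \<alpha> i" and deg: "xdeg \<alpha> = Suc k * m"
      unfolding hom_exps_def by auto
    show "\<alpha> \<in> ?R \<union> ?M"
    proof (cases "lk \<alpha> a = 0")
      case True
      then have "ks \<alpha> \<subseteq> A" using supp by (auto simp: in_keys_iff)
      then show ?thesis using dvd deg by (simp add: hom_exps_def)
    next
      case False
      then have "m \<le> lk \<alpha> a" using dvd by (simp add: dvd_imp_le)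
      then have eq: "?s + (\<alpha> - ?s) = \<alpha>"
        by (intro poly_mapping_eqI) (auto simp: lookup_add lookup_minus lookup_single when_def)
      have "xdeg ?s + xdeg (\<alpha> - ?s) = Suc k * m" unfolding xdeg_add[symmetric] eq by (rule deg)
      then have "xdeg (\<alpha> - ?s) = k * m" by simp
      moreover have "m dvd lk (\<alpha> - ?s) i" for i
        using dvd[of i] by (auto simp: lookup_minus lookup_single when_def intro: dvd_diff_nat)
      moreover have "ks (\<alpha> - ?s) \<subseteq> insert a A"
        using supp by (auto simp: in_keys_iff lookup_minus subset_iff)
      ultimately have "\<alpha> - ?s \<in> hom_exps m (insert a A) k" by (simp add: hom_exps_def)
      then have "?s + (\<alpha> - ?s) \<in> ?M" by (rule imageI)
      then show ?thesis unfolding eq by simp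
    qed
  next
    fix \<alpha> assume "\<alpha> \<in> ?R \<union> ?M"
    then show "\<alpha> \<in> ?L"
    proof
      assume "\<alpha> \<in> ?R" then show ?thesis by (auto simp: hom_exps_def)
    next
      assume "\<alpha> \<in> ?M"
      then obtain \<beta> where b: "\<beta> \<in> hom_exps m (insert a A) k" "\<alpha> = ?s + \<beta>" by blast
      have "ks \<alpha> \<subseteq> insert a A"
        using b Poly_Mapping.keys_add[of ?s \<beta>] by (auto simp: hom_exps_def split: if_splits)
      moreover have "m dvd lk \<alpha> i" for i
        using b by (auto simp: hom_exps_def lookup_add lookup_single when_def)
      ultimately show ?thesis using b by (simp add: hom_exps_def xdeg_add)
    qed
  qed
  show "?R \<inter> ?M = {}" if "m > 0"
  proof (rule ccontr)
    assume "?R \<inter> ?M \<noteq> {}"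
    then obtain \<beta> where "?s + \<beta> \<in> ?R" by blast
    then have "ks (?s + \<beta>) \<subseteq> A" by (simp add: hom_exps_def)
    then have "lk (?s + \<beta>) a = 0" using assms by (auto simp: in_keys_iff subset_iff)
    then show False using that by (simp add: lookup_add)
  qed
qed

text \<open>Let \<open>\<phi>\<close> be a linear functional on polynomials, given by its values on monomials, that vanishes
  on the ideal generated by the \<open>h\<^sub>k(x\<^sub>1\<^sup>m, \<dots>, x\<^sub>n\<^sup>m)\<close> with \<open>k > 0\<close>. It also vanishes on \<open>h\<^sub>k(x\<^sub>i\<^sup>m : i \<in> A)\<close> times any
  monomial for \<open>k > n - |A|\<close>, by downward induction on \<open>|A|\<close>.\<close>

lemma hom_sum_vanishes:
  fixes \<phi> :: "(nat \<Rightarrow>\<^sub>0 nat) \<Rightarrow> complex"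
  assumes H: "\<And>k \<gamma>. 0 < k \<Longrightarrow> (\<Sum>\<alpha>\<in>hom_exps m {..<n} k. \<phi> (\<alpha> + \<gamma>)) = 0" and m: "m > 0"
    and A: "A \<subseteq> {..<n}" "n < k + card A"
  shows "(\<Sum>\<alpha>\<in>hom_exps m A k. \<phi> (\<alpha> + \<gamma>)) = 0"
  using A
proof (induction "n - card A" arbitrary: A k \<gamma>)
  case 0
  then have "card A = card {..<n}" using card_mono[of "{..<n}" A] by simp
  then have "A = {..<n}" using 0 by (intro card_subset_eq) auto
  then show ?case using H 0 by simp
next
  case (Suc d)
  have finA: "finite A" using Suc.prems by (blast intro: finite_subset)
  from Suc.hyps(2) have "card A < n" by simp
  then have "\<not> {..<n} \<subseteq> A" using card_mono[OF finA, of "{..<n}"] by auto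
  then obtain a where a: "a < n" "a \<notin> A" by auto
  let ?B = "insert a A" and ?s = "xpow a m"
  obtain k' where k: "k = Suc k'" using \<open>card A < n\<close> Suc.prems(2) by (cases k) auto
  have cB: "card ?B = Suc (card A)" using finA a by simp
  have B: "?B \<subseteq> {..<n}" using Suc.prems a by auto
  have "(\<Sum>\<alpha>\<in>hom_exps m ?B (Suc k'). \<phi> (\<alpha> + \<gamma>))
     = (\<Sum>\<alpha>\<in>hom_exps m A (Suc k'). \<phi> (\<alpha> + \<gamma>))
       + (\<Sum>\<alpha>\<in>(\<lambda>\<alpha>. ?s + \<alpha>) ` hom_exps m ?B k'. \<phi> (\<alpha> + \<gamma>))"
    unfolding hom_exps_insert(1)[OF a(2)]
    by (rule sum.union_disjoint) (use finA hom_exps_insert(2)[OF a(2) m] in \<open>simp_all add: finite_hom_exps\<close>)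
  moreover have "(\<Sum>\<alpha>\<in>(\<lambda>\<alpha>. ?s + \<alpha>) ` hom_exps m ?B k'. \<phi> (\<alpha> + \<gamma>))
     = (\<Sum>\<alpha>\<in>hom_exps m ?B k'. \<phi> (\<alpha> + (?s + \<gamma>)))"
    by (subst sum.reindex) (auto simp: inj_on_def add_ac)
  moreover have "(\<Sum>\<alpha>\<in>hom_exps m ?B (Suc k'). \<phi> (\<alpha> + \<gamma>)) = 0"
    by (rule Suc.hyps(1)[OF _ B]) (use Suc cB k in simp_all)
  moreover have "(\<Sum>\<alpha>\<in>hom_exps m ?B k'. \<phi> (\<alpha> + (?s + \<gamma>))) = 0"
    by (rule Suc.hyps(1)[OF _ B]) (use Suc cB k in simp_all)
  ultimately show ?case unfolding k by simp
qed

lemma bij_sorting_small_first: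
  fixes P :: "nat \<Rightarrow> bool"
  obtains f k where "bij_betw f {..<n} {..<n}" "k \<le> n" "\<And>i. i < n \<Longrightarrow> P (f i) \<longleftrightarrow> i < k"
proof -
  let ?xs = "filter P [0..<n]" and ?ys = "filter (\<lambda>i. \<not> P i) [0..<n]"
  have len: "length (?xs @ ?ys) = n" using sum_length_filter_compl[of P "[0..<n]"] by simp
  have dist: "distinct (?xs @ ?ys)" by auto
  have set: "set (?xs @ ?ys) = {..<n}" by auto
  show ?thesis
  proof (rule that)
    show "bij_betw (\<lambda>i. (?xs @ ?ys) ! i) {..<n} {..<n}"
      using bij_betw_nth[OF dist _ set[symmetric], of "{..<n}"] len by simp
    show "length ?xs \<le> n" using len by simp
    fix i assume i: "i < n"
    show "P ((?xs @ ?ys) ! i) \<longleftrightarrow> i < length ?xs"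
    proof (cases "i < length ?xs")
      case True
      then have "(?xs @ ?ys) ! i \<in> set ?xs" unfolding nth_append by (simp add: nth_mem del: set_filter)
      then show ?thesis using True by simp
    next
      case False
      then have "(?xs @ ?ys) ! i \<in> set ?ys" using i len
        unfolding nth_append by (simp add: nth_mem del: set_filter)
      then show ?thesis using False by simp
    qed
  qed
qed

text \<open>The relations rewrite any monomial, keeping the residues of its exponents modulo \<open>m\<close>, into
  monomials under a staircase \<open>\<lfloor>\<gamma>\<^sub>i / m\<rfloor> \<le> n - 1 - i\<close> for any chosen order of the variables. With the
  variables of residue below \<open>q\<close> placed first, a staircase monomial is either divisible by
  \<open>(x\<^sub>1 \<cdots> x\<^sub>n)\<^sup>q\<close> or has \<open>\<lfloor>\<gamma>\<^sub>i / m\<rfloor> = 0\<close> at one of the first, highest steps, which bounds its degree.\<close>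

lemma functional_vanishes_in_high_degree:
  fixes \<phi> :: "(nat \<Rightarrow>\<^sub>0 nat) \<Rightarrow> complex"
  assumes H: "\<And>k \<gamma>. 0 < k \<Longrightarrow> (\<Sum>\<alpha>\<in>hom_exps m {..<n} k. \<phi> (\<alpha> + \<gamma>)) = 0"
    and Q: "\<And>\<gamma>. \<phi> (expo n (\<lambda>_. q) + \<gamma>) = 0"
    and q: "1 \<le> q" "q \<le> m"
    and g0: "ks \<gamma> \<subseteq> {..<n}" and deg: "m * (\<Sum>i<n. i) + n * q < xdeg \<gamma> + n"
  shows "\<phi> \<gamma> = 0"
proof -
  have m: "m > 0" using q by simp
  define \<rho> where "\<rho> i = lk \<gamma> i mod m" for i
  obtain f k where f: "bij_betw f {..<n} {..<n}" and k: "k \<le> n"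
    and small: "\<And>i. i < n \<Longrightarrow> \<rho> (f i) < q \<longleftrightarrow> i < k"
    by (rule bij_sorting_small_first[of n "\<lambda>i. \<rho> i < q"]) (rule that; assumption)
  have flt: "f i < n" if "i < n" for i using f that by (auto simp: bij_betw_def)
  have finj: "i = j" if "f i = f j" "i < n" "j < n" for i j
    using f that by (auto simp: bij_betw_def dest: inj_onD)
  \<comment> \<open>Under the staircase, the degree is too small unless \<open>(x\<^sub>1 \<cdots> x\<^sub>n)\<^sup>q\<close> divides the monomial; adding \<open>1\<close> at each variable avoids truncated subtraction.\<close>
  have base: "\<phi> \<delta> = 0"
    if d: "ks \<delta> \<subseteq> {..<n}" "xdeg \<delta> = xdeg \<gamma>" "\<And>i. i < n \<Longrightarrow> lk \<delta> i mod m = \<rho> i"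
      and st: "\<And>i. i < n \<Longrightarrow> lk \<delta> (f i) div m \<le> n - Suc i" for \<delta>
  proof (cases "\<exists>i<k. lk \<delta> (f i) div m = 0")
    case True
    then obtain i0 where i0: "i0 < k" "lk \<delta> (f i0) div m = 0" by blast
    have i0n: "i0 < n" using i0 k by simp
    let ?c = "\<lambda>i. (if i = i0 then 0 else m * (n - Suc i)) + (if i < k then q else m)"
    have le: "lk \<delta> (f i) + 1 \<le> ?c i" if i: "i < n" for i
    proof -
      let ?b = "lk \<delta> (f i) div m"
      have e: "lk \<delta> (f i) = m * ?b + \<rho> (f i)"
        unfolding d(3)[OF flt[OF i], symmetric] by simp
      have r: "\<rho> (f i) + 1 \<le> (if i < k then q else m)"
        using small[OF i] m by (auto simp: \<rho>_def Suc_le_eq)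
      have "m * ?b \<le> (if i = i0 then 0 else m * (n - Suc i))"
        using i0(2) mult_le_mono2[OF st[OF i], of m] by simp
      then show ?thesis using e r by linarith
    qed
    have "xdeg \<delta> = (\<Sum>i<n. lk \<delta> i)" by (rule xdeg_superset) (use d in auto)
    also have "\<dots> = (\<Sum>i<n. lk \<delta> (f i))" by (rule sum.reindex_bij_betw[OF f, symmetric])
    finally have "xdeg \<delta> + n = (\<Sum>i<n. lk \<delta> (f i) + 1)" unfolding sum.distrib by simp
    also have "\<dots> \<le> (\<Sum>i<n. ?c i)" by (rule sum_mono) (use le in simp)
    also have "\<dots> = (\<Sum>i<n. if i = i0 then 0 else m * (n - Suc i)) + (\<Sum>i<n. if i < k then q else m)"
      by (rule sum.distrib)
    finally have 1: "xdeg \<delta> + n \<le> (\<Sum>i<n. if i = i0 then 0 else m * (n - Suc i))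
        + (\<Sum>i<n. if i < k then q else m)" .
    have "(\<Sum>i<n. m * (n - Suc i)) = (\<Sum>i<n. (if i = i0 then 0 else m * (n - Suc i))
        + (if i = i0 then m * (n - Suc i0) else 0))"
      by (rule sum.cong) auto
    also have "\<dots> = (\<Sum>i<n. if i = i0 then 0 else m * (n - Suc i)) + m * (n - Suc i0)"
      using i0n by (simp add: sum.distrib)
    finally have 2: "(\<Sum>i<n. if i = i0 then 0 else m * (n - Suc i)) + m * (n - Suc i0) = m * (\<Sum>i<n. i)"
      by (simp add: sum_distrib_left[symmetric] sum.nat_diff_reindex[of "\<lambda>i. i"])
    have "(\<Sum>i<n. if i < k then q else m) = (\<Sum>i\<in>{..<k} \<union> {k..<n}. if i < k then q else m)"
      by (rule sum.cong) (use k in auto)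
    also have "\<dots> = (\<Sum>i<k. if i < k then q else m) + (\<Sum>i\<in>{k..<n}. if i < k then q else m)"
      by (rule sum.union_disjoint) auto
    also have "\<dots> = k * q + (n - k) * m" by simp
    finally have 3: "(\<Sum>i<n. if i < k then q else m) = k * q + (n - k) * m" .
    have "n - k \<le> n - Suc i0" using i0(1) by simp
    then have 4: "(n - k) * m \<le> m * (n - Suc i0)" by (simp add: mult.commute)
    have 5: "k * q \<le> n * q" using k by simp
    show ?thesis using 1 2 3 4 5 deg d(2) by linarith
  next
    case False
    have "q \<le> lk \<delta> i" if i: "i < n" for i
    proof -
      obtain j where j: "j < n" "i = f j" using f i by (auto simp: bij_betw_def)
      show ?thesis
      proof (cases "j < k")
        case True
        then have "lk \<delta> i div m \<noteq> 0" using False unfolding j(2) by simp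
        then have "m \<le> lk \<delta> i" by (metis div_less not_le)
        then show ?thesis using q by simp
      next
        case False
        then have "q \<le> lk \<delta> i mod m" using small[OF j(1)] d(3)[OF i] j(2) by simp
        also have "\<dots> \<le> lk \<delta> i" by (rule mod_less_eq_dividend)
        finally show ?thesis .
      qed
    qed
    then have "expo n (\<lambda>_. q) + (\<delta> - expo n (\<lambda>_. q)) = \<delta>"
      by (intro exponent_diff_add) (simp add: lookup_expo)
    then show ?thesis using Q[of "\<delta> - expo n (\<lambda>_. q)"] by simp
  qed
  \<comment> \<open>The staircase condition is given up at the first \<open>j\<close> variables. In the step, \<open>h\<^bsub>n-j\<^esub>\<close> of the first \<open>j + 1\<close> variables trades \<open>x\<^sub>a\<^bsup>(n-j)m\<^esup>\<close> for smaller powers of \<open>x\<^sub>a\<close>.\<close>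
  have step: "j \<le> n \<Longrightarrow> ks \<delta> \<subseteq> {..<n} \<Longrightarrow> xdeg \<delta> = xdeg \<gamma> \<Longrightarrow> (\<And>i. i < n \<Longrightarrow> lk \<delta> i mod m = \<rho> i) \<Longrightarrow>
      (\<And>i. j \<le> i \<Longrightarrow> i < n \<Longrightarrow> lk \<delta> (f i) div m \<le> n - Suc i) \<Longrightarrow> \<phi> \<delta> = 0" for j \<delta>
  proof (induction j arbitrary: \<delta>)
    case 0
    show ?case by (rule base) (use 0 in auto)
  next
    case (Suc j)
    note IH = Suc.IH
    have j: "j < n" using Suc.prems(1) by simp
    let ?a = "f j"
    let ?A = "insert ?a (f ` {..<j})"
    have A: "?A \<subseteq> {..<n}" using flt j by auto
    have aA: "?a \<notin> f ` {..<j}" using finj j by fastforce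
    have "inj_on f {..<j}"
    proof (rule inj_onI)
      fix x y assume "x \<in> {..<j}" "y \<in> {..<j}" and e: "f x = f y"
      then have "x < n" "y < n" using j by simp_all
      with e show "x = y" by (rule finj)
    qed
    then have cA: "card ?A = Suc j" using aA by (simp add: card_image)
    show ?case using Suc.prems(2-)
    proof (induction "lk \<delta> ?a" arbitrary: \<delta> rule: less_induct)
      case less
      show ?case
      proof (cases "lk \<delta> ?a div m \<le> n - Suc j")
        case True
        show ?thesis
        proof (rule IH)
          fix i assume "j \<le> i" "i < n"
          then show "lk \<delta> (f i) div m \<le> n - Suc i"
            using True less.prems(4)[of i] by (cases "i = j") auto
        qed (use less.prems j in auto)
      next
        case False
        define r where "r = n - j"
        let ?s = "xpow ?a (r * m)"
        have "r \<le> lk \<delta> ?a div m" using False j by (simp add: r_def)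
        then have "r * m \<le> lk \<delta> ?a div m * m" by (rule mult_le_mono1)
        also have "\<dots> \<le> lk \<delta> ?a" by (rule div_times_less_eq_dividend)
        finally have ge: "r * m \<le> lk \<delta> ?a" .
        have eq: "?s + (\<delta> - ?s) = \<delta>"
          by (rule exponent_single_diff[OF ge])
        have fin: "finite (hom_exps m ?A r)" by (rule finite_hom_exps) simp
        have sin: "?s \<in> hom_exps m ?A r"
          by (auto simp: hom_exps_def lookup_single when_def split: if_splits)
        have "0 = (\<Sum>\<alpha>\<in>hom_exps m ?A r. \<phi> (\<alpha> + (\<delta> - ?s)))"
          by (rule hom_sum_vanishes[OF H m A, symmetric]) (use cA j in \<open>simp_all add: r_def\<close>)
        also have "\<dots> = \<phi> (?s + (\<delta> - ?s)) + (\<Sum>\<alpha>\<in>hom_exps m ?A r - {?s}. \<phi> (\<alpha> + (\<delta> - ?s)))"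
          by (rule sum.remove[OF fin sin])
        also have "(\<Sum>\<alpha>\<in>hom_exps m ?A r - {?s}. \<phi> (\<alpha> + (\<delta> - ?s))) = 0"
        proof (rule sum.neutral, rule ballI)
          fix \<alpha> assume al: "\<alpha> \<in> hom_exps m ?A r - {?s}"
          then have supp: "ks \<alpha> \<subseteq> ?A" and dvd: "\<And>i. m dvd lk \<alpha> i" and dg: "xdeg \<alpha> = r * m"
            and ne: "\<alpha> \<noteq> ?s" unfolding hom_exps_def by auto
          have ltA: "lk \<alpha> ?a < r * m"
          proof (rule ccontr)
            assume n: "\<not> lk \<alpha> ?a < r * m"
            have sum: "(\<Sum>i\<in>?A. lk \<alpha> i) = lk \<alpha> ?a + (\<Sum>i\<in>f ` {..<j}. lk \<alpha> i)"
              using aA by simp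
            have "(\<Sum>i\<in>?A. lk \<alpha> i) = r * m"
              using dg xdeg_superset[OF _ supp] by simp
            with sum n have "(\<Sum>i\<in>f ` {..<j}. lk \<alpha> i) = 0" and am: "lk \<alpha> ?a = r * m" by linarith+
            then have z: "lk \<alpha> i = 0" if "i \<in> f ` {..<j}" for i using that by auto
            have "\<alpha> = ?s"
            proof (rule poly_mapping_eqI)
              fix i show "lk \<alpha> i = lk ?s i"
              proof (cases "i = ?a")
                case False
                then have "lk \<alpha> i = 0" using z[of i] supp by (auto simp: in_keys_iff)
                then show ?thesis using False by (simp add: lookup_single_not_eq)
              qed (simp add: am)
            qed
            with ne show False by simp
          qed
          let ?d = "\<alpha> + (\<delta> - ?s)"
          show "\<phi> ?d = 0"
          proof (rule less.hyps)
            show "lk ?d ?a < lk \<delta> ?a" using ltA ge by (simp add: lookup_add lookup_minus)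
            have "ks (\<delta> - ?s) \<subseteq> {..<n}" using less.prems(1) by (auto simp: in_keys_iff lookup_minus subset_iff)
            moreover have "ks \<alpha> \<subseteq> {..<n}" using supp A by blast
            ultimately show "ks ?d \<subseteq> {..<n}" using Poly_Mapping.keys_add[of \<alpha> "\<delta> - ?s"] by blast
            have "r * m + xdeg (\<delta> - ?s) = xdeg \<delta>"
              using arg_cong[OF eq, of xdeg] unfolding xdeg_add by simp
            then show "xdeg ?d = xdeg \<gamma>" using dg less.prems(2) by (simp add: xdeg_add)
            fix i assume i: "i < n"
            have d: "lk \<delta> i = lk ?s i + lk (\<delta> - ?s) i"
              by (simp only: lookup_add[symmetric] eq)
            have "lk ?s i mod m = 0" by (simp add: lookup_single when_def)
            then have "lk \<delta> i mod m = lk (\<delta> - ?s) i mod m" unfolding d by (metis add_0 mod_add_left_eq)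
            moreover have "lk ?d i mod m = lk (\<delta> - ?s) i mod m"
              using dvd[of i] unfolding lookup_add by (metis add_0 dvd_imp_mod_0 mod_add_left_eq)
            ultimately have "lk ?d i mod m = lk \<delta> i mod m" by simp
            then show "lk ?d i mod m = \<rho> i" using less.prems(3)[OF i] by simp
          next
            fix i assume i: "Suc j \<le> i" "i < n"
            have "f i \<notin> ?A" using finj[of i] i j by fastforce
            then have "lk \<alpha> (f i) = 0" "f i \<noteq> ?a" using supp by (auto simp: in_keys_iff)
            then have "lk ?d (f i) = lk \<delta> (f i)"
              by (simp add: lookup_add lookup_minus lookup_single_not_eq)
            then show "lk ?d (f i) div m \<le> n - Suc i" using less.prems(4)[OF i] by simp
          qed
        qed
        finally show ?thesis unfolding eq by simp
      qed
    qed
  qed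
  show ?thesis by (rule step[of n]) (use g0 in \<open>simp_all add: \<rho>_def\<close>)
qed

context imprimitive
begin

lemma hom_invariant:
  assumes k: "0 < k"
  shows "(\<Sum>\<alpha>\<in>hom_exps m {..<n} k. basis_form \<alpha> {}) \<in> invariant_ideal K n G"
proof (rule invariant_monomial_sum(3)[OF finite_hom_exps])
  show "ks \<alpha> \<subseteq> {..<n}" "xdeg \<alpha> = k * m" if "\<alpha> \<in> hom_exps m {..<n} k" for \<alpha>
    using that by (simp_all add: hom_exps_def)
  show "0 < k * m" using k m_ge by simp
  show "perm_exp \<pi> \<alpha> \<in> hom_exps m {..<n} k"
    if p: "\<pi> permutes {..<n}" and a: "\<alpha> \<in> hom_exps m {..<n} k" for \<pi> \<alpha>
  proof -
    have supp: "ks \<alpha> \<subseteq> {..<n}" and dvd: "\<And>i. m dvd lk \<alpha> i" and deg: "xdeg \<alpha> = k * m"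
      using a by (simp_all add: hom_exps_def)
    have "\<alpha> = expo n (lk \<alpha>)" by (rule exponent_eqI[OF supp keys_expo]) (simp add: lookup_expo)
    moreover have "perm_exp \<pi> (expo n (lk \<alpha>)) = expo n (lk \<alpha> \<circ> inv_into UNIV \<pi>)"
      by (rule perm_exp_expo[OF p]) (simp add: permutes_inverses(2)[OF p])
    ultimately have e: "perm_exp \<pi> \<alpha> = expo n (lk \<alpha> \<circ> inv_into UNIV \<pi>)" by simp
    have "(\<Sum>i<n. lk \<alpha> (inv_into UNIV \<pi> i)) = (\<Sum>i<n. lk \<alpha> i)"
      using sum.permute[OF permutes_inv[OF p], of "lk \<alpha>"] by (simp add: comp_def)
    also have "\<dots> = k * m" using deg xdeg_superset[OF _ supp] by simp
    finally show ?thesis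
      unfolding e hom_exps_def using dvd keys_expo by (simp add: xdeg_expo lookup_expo)
  qed
  fix c :: "nat \<Rightarrow> complex" and \<alpha>
  assume c: "\<And>j. j < n \<Longrightarrow> c j ^ m = 1" and a: "\<alpha> \<in> hom_exps m {..<n} k"
  show "weight n c \<alpha> {} = 1"
    unfolding weight_def
  proof (rule prod.neutral, rule ballI)
    fix j assume "j \<in> {..<n}"
    then have "c j ^ m = 1" using c by simp
    moreover have "m dvd lk \<alpha> j" using a by (simp add: hom_exps_def)
    then obtain l where "lk \<alpha> j = m * l" by (rule dvdE)
    ultimately show "cnj (c j) ^ (lk \<alpha> j + (if j \<in> {} then 1 else 0)) = 1"
      by (simp add: power_mult flip: complex_cnj_power)
  qed
qed simp

text \<open>The functional sends \<open>x\<^sup>\<alpha>\<close> to the constant \<open>\<partial>\<^sup>\<alpha> F\<close> at the origin; it vanishes on the multiples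
  of \<open>h\<^sub>k(x\<^sub>1\<^sup>m, \<dots>, x\<^sub>n\<^sup>m)\<close> and \<open>(x\<^sub>1 \<cdots> x\<^sub>n)\<^sup>q\<close>, as \<open>F\<close> is harmonic.\<close>

lemma harmonic_degree_le:
  assumes F: "F \<in> SH_comp K n G i 0" "F \<noteq> 0"
  shows "i + int n \<le> int (m * (\<Sum>i<n. i) + n * q)"
proof (rule ccontr)
  assume big: "\<not> i + int n \<le> int (m * (\<Sum>i<n. i) + n * q)"
  from F(2) have "ks F \<noteq> {}" by simp
  then obtain \<gamma> I where key: "(\<gamma>, I) \<in> ks F" by fastforce
  have I: "I = {}" using SH_0_key[OF SH_comp_subset_SH[OF F(1)] key] .
  have sh: "d_form \<omega> F = 0" if "\<omega> \<in> invariant_ideal K n G" for \<omega>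
    using SH_compD(2)[OF F(1)] that unfolding super_harmonics_def by blast
  define \<phi> where "\<phi> \<alpha> = exp_fact \<alpha> * lk F (\<alpha>, {})" for \<alpha>
  have "\<phi> \<gamma> = 0"
  proof (rule functional_vanishes_in_high_degree)
    show "(\<Sum>\<alpha>\<in>hom_exps m {..<n} k. \<phi> (\<alpha> + \<gamma>)) = 0" if "0 < k" for k \<gamma>
    proof -
      have "(\<Sum>\<alpha>\<in>hom_exps m {..<n} k. \<phi> (\<alpha> + \<gamma>))
        = (\<Sum>\<alpha>\<in>hom_exps m {..<n} k. exp_fact \<gamma> * lk (d_x_power \<alpha> F) (\<gamma>, {}))"
        unfolding \<phi>_def by (simp only: lookup_d_x_power)
      also have "\<dots> = exp_fact \<gamma> * lk (d_form (\<Sum>\<alpha>\<in>hom_exps m {..<n} k. basis_form \<alpha> {}) F) (\<gamma>, {})"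
        unfolding d_form_sum_left d_form_basis by (simp add: lookup_sum sum_distrib_left)
      also have "\<dots> = 0" unfolding sh[OF hom_invariant[OF that]] by simp
      finally show ?thesis .
    qed
    show "\<phi> (expo n (\<lambda>_. q) + \<gamma>) = 0" for \<gamma>
    proof -
      have "\<phi> (expo n (\<lambda>_. q) + \<gamma>) = exp_fact \<gamma> * lk (d_form (basis_form (expo n (\<lambda>_. q)) {}) F) (\<gamma>, {})"
        unfolding \<phi>_def d_form_basis by (simp add: lookup_d_x_power)
      then show ?thesis unfolding sh[OF product_invariant] by simp
    qed
    show "1 \<le> q" by (rule q_ge)
    show "q \<le> m" using q_lt by simp
    show "ks \<gamma> \<subseteq> {..<n}" by (rule forms_keysD(1)[OF SH_compD(1)[OF F(1)] key])
    have "int (xdeg \<gamma>) = i" using SH_compD(3)[OF F(1) key] by simp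
    then show "m * (\<Sum>i<n. i) + n * q < xdeg \<gamma> + n" using big by linarith
  qed
  then show False using key by (simp add: \<phi>_def I in_keys_iff)
qed

lemma Delta_degree_le:
  assumes "is_Delta K n G \<Delta>"
  shows "x_degree \<Delta> + n \<le> m * (\<Sum>i<n. i) + n * q"
proof -
  obtain t where t: "is_top_degree (\<lambda>i. SH_comp K n G i 0) t"
    and eq: "SH_comp K n G t 0 = {scale c \<Delta> | c. c \<in> K}"
    using assms unfolding is_Delta_def by blast
  have nz: "\<Delta> \<noteq> 0"
  proof
    assume "\<Delta> = 0"
    then have "SH_comp K n G t 0 = {0}" unfolding eq using one_in by auto
    then show False using t unfolding is_top_degree_def by simp
  qed
  have "scale 1 \<Delta> \<in> SH_comp K n G t 0" unfolding eq using one_in by blast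
  then have mem: "\<Delta> \<in> SH_comp K n G t 0" by simp
  have "x_degree \<Delta> \<in> (\<lambda>(\<alpha>, I). xdeg \<alpha>) ` ks \<Delta>"
    unfolding x_degree_def using nz by (intro Max_in) auto
  then obtain \<alpha> I where "(\<alpha>, I) \<in> ks \<Delta>" "x_degree \<Delta> = xdeg \<alpha>" by auto
  then have "int (x_degree \<Delta>) = t" using SH_compD(3)[OF mem] by simp
  then show ?thesis using harmonic_degree_le[OF mem nz] by linarith
qed

end

section \<open>Equivariant operators and co-exponents\<close>

context imprimitive
begin

lemma d_x_in_forms: "\<eta> \<in> forms K n \<Longrightarrow> d_x i \<eta> \<in> forms K n"
  unfolding d_x_def
proof (rule forms_closed_lin_ext)
  assume e: "\<eta> \<in> forms K n"
  fix \<alpha> I assume k: "(\<alpha>, I) \<in> ks \<eta>"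
  have "ks (\<alpha> - xpow i 1) \<subseteq> ks \<alpha>" by (auto simp: in_keys_iff lookup_minus)
  then have "ks (\<alpha> - xpow i 1) \<subseteq> {..<n}" using forms_keysD(1)[OF e k] by blast
  then show "scale (of_nat (lk \<alpha> i)) (basis_form (\<alpha> - xpow i 1) I) \<in> forms K n"
    by (rule scale_basis_in_forms[OF of_nat_in _ forms_keysD(2)[OF e k]])
qed

lemma d_x_power_in_forms: "\<eta> \<in> forms K n \<Longrightarrow> d_x_power \<alpha> \<eta> \<in> forms K n"
proof -
  assume e: "\<eta> \<in> forms K n"
  have pow: "(d_x i ^^ k) \<zeta> \<in> forms K n" if "\<zeta> \<in> forms K n" for i k \<zeta>
    by (induction k) (simp_all add: that d_x_in_forms)
  have "foldr (\<lambda>i. d_x i ^^ lk \<alpha> i) xs \<eta> \<in> forms K n" for xs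
    by (induction xs) (simp_all add: e pow)
  then show ?thesis by (simp add: d_x_power_def)
qed

lemma diff_op_apply:
  "\<eta> \<in> forms K n \<Longrightarrow> diff_op K n \<omega> \<eta>
     = lin_ext (\<lambda>\<alpha> I. form_times (basis_form 0 I) (d_x_power \<alpha> \<eta>)) \<omega>"
  by (simp add: diff_op_def)

lemma diff_op_in_forms:
  assumes "\<omega> \<in> forms K n" "\<eta> \<in> forms K n"
  shows "diff_op K n \<omega> \<eta> \<in> forms K n"
  unfolding diff_op_apply[OF assms(2)]
  by (intro forms_closed_lin_ext assms(1) forms_closed_times basis_in_forms d_x_power_in_forms assms(2))
    (use forms_keysD(2)[OF assms(1)] in auto)

lemma diff_op_linear:
  assumes "\<eta> \<in> forms K n" "c \<in> K"
  shows "diff_op K n \<omega> (scale c \<eta>) = scale c (diff_op K n \<omega> \<eta>)"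
proof -
  have "form_times (basis_form 0 I) (d_x_power \<alpha> (scale c \<eta>))
     = scale c (form_times (basis_form 0 I) (d_x_power \<alpha> \<eta>))" for \<alpha> I
    by (simp only: linear_op_scale[OF linear_d_x_power] form_times_scale_right)
  then show ?thesis
    unfolding diff_op_apply[OF assms(1)] diff_op_apply[OF forms_scale[OF assms(2,1)]]
    by (intro poly_mapping_eqI) (simp add: lookup_lin_ext sum_distrib_left mult.left_commute)
qed

lemma diff_op_key:
  assumes "\<eta> \<in> forms K n" "(\<gamma>, J) \<in> ks (diff_op K n \<omega> \<eta>)"
  obtains \<alpha> I J' where "(\<alpha>, I) \<in> ks \<omega>" "(\<alpha> + \<gamma>, J') \<in> ks \<eta>" "J = I \<union> J'" "I \<inter> J' = {}"
proof -
  from assms(2) obtain \<alpha> I where 1: "(\<alpha>, I) \<in> ks \<omega>"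
    "(\<gamma>, J) \<in> ks (form_times (basis_form 0 I) (d_x_power \<alpha> \<eta>))"
    unfolding diff_op_apply[OF assms(1)] by (rule keys_lin_ext)
  from 1(2) obtain \<alpha>' I' \<beta> J' where 2: "(\<alpha>', I') \<in> ks (basis_form 0 I)"
    "(\<beta>, J') \<in> ks (d_x_power \<alpha> \<eta>)" "(\<gamma>, J) = (\<alpha>' + \<beta>, I' \<union> J')" "I' \<inter> J' = {}"
    by (rule keys_form_times)
  then show ?thesis using that[OF 1(1), of J'] by (simp add: keys_d_x_power)
qed

lemma diff_op_bihomogeneous:
  assumes om: "\<omega> \<in> forms K n" "bihomogeneous e k' \<omega>" and eta: "\<eta> \<in> forms K n" "bihomogeneous i k \<eta>"
  shows "bihomogeneous (i - e) (k' + k) (diff_op K n \<omega> \<eta>)"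
  unfolding bihomogeneous_def
proof (clarify)
  fix \<gamma> J assume "(\<gamma>, J) \<in> ks (diff_op K n \<omega> \<eta>)"
  then obtain \<alpha> I J' where k: "(\<alpha>, I) \<in> ks \<omega>" "(\<alpha> + \<gamma>, J') \<in> ks \<eta>" "J = I \<union> J'" "I \<inter> J' = {}"
    by (rule diff_op_key[OF eta(1)])
  have "int (xdeg \<alpha>) = e" "card I = k'" using om(2) k(1) unfolding bihomogeneous_def by auto
  moreover have "int (xdeg (\<alpha> + \<gamma>)) = i" "card J' = k" using eta(2) k(2) unfolding bihomogeneous_def by auto
  moreover have "finite I" "finite J'"
    using forms_keysD(4)[OF om(1) k(1)] forms_keysD(4)[OF eta(1) k(2)] by simp_all
  ultimately show "int (xdeg \<gamma>) = i - e \<and> card J = k' + k"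
    using k(3,4) by (simp add: card_Un_disjoint xdeg_add)
qed

lemma theta_times_poly:
  assumes "\<And>\<alpha> J. (\<alpha>, J) \<in> ks \<zeta> \<Longrightarrow> J = {}"
  shows "lk (form_times (basis_form 0 I) \<zeta>) (\<gamma>, J) = (if J = I then lk \<zeta> (\<gamma>, {}) else 0)"
proof -
  have "lk (form_times (basis_form 0 I) \<zeta>) (\<gamma>, J)
     = lk (lin_ext (\<lambda>\<alpha> J. basis_times 0 I \<alpha> J) \<zeta>) (\<gamma>, J)"
    by (simp add: form_times_def)
  also have "\<dots> = (\<Sum>a\<in>ks \<zeta>. lk \<zeta> a * (if a = (\<gamma>, {}) \<and> J = I then 1 else 0))"
    unfolding lookup_lin_ext
  proof (rule sum.cong[OF refl])
    fix a assume a: "a \<in> ks \<zeta>"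
    obtain \<alpha> where e: "a = (\<alpha>, {})" using assms[of "fst a" "snd a"] a by (cases a) auto
    show "lk \<zeta> a * lk (basis_times 0 I (fst a) (snd a)) (\<gamma>, J)
        = lk \<zeta> a * (if a = (\<gamma>, {}) \<and> J = I then 1 else 0)"
      by (simp add: e basis_times_empty_right lookup_basis_form)
  qed
  also have "\<dots> = (if J = I then lk \<zeta> (\<gamma>, {}) else 0)"
  proof (cases "J = I")
    case True
    have "(\<Sum>a\<in>ks \<zeta>. lk \<zeta> a * (if a = (\<gamma>, {}) \<and> J = I then 1 else 0))
       = (\<Sum>a\<in>ks \<zeta>. if a = (\<gamma>, {}) then lk \<zeta> (\<gamma>, {}) else 0)"
      by (rule sum.cong) (simp_all add: True)
    then show ?thesis using True by (simp add: in_keys_iff)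
  qed simp
  finally show ?thesis .
qed

text \<open>The operator \<open>\<Sum> c\<^bsub>\<alpha>,I\<^esub> \<theta>\<^sub>I \<partial>\<^sup>\<alpha>\<close> maps \<open>x\<^sup>\<beta>\<close> to a form whose coefficient at \<open>\<theta>\<^sub>J\<close> is \<open>\<beta>! c\<^bsub>\<beta>,J\<^esub>\<close>.\<close>

lemma diff_op_on_monomial:
  assumes b: "ks \<beta> \<subseteq> {..<n}"
  shows "lk (diff_op K n \<omega> (basis_form \<beta> {})) (0, J) = exp_fact \<beta> * lk \<omega> (\<beta>, J)"
proof -
  have dx: "lk (d_x_power \<alpha> (basis_form \<beta> {})) (0, {}) = (if \<alpha> = \<beta> then exp_fact \<beta> else 0)" for \<alpha>
    using lookup_d_x_power[of 0 \<alpha> "basis_form \<beta> {}" "{}"] by (simp add: lookup_basis_form)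
  have poly: "I = {}" if "(\<gamma>, I) \<in> ks (d_x_power \<alpha> (basis_form \<beta> {}))" for \<alpha> \<gamma> I
    using that by (simp add: keys_d_x_power)
  have "lk (diff_op K n \<omega> (basis_form \<beta> {})) (0, J)
     = (\<Sum>a\<in>ks \<omega>. lk \<omega> a * (if J = snd a then lk (d_x_power (fst a) (basis_form \<beta> {})) (0, {}) else 0))"
    unfolding diff_op_apply[OF basis_in_forms[OF b empty_subsetI]] lookup_lin_ext
    by (simp only: theta_times_poly[OF poly])
  also have "\<dots> = (\<Sum>a\<in>ks \<omega>. if a = (\<beta>, J) then exp_fact \<beta> * lk \<omega> (\<beta>, J) else 0)"
    by (rule sum.cong) (auto simp: dx)
  also have "\<dots> = exp_fact \<beta> * lk \<omega> (\<beta>, J)" by (simp add: in_keys_iff)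
  finally show ?thesis .
qed

lemma weight_in: "(\<And>j. j < n \<Longrightarrow> c j ^ m = 1) \<Longrightarrow> weight n c \<alpha> I \<in> K"
  unfolding weight_def by (intro prod_in power_in cnj_closed roots_in) simp

text \<open>Equivariance under the diagonal matrices forces \<open>\<partial>\<^sup>\<beta>\<close> and \<open>\<theta>\<^sub>J\<close> to have inverse weights, that is,
  the quotient of \<open>x\<^sup>\<beta>\<close> by \<open>\<Prod>\<^bsub>j\<in>J\<^esub> x\<^sub>j\<close> to have trivial weight. The summand \<open>m - 1\<close>
  stands for \<open>-1\<close> modulo \<open>m\<close>.\<close>

lemma equivariant_key_exponents:
  assumes eq: "diff_op K n \<omega> \<in> equivariant_ops K n G" and om: "\<omega> \<in> forms K n"
    and key: "(\<beta>, J) \<in> ks \<omega>" and ij: "i < n" "j < n"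
  shows "(lk \<beta> i + (if i \<in> J then m - 1 else 0)) mod m = (lk \<beta> j + (if j \<in> J then m - 1 else 0)) mod m"
    and "q dvd lk \<beta> i + (if i \<in> J then m - 1 else 0)"
proof -
  let ?D = "diff_op K n \<omega>" and ?x = "basis_form \<beta> {}"
  let ?e = "\<lambda>i. lk \<beta> i + (if i \<in> J then m - 1 else 0)"
  note kD = forms_keysD[OF om key]
  have xf: "?x \<in> forms K n" using kD(1) by (rule basis_in_forms) simp
  define v where "v = lk (?D ?x) (0, J)"
  have v: "v \<noteq> 0" using key unfolding v_def diff_op_on_monomial[OF kD(1)] by (simp add: in_keys_iff)
  have char: "(\<Prod>j<n. c j ^ ?e j) * (\<Prod>j<n. c j) ^ 0 = 1"
    if c: "\<And>j. j < n \<Longrightarrow> c j ^ m = 1" "(\<Prod>j<n. c j) ^ q = 1" for c :: "nat \<Rightarrow> complex"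
  proof -
    let ?s = "mon_mat n id c"
    have s: "?s \<in> G" by (rule mon_mat_in_G[OF permutes_id c])
    have "act ?s ?x = scale (weight n c \<beta> {}) ?x"
      using act_mon_mat_basis[OF permutes_id kD(1) empty_subsetI, of c] by simp
    then have "?D (act ?s ?x) = scale (weight n c \<beta> {}) (?D ?x)"
      using diff_op_linear[OF xf weight_in[of c, OF c(1)]] by simp
    moreover have "?D (act ?s ?x) = act ?s (?D ?x)"
      using eq s xf unfolding equivariant_ops_def by blast
    ultimately have "lk (act ?s (?D ?x)) (0, J) = lk (scale (weight n c \<beta> {}) (?D ?x)) (0, J)" by simp
    then have "weight n c 0 J * v = weight n c \<beta> {} * v"
      unfolding lookup_act_diag[OF diff_op_in_forms[OF om xf]] by (simp add: v_def)
    then have w: "weight n c 0 J = weight n c \<beta> {}" using v by simp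
    have cc: "c l * cnj (c l) = 1" if "l < n" for l
      using root_of_unity_cnj[OF c(1)[OF that] m_ge_1] by simp
    have 1: "(\<Prod>j<n. c j ^ lk \<beta> j) * weight n c \<beta> {} = 1"
      unfolding weight_def prod.distrib[symmetric]
      by (rule prod.neutral) (simp add: power_mult_distrib[symmetric] cc)
    have "(\<Prod>j<n. c j ^ (if j \<in> J then m - 1 else 0)) = weight n c 0 J"
      unfolding weight_def
    proof (rule prod.cong[OF refl])
      fix l assume "l \<in> {..<n}"
      then have l: "l < n" by simp
      have "m = Suc (m - 1)" using m_ge by simp
      then have "c l * c l ^ (m - 1) = 1" using c(1)[OF l] by (metis power_Suc)
      then have "cnj (c l) * (c l * c l ^ (m - 1)) = cnj (c l)" by simp
      then have "c l ^ (m - 1) = cnj (c l)" using cc[OF l] by (simp add: mult.assoc[symmetric] mult.commute)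
      then show "c l ^ (if l \<in> J then m - 1 else 0) = cnj (c l) ^ (lk 0 l + (if l \<in> J then 1 else 0))"
        by simp
    qed
    then have "(\<Prod>j<n. c j ^ ?e j) = (\<Prod>j<n. c j ^ lk \<beta> j) * weight n c \<beta> {}"
      by (simp only: power_add prod.distrib w)
    then show ?thesis using 1 by simp
  qed
  show "?e i mod m = ?e j mod m" "q dvd ?e i"
    using diagonal_character[of n m q ?e 0 p i j, OF char m_eq m_ge_1 ij] by simp_all
qed

text \<open>If two exponents agree, the transposition of these variables fixes \<open>x\<^sup>\<beta>\<close> but changes the sign of
  \<open>\<theta>\<^sub>1 \<cdots> \<theta>\<^sub>n\<close>.\<close>

lemma equivariant_top_key_distinct:
  assumes eq: "diff_op K n \<omega> \<in> equivariant_ops K n G" and om: "\<omega> \<in> forms K n"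
    and key: "(\<beta>, {..<n}) \<in> ks \<omega>" and ij: "i < n" "j < n" "i \<noteq> j"
  shows "lk \<beta> i \<noteq> lk \<beta> j"
proof
  assume e: "lk \<beta> i = lk \<beta> j"
  let ?D = "diff_op K n \<omega>" and ?x = "basis_form \<beta> {}" and ?\<tau> = "Transposition.transpose i j"
  note kD = forms_keysD[OF om key]
  have xf: "?x \<in> forms K n" using kD(1) by (rule basis_in_forms) simp
  have t: "?\<tau> permutes {..<n}" using ij by (intro permutes_swap_id) auto
  have tb: "perm_exp ?\<tau> \<beta> = \<beta>"
    by (rule perm_exp_eqI) (use e in \<open>simp_all add: Transposition.transpose_def\<close>)
  have t0: "perm_exp ?\<tau> 0 = 0" by (simp add: perm_exp_def)
  let ?s = "mon_mat n ?\<tau> (\<lambda>_. 1)"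
  have "sort_sign ?\<tau> {} = 1" by (simp add: sort_sign_def)
  then have "act ?s ?x = ?x" using act_mon_mat_basis[OF t kD(1) empty_subsetI, of "\<lambda>_. 1"] tb by simp
  moreover have "?D (act ?s ?x) = act ?s (?D ?x)"
    using eq perm_mat_in_G[OF t] xf unfolding equivariant_ops_def by blast
  ultimately have "lk (act ?s (?D ?x)) (0, {..<n}) = lk (?D ?x) (0, {..<n})" by simp
  moreover have "lk (act ?s (?D ?x)) (0, {..<n}) = - lk (?D ?x) (0, {..<n})"
    using lookup_act_mon_mat[OF t diff_op_in_forms[OF om xf], of "\<lambda>_. 1" 0 "{..<n}"]
    unfolding t0 permutes_image[OF t] sort_sign_top[OF t] by (simp add: sign_swap_id ij(3))
  ultimately have "lk (?D ?x) (0, {..<n}) = 0" by simp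
  then show False using key unfolding diff_op_on_monomial[OF kD(1)] by (simp add: in_keys_iff)
qed

end

lemma sum_distinct_ge:
  fixes A :: "nat set"
  assumes "finite A"
  shows "(\<Sum>i<card A. i) \<le> \<Sum>A"
  using assms
proof (induction "card A" arbitrary: A)
  case 0
  then show ?case by simp
next
  case (Suc d)
  let ?x = "Max A"
  have "A \<noteq> {}" using Suc.hyps(2) by auto
  then have x: "?x \<in> A" using Suc.prems by (rule Max_in[rotated])
  have "A \<subseteq> {..?x}" using Suc.prems by auto
  then have "card A \<le> Suc ?x" using card_mono[of "{..?x}" A] by simp
  then have "d \<le> ?x" using Suc.hyps(2) by simp
  moreover have "(\<Sum>i<card (A - {?x}). i) \<le> \<Sum>(A - {?x})"
    by (rule Suc.hyps(1)) (use Suc x in simp_all)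
  moreover have "card (A - {?x}) = d" using Suc x by simp
  moreover have "\<Sum>A = ?x + \<Sum>(A - {?x})" using Suc.prems x by (rule sum.remove)
  ultimately show ?case unfolding Suc.hyps(2)[symmetric] by simp
qed

context imprimitive
begin

text \<open>The exponents are distinct and congruent modulo \<open>m\<close>, hence distinct multiples of \<open>m\<close> shifted by a
  common residue. This residue is congruent to \<open>1\<close> modulo \<open>q\<close>, so it is positive unless \<open>q = 1\<close>.\<close>

lemma equivariant_top_key_degree:
  assumes eq: "diff_op K n \<omega> \<in> equivariant_ops K n G" and om: "\<omega> \<in> forms K n"
    and key: "(\<beta>, {..<n}) \<in> ks \<omega>"
  shows "m * (\<Sum>i<n. i) + (if q = 1 then 0 else n) \<le> xdeg \<beta>"
proof -
  note kD = forms_keysD[OF om key]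
  have n0: "0 < n" using n_ge by simp
  define c where "c = lk \<beta> 0 mod m"
  have c: "lk \<beta> i mod m = c" if i: "i < n" for i
  proof -
    have "(lk \<beta> i + (m - 1)) mod m = (lk \<beta> 0 + (m - 1)) mod m"
      using equivariant_key_exponents(1)[OF eq om key i n0] i n0 by simp
    then have "(lk \<beta> i + (m - 1) + 1) mod m = (lk \<beta> 0 + (m - 1) + 1) mod m"
      by (metis mod_add_left_eq)
    then show ?thesis using m_ge by (simp add: c_def)
  qed
  have c1: "(if q = 1 then 0 else 1) \<le> c"
  proof (cases "q = 1")
    case False
    have "c \<noteq> 0"
    proof
      assume "c = 0"
      then have "m dvd lk \<beta> 0" unfolding c_def by (rule mod_0_imp_dvd)
      then have "q dvd lk \<beta> 0" using m_eq by (metis dvd_mult_right)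
      moreover have "q dvd lk \<beta> 0 + (m - 1)"
        using equivariant_key_exponents(2)[OF eq om key n0 n0] n0 by simp
      ultimately have "q dvd m - 1" by (simp add: dvd_add_right_iff)
      moreover have "q dvd m" using m_eq by simp
      ultimately have "q dvd m - (m - 1)" by (rule dvd_diff_nat[rotated])
      then show False using False m_ge by simp
    qed
    then show ?thesis by simp
  qed simp
  let ?b = "\<lambda>i. lk \<beta> i div m"
  have inj: "inj_on ?b {..<n}"
  proof (rule inj_onI)
    fix i j assume ij: "i \<in> {..<n}" "j \<in> {..<n}" and e: "?b i = ?b j"
    have "lk \<beta> i = m * ?b i + c" "lk \<beta> j = m * ?b j + c"
      using c[of i] c[of j] ij by (metis lessThan_iff mult_div_mod_eq)+
    then have "lk \<beta> i = lk \<beta> j" unfolding e by simp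
    then show "i = j" using equivariant_top_key_distinct[OF eq om key, of i j] ij by auto
  qed
  have "(\<Sum>i<n. i) \<le> \<Sum>(?b ` {..<n})" using sum_distinct_ge[of "?b ` {..<n}"] by (simp add: card_image[OF inj])
  also have "\<dots> = (\<Sum>i<n. ?b i)" by (simp add: sum.reindex[OF inj])
  finally have le: "m * (\<Sum>i<n. i) \<le> m * (\<Sum>i<n. ?b i)" by simp
  have "xdeg \<beta> = (\<Sum>i<n. lk \<beta> i)" by (rule xdeg_superset[OF _ kD(1)]) simp
  also have "\<dots> = (\<Sum>i<n. m * ?b i + c)"
  proof (rule sum.cong[OF refl])
    fix i assume "i \<in> {..<n}"
    then have "lk \<beta> i mod m = c" using c by simp
    then show "lk \<beta> i = m * ?b i + c" by (metis mult_div_mod_eq)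
  qed
  also have "\<dots> = m * (\<Sum>i<n. ?b i) + n * c" by (simp add: sum.distrib sum_distrib_left)
  finally have "xdeg \<beta> = m * (\<Sum>i<n. ?b i) + n * c" .
  moreover have "(if q = 1 then 0 else n) \<le> n * c" using mult_le_mono2[OF c1, of n] by (simp split: if_splits)
  ultimately show ?thesis using le by linarith
qed

context
  fixes f :: "nat \<Rightarrow> form" and d :: "nat \<Rightarrow> form \<Rightarrow> form" and e :: "nat \<Rightarrow> nat"
  assumes ops: "orlik_solomon_ops K n G f d e"
begin

lemma d_diff_op:
  assumes "i < n"
  obtains \<omega> where "\<omega> \<in> forms K n" "bihomogeneous (int (e i)) 1 \<omega>" "d i = diff_op K n \<omega>"
    "diff_op K n \<omega> \<in> equivariant_ops K n G"
  using ops assms unfolding orlik_solomon_ops_def by metis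

text \<open>The product \<open>d\<^bsub>i\<^sub>1\<^esub> \<cdots> d\<^bsub>i\<^sub>k\<^esub>\<close> is a basis element, so it is a non-zero equivariant operator.\<close>

lemma d_product:
  assumes I: "I \<subseteq> {..<n}"
  obtains \<omega> where "\<omega> \<in> forms K n" "\<omega> \<noteq> 0" "diff_op K n \<omega> \<in> equivariant_ops K n G"
    "\<And>\<eta>. \<eta> \<in> forms K n \<Longrightarrow> diff_op K n \<omega> \<eta> = foldr d (sorted_list_of_set I) \<eta>"
proof -
  let ?\<Phi> = "\<lambda>c. \<lambda>\<eta> \<in> forms K n. lin_ext (\<lambda>\<alpha> I. op_product f d \<alpha> I \<eta>) c"
  have bij: "bij_betw ?\<Phi> (forms K n) (equivariant_ops K n G)"
    using ops unfolding orlik_solomon_ops_def by blast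
  have b: "basis_form 0 I \<in> forms K n" by (rule basis_in_forms[OF _ I]) simp
  have "?\<Phi> (basis_form 0 I) \<in> equivariant_ops K n G"
    using bij b by (rule bij_betwE[rule_format])
  moreover from this obtain \<omega> where om: "\<omega> \<in> forms K n" "?\<Phi> (basis_form 0 I) = diff_op K n \<omega>"
    unfolding equivariant_ops_def by blast
  ultimately have "diff_op K n \<omega> \<in> equivariant_ops K n G" by simp
  moreover have "diff_op K n \<omega> \<eta> = foldr d (sorted_list_of_set I) \<eta>" if "\<eta> \<in> forms K n" for \<eta>
    unfolding om(2)[symmetric] using that by (simp add: op_product_def)
  moreover have "\<omega> \<noteq> 0"
  proof
    assume "\<omega> = 0"
    then have "?\<Phi> (basis_form 0 I) = ?\<Phi> 0" unfolding om(2) by (simp add: diff_op_def restrict_def fun_eq_iff)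
    then have "basis_form 0 I = 0"
      using bij b zero_in_forms unfolding bij_betw_def by (meson inj_onD)
    then show False by (metis keys_basis_form insert_not_empty keys_zero)
  qed
  ultimately show ?thesis using that om(1) by blast
qed

lemma d_sequence:
  assumes xs: "set xs \<subseteq> {..<n}" and eta: "\<eta> \<in> forms K n" "bihomogeneous i k \<eta>"
  shows "foldr d xs \<eta> \<in> forms K n
    \<and> bihomogeneous (i - (\<Sum>j\<leftarrow>xs. int (e j))) (length xs + k) (foldr d xs \<eta>)"
  using xs
proof (induction xs)
  case Nil
  then show ?case using eta by simp
next
  case (Cons j xs)
  then have IH: "foldr d xs \<eta> \<in> forms K n"
    "bihomogeneous (i - (\<Sum>j\<leftarrow>xs. int (e j))) (length xs + k) (foldr d xs \<eta>)" by simp_all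
  have "j < n" using Cons.prems by simp
  then obtain \<omega> where om: "\<omega> \<in> forms K n" "bihomogeneous (int (e j)) 1 \<omega>" "d j = diff_op K n \<omega>"
    by (rule d_diff_op)
  show ?case
    using diff_op_in_forms[OF om(1) IH(1)] diff_op_bihomogeneous[OF om(1,2) IH]
    by (simp add: om(3) algebra_simps)
qed

text \<open>Whether \<open>\<theta>\<^sub>J \<partial>\<^sup>\<beta>\<close> occurs in the operator is visible from the constant coefficient of its value at
  \<open>x\<^sup>\<beta>\<close>, and the factors \<open>d\<^sub>i\<close> determine the bidegree of this value.\<close>

lemma d_product_key:
  assumes I: "I \<subseteq> {..<n}"
  obtains \<omega> \<beta> J where "\<omega> \<in> forms K n" "diff_op K n \<omega> \<in> equivariant_ops K n G" "(\<beta>, J) \<in> ks \<omega>"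
    "card J = card I" "xdeg \<beta> = (\<Sum>j\<in>I. e j)"
proof -
  obtain \<omega> where om: "\<omega> \<in> forms K n" "\<omega> \<noteq> 0" "diff_op K n \<omega> \<in> equivariant_ops K n G"
    and D: "\<And>\<eta>. \<eta> \<in> forms K n \<Longrightarrow> diff_op K n \<omega> \<eta> = foldr d (sorted_list_of_set I) \<eta>"
    by (rule d_product[OF I]) (rule that; assumption)
  from om(2) have "ks \<omega> \<noteq> {}" by simp
  then obtain \<beta> J where key: "(\<beta>, J) \<in> ks \<omega>" by fastforce
  note kD = forms_keysD[OF om(1) key]
  let ?x = "basis_form \<beta> {}"
  have x: "?x \<in> forms K n" using kD(1) by (rule basis_in_forms) simp
  have finI: "finite I" using I by (rule finite_subset) simp
  have bih: "bihomogeneous (int (xdeg \<beta>)) 0 ?x" by (simp add: bihomogeneous_def)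
  have "bihomogeneous (int (xdeg \<beta>) - (\<Sum>j\<leftarrow>sorted_list_of_set I. int (e j)))
      (length (sorted_list_of_set I) + 0) (diff_op K n \<omega> ?x)"
    unfolding D[OF x] using d_sequence[OF _ x bih, of "sorted_list_of_set I"] I finI by simp
  moreover have "(0, J) \<in> ks (diff_op K n \<omega> ?x)"
    using key unfolding in_keys_iff diff_op_on_monomial[OF kD(1)] by simp
  ultimately have "int (xdeg (0::nat \<Rightarrow>\<^sub>0 nat)) = int (xdeg \<beta>) - (\<Sum>j\<leftarrow>sorted_list_of_set I. int (e j))
      \<and> card J = length (sorted_list_of_set I) + 0"
    unfolding bihomogeneous_def by blast
  moreover have "(\<Sum>j\<leftarrow>sorted_list_of_set I. int (e j)) = int (\<Sum>j\<in>I. e j)"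
    using finI by (simp add: sum_list_distinct_conv_sum_set)
  ultimately have "int 0 = int (xdeg \<beta>) - int (\<Sum>j\<in>I. e j)" "card J = card I"
    using finI by (simp_all only: xdeg_zero length_sorted_list_of_set add_0_right)
  then have "xdeg \<beta> = (\<Sum>j\<in>I. e j)" "card J = card I" by linarith+
  then show ?thesis using that[OF om(1,3) key] by simp
qed

text \<open>A co-exponent \<open>0\<close> would come from an invariant one-form with constant coefficients, but no \<open>\<theta>\<^sub>j\<close> is
  fixed by all diagonal matrices of the group.\<close>

lemma coexponent_positive:
  assumes i: "i < n"
  shows "0 < e i"
proof (rule ccontr)
  assume "\<not> 0 < e i"
  moreover obtain \<omega> \<beta> J where om: "\<omega> \<in> forms K n" "diff_op K n \<omega> \<in> equivariant_ops K n G"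
    and key: "(\<beta>, J) \<in> ks \<omega>" and J: "card J = card {i}" "xdeg \<beta> = (\<Sum>j\<in>{i}. e j)"
    by (rule d_product_key[of "{i}"]) (use i in auto)
  ultimately have "xdeg \<beta> = 0" by simp
  then have b0: "lk \<beta> l = 0" for l
    unfolding xdeg_def by (cases "l \<in> ks \<beta>") (simp_all add: in_keys_iff)
  obtain j where j: "J = {j}" using J(1) by (auto simp: card_1_singleton_iff)
  have jn: "j < n" using forms_keysD(2)[OF om(1) key] j by simp
  define l where "l = (if j = 0 then 1 else 0 :: nat)"
  have l: "l < n" "l \<noteq> j" using n_ge by (auto simp: l_def)
  have "(m - 1) mod m = 0"
    using equivariant_key_exponents(1)[OF om(2,1) key jn l(1)] l(2) b0 j by simp
  then show False using m_ge by simp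
qed

lemma coexponent_sum_ge: "m * (\<Sum>i<n. i) + (if q = 1 then 0 else n) \<le> (\<Sum>i<n. e i)"
proof -
  obtain \<omega> \<beta> J where om: "\<omega> \<in> forms K n" "diff_op K n \<omega> \<in> equivariant_ops K n G"
    and key: "(\<beta>, J) \<in> ks \<omega>" and J: "card J = card {..<n}" "xdeg \<beta> = (\<Sum>j\<in>{..<n}. e j)"
    by (rule d_product_key[of "{..<n}"]) auto
  have "J = {..<n}" using forms_keysD(2)[OF om(1) key] J(1) by (intro card_top) simp_all
  then have "(\<beta>, {..<n}) \<in> ks \<omega>" using key by simp
  from equivariant_top_key_degree[OF om(2,1) this] show ?thesis unfolding J(2) .
qed

end

lemma coexponents_sum_ge:
  assumes "coexponents K n G es"
  shows "m * (\<Sum>i<n. i) + (if q = 1 then 0 else n) \<le> (\<Sum>j<n. es ! j)"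
proof -
  obtain f d e where ops: "orlik_solomon_ops K n G f d e"
    and es: "es = sort (filter (\<lambda>a. 0 < a) (map e [0..<n]))"
    using assms unfolding coexponents_def by blast
  have "filter (\<lambda>a. 0 < a) (map e [0..<n]) = map e [0..<n]"
    by (rule filter_True) (use coexponent_positive[OF ops] in auto)
  then have es': "es = sort (map e [0..<n])" using es by simp
  have "(\<Sum>j<n. es ! j) = sum_list es"
    by (simp add: sum_list_sum_nth es' lessThan_atLeast0)
  also have "\<dots> = sum_mset (mset (map e [0..<n]))" unfolding es' by (simp add: sum_mset_sum_list[symmetric] del: mset_map)
  also have "\<dots> = (\<Sum>i<n. e i)"
    unfolding sum_mset_sum_list by (simp add: interv_sum_list_conv_sum_set_nat lessThan_atLeast0)
  finally show ?thesis using coexponent_sum_ge[OF ops] by simp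
qed

text \<open>The formula would put the top degree of the top component at \<open>deg \<Delta> - \<Sum> e\<^sub>i\<^sup>*\<close>, which the two
  degree bounds keep down to the strictly smaller \<open>n (q - 2)\<close>.\<close>

lemma degree_formula_fails:
  assumes Delta: "is_Delta K n G \<Delta>" and es: "coexponents K n G es"
  shows "\<not> (\<forall>i::int. SH_comp K n G i n \<noteq> {0} \<longleftrightarrow>
             0 \<le> i \<and> i \<le> int (x_degree \<Delta>) - (\<Sum>j<n. int (es ! j)))"
proof
  assume "\<forall>i::int. SH_comp K n G i n \<noteq> {0} \<longleftrightarrow>
             0 \<le> i \<and> i \<le> int (x_degree \<Delta>) - (\<Sum>j<n. int (es ! j))"
  moreover have "SH_comp K n G (int top_deg) n \<noteq> {0}"
    using top_degree_full unfolding is_top_degree_def by blast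
  ultimately have "int top_deg \<le> int (x_degree \<Delta>) - (\<Sum>j<n. int (es ! j))" by blast
  then have "top_deg + (\<Sum>j<n. es ! j) \<le> x_degree \<Delta>"
    unfolding of_nat_sum[symmetric] by linarith
  then have 1: "top_deg + n + (if q = 1 then 0 else n) \<le> n * q"
    using coexponents_sum_ge[OF es] Delta_degree_le[OF Delta] by linarith
  have 2: "n * (q - 2) < top_deg" by (rule det_deg_less_top_deg)
  show False
  proof (cases "q = 1")
    case True
    then show False using 1 2 by simp
  next
    case False
    then have "q = (q - 2) + 2" using q_ge by simp
    then have "n * q = n * (q - 2) + 2 * n" by (metis add_mult_distrib2 mult.commute)
    then show False using 1 2 False by simp
  qed
qed

end

theorem lemma3p8:
  fixes K :: "complex set" and m p n r :: nat and G :: "complex mat set"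
  assumes "subfield K class_ring"
    and "\<forall>z\<in>K. cnj z \<in> K"
    and "\<forall>z. z ^ m = 1 \<longrightarrow> z \<in> K"
    and "m \<ge> 1" and "n \<ge> 1" and "p dvd m"
    and "G = imprim_group m p n"
    and "r = refl_rank K n G"
    and "\<not> (m = 1 \<and> p = 1)"
    and "\<not> (m = 2 \<and> p = 1)"
    and "\<not> (m = 2 \<and> p = 2)"
    and "n \<noteq> 1"
    and "\<not> (p = m \<and> n = 2)"
    and "p \<noteq> 1"
  shows "r = n \<and>
    (\<forall>f \<Gamma>. basic_invariants K n G f \<longrightarrow> is_Gamma K n G \<Gamma> \<longrightarrow>
       Ann K n \<Gamma> \<noteq> jacobian_ideal K n f) \<and>
    SH K n G r \<noteq> diff_closure K n (SH_det K n G r) \<and>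
    (\<exists>s t. is_top_degree (\<lambda>i. SH_comp K n G i r \<inter> SH_det K n G r) s \<and>
           is_top_degree (\<lambda>i. SH_comp K n G i r) t \<and> s < t) \<and>
    (\<forall>\<Delta> es. is_Delta K n G \<Delta> \<longrightarrow> coexponents K n G es \<longrightarrow>
       \<not> (\<forall>i::int. SH_comp K n G i r \<noteq> {0} \<longleftrightarrow>
             0 \<le> i \<and> i \<le> int (x_degree \<Delta>) - (\<Sum>j<r. int (es ! j))))"
proof -
  obtain q where q: "m = p * q" using assms(6) by (rule dvdE)
  have p2: "2 \<le> p" using q assms(4,14) by (cases p) auto
  have "p \<le> m" using assms(4,6) by (simp add: dvd_imp_le)
  then have m3: "3 \<le> m" using p2 assms(11) by (cases "m = 2") auto
  interpret I: imprimitive K m p q n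
  proof (rule imprimitive.intro)
    show "subfield K class_ring" by (rule assms(1))
    show "cnj z \<in> K" if "z \<in> K" for z using assms(2) that by blast
    show "z \<in> K" if "z ^ m = 1" for z using assms(3) that by blast
    show "2 \<le> n" using assms(5,12) by simp
    show "3 \<le> n" if "q = 1" using assms(5,12,13) q that by simp
  qed (fact q m3 p2)+
  have r: "r = n" unfolding assms(8,7) by (rule I.refl_rank_eq)
  have "\<exists>s t. is_top_degree (\<lambda>i. SH_comp K n I.G i n \<inter> SH_det K n I.G n) s \<and>
         is_top_degree (\<lambda>i. SH_comp K n I.G i n) t \<and> s < t"
    using I.top_degree_det I.top_degree_full I.det_deg_less_top_deg by (metis of_nat_less_iff)
  then show ?thesis
    unfolding r assms(7)
    by (intro conjI allI impI refl I.Ann_neq_jacobian_ideal I.SH_neq_diff_closure I.degree_formula_fails)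
qed

end
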